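(* Let $\mathbf F=\{F_\gamma:\gamma\in T^*\}$ be a weight system for the cascade generator $\{W_\gamma:\gamma\in T^*\}$, with weighted cascade $Q_{\mathbf F,n}(t)$. Let $\beta\ge0$ and let $\{B_\gamma:\gamma\in T^*,\ |\gamma|\ge1\}$ be i.i.d. random variables, independent of $\{W_\gamma:\gamma\in T^*\}$, with $$B_\gamma=\begin{cases}b^\beta&\text{with probability }b^{-\beta},\\0&\text{with probability }1-b^{-\beta},\end{cases}$$ and let $Q_{\beta,n}(t)=\prod_{j=1}^nB_{t|j}$ ($t\in T$) be the corresponding cascade ($\beta$-model). Then $Q_n(t):=Q_{\beta,n}(t)Q_{\mathbf F,n}(t)$ is a weighted cascade, with weights $\mathbf F_\beta$ defined by $$(F_\beta)_\gamma:=\Big(\prod_{j=1}^{|\gamma|}B_{\gamma|j}\Big)F_\gamma,\qquad\gamma\in T^*,$$ and for every $\sigma\in M^+(T)$ $$Q_\infty\sigma=Q_{\beta,\infty}(Q_{\mathbf F,\infty}\sigma)\quad\text{a.s.}$$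
   Context: Tree. Fix an integer $b\ge2$. $T=\{0,\dots,b-1\}^{\mathbb N}$ with the product topology (a compact metric space). $M^+(T)$ is the space of positive (finite) Borel measures on $T$. $T^*$ is the set of all finite words over $\{0,\dots,b-1\}$, including the empty word $\emptyset$ (the root). $|\gamma|$ is the length of $\gamma\in T^*$. For $t\in T$, $t|n=(t_1,\dots,t_n)$, $t|0=\emptyset$; for $\gamma\in T^*$ and $j\le|\gamma|$, $\gamma|j$ is the prefix of length $j$. Cascade generator. Given a probability measure $p_0(dx)$ on $[0,\infty)$ and transition probability kernels $q_n(dx|x_0,\dots,x_{n-1})$, $n\ge1$, on $[0,\infty)$, each of mean one, $\{W_\gamma:\gamma\in T^*\}$ are nonnegative random variables such that, with $\mathcal F_n=\sigma\{W_\gamma:|\gamma|\le n\}$: $W_\emptyset$ has law $p_0$; for every $t\in T$ and $n\ge0$ the conditional law of $W_{t|n+1}$ given $\mathcal F_n$ is $q_{n+1}(dx|W_{t|0},\dots,W_{t|n})$; and the variables $W_\gamma$, $|\gamma|=n+1$, are conditionally independent given $\mathcal F_n$. Positive $T$-martingale (with respect to a filtration $(\mathcal G_n)$). A sequence $\{Q_n(t)\}$ of nonnegative random functions on $T$, almost surely Borel in $t$, such that for every $t\in T$, $\{Q_n(t)\}_n$ is a martingale with respect to $(\mathcal G_n)$. For $\sigma\in M^+(T)$, $Q_n\sigma$ is the random measure with $dQ_n\sigma/d\sigma=Q_n(t)$, and $Q_\infty\sigma$ is the random Borel measure that is the a.s. weak limit of $Q_n\sigma$ as $n\to\infty$ (it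 exists by martingale convergence). Weight system. A family $\mathbf F=\{F_\gamma:\gamma\in T^*\}$ of $[0,\infty)$-valued random variables, $F_\gamma$ measurable with respect to $\sigma\{W_{\gamma|j}:0\le j\le|\gamma|\}$, such that $Q_{\mathbf F,n}(t)=\big(\prod_{j=0}^nW_{t|j}\big)F_{t|n}$ is a positive $T$-martingale with respect to $(\mathcal F_n)$; $Q_{\mathbf F,n}$ is then called a weighted cascade. Standing assumption: $E[W_\emptyset F_\emptyset]>0$. In the claim, everything is defined on a common probability space carrying $\{W_\gamma\}$ and $\{B_\gamma\}$. "$Q_n$ is a weighted cascade with weights $\mathbf F_\beta$" means that $(F_\beta)_\gamma$ is nonnegative and measurable with respect to the $\sigma$-field generated by $W_{\gamma|j}$ ($0\le j\le|\gamma|$) and $B_{\gamma|j}$ ($1\le j\le|\gamma|$), and that $Q_n(t)=\big(\prod_{j=0}^nW_{t|j}\big)(F_\beta)_{t|n}$ is a positive $T$-martingale with respect to $\sigma\{W_\gamma:|\gamma|\le n\}\vee\sigma\{B_\gamma:1\le|\gamma|\le n\}$. The random measure $Q_{\beta,\infty}(Q_{\mathbf F,\infty}\sigma)$ is the a.s. weak limit as $m\to\infty$ of the measures $Q_{\beta,m}(t)\,(Q_{\mathbf F,\infty}\sigma)(dt)$. *)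

theory Defs
  imports "HOL-Probability.Probability"
begin

section \<open>The tree and its boundary\<close>

text \<open>Points of \<open>T\<close> are indexed from \<open>0\<close>, so the coordinate \<open>t\<^sub>i\<close> of the mathematics is
  \<open>t (i - 1)\<close>. The ambient type \<open>nat \<Rightarrow> nat\<close> carries the product topology of the discrete one.\<close>

definition boundary :: "nat \<Rightarrow> (nat \<Rightarrow> nat) set" where
  "boundary b = {t. \<forall>i. t i < b}"

definition words :: "nat \<Rightarrow> nat list set" where
  "words b = {\<gamma>. set \<gamma> \<subseteq> {..<b}}"

definition tprefix :: "(nat \<Rightarrow> nat) \<Rightarrow> nat \<Rightarrow> nat list" where
  "tprefix t n = map t [0..<n]"

definition borel_boundary :: "nat \<Rightarrow> (nat \<Rightarrow> nat) measure" where
  "borel_boundary b = restrict_space borel (boundary b)"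

definition finite_borel_measures :: "nat \<Rightarrow> (nat \<Rightarrow> nat) measure set" where
  "finite_borel_measures b = {\<mu>. sets \<mu> = sets (borel_boundary b) \<and> finite_measure \<mu>}"

text \<open>Every continuous function on the boundary is bounded, since the boundary is compact.\<close>

definition weakly_converges ::
    "nat \<Rightarrow> (nat \<Rightarrow> (nat \<Rightarrow> nat) measure) \<Rightarrow> (nat \<Rightarrow> nat) measure \<Rightarrow> bool" where
  "weakly_converges b \<mu>s \<mu> \<longleftrightarrow>
     (\<forall>f :: (nat \<Rightarrow> nat) \<Rightarrow> real. continuous_on (boundary b) f \<longrightarrow>
        (\<lambda>n. \<integral>t. f t \<partial>\<mu>s n) \<longlonglongrightarrow> (\<integral>t. f t \<partial>\<mu>))"

text \<open>The null measure is only a default value, used where there is no weak limit.\<close>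

definition weak_limit :: "nat \<Rightarrow> (nat \<Rightarrow> (nat \<Rightarrow> nat) measure) \<Rightarrow> (nat \<Rightarrow> nat) measure" where
  "weak_limit b \<mu>s =
     (if \<exists>\<mu>\<in>finite_borel_measures b. weakly_converges b \<mu>s \<mu>
      then THE \<mu>. \<mu> \<in> finite_borel_measures b \<and> weakly_converges b \<mu>s \<mu>
      else null_measure (borel_boundary b))"


section \<open>Generated sigma-algebras, conditional independence, martingales\<close>

definition nonneg_borel :: "real measure" where
  "nonneg_borel = restrict_space borel {0..}"

definition sigma_rvs :: "'a measure \<Rightarrow> 'i set \<Rightarrow> ('i \<Rightarrow> 'a \<Rightarrow> real) \<Rightarrow> 'a measure" where
  "sigma_rvs M I X =
     sigma (space M) (\<Union>i\<in>I. {X i -` A \<inter> space M |A. A \<in> sets nonneg_borel})"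

text \<open>Only the sigma-algebra of this measure matters, as for \<open>sigma_rvs\<close>.\<close>

definition sigma_join :: "'a measure \<Rightarrow> 'a measure \<Rightarrow> 'a measure \<Rightarrow> 'a measure" where
  "sigma_join M F G = sigma (space M) (sets F \<union> sets G)"

definition cond_indep_vars ::
    "'a measure \<Rightarrow> 'a measure \<Rightarrow> 'i set \<Rightarrow> ('i \<Rightarrow> 'a \<Rightarrow> real) \<Rightarrow> bool" where
  "cond_indep_vars M F I X \<longleftrightarrow>
     (\<forall>J A. finite J \<longrightarrow> J \<subseteq> I \<longrightarrow> (\<forall>i\<in>J. A i \<in> sets nonneg_borel) \<longrightarrow>
        (AE \<omega> in M. real_cond_exp M F (\<lambda>\<omega>. \<Prod>i\<in>J. indicator (A i) (X i \<omega>)) \<omega>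
                  = (\<Prod>i\<in>J. real_cond_exp M F (\<lambda>\<omega>. indicator (A i) (X i \<omega>)) \<omega>)))"

definition martingale :: "'a measure \<Rightarrow> (nat \<Rightarrow> 'a measure) \<Rightarrow> (nat \<Rightarrow> 'a \<Rightarrow> real) \<Rightarrow> bool" where
  "martingale M G X \<longleftrightarrow>
     filtration (space M) G \<and> (\<forall>n. subalgebra M (G n)) \<and>
     (\<forall>n. X n \<in> borel_measurable (G n) \<and> integrable M (X n)) \<and>
     (\<forall>m n. m \<le> n \<longrightarrow> (AE \<omega> in M. real_cond_exp M (G m) (X n) \<omega> = X m \<omega>))"

definition positive_T_martingale ::
    "nat \<Rightarrow> 'a measure \<Rightarrow> (nat \<Rightarrow> 'a measure) \<Rightarrow> (nat \<Rightarrow> (nat \<Rightarrow> nat) \<Rightarrow> 'a \<Rightarrow> real) \<Rightarrow> bool" where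
  "positive_T_martingale b M G Q \<longleftrightarrow>
     (\<forall>n. \<forall>t\<in>boundary b. \<forall>\<omega>\<in>space M. 0 \<le> Q n t \<omega>) \<and>
     (AE \<omega> in M. \<forall>n. (\<lambda>t. Q n t \<omega>) \<in> borel_measurable (borel_boundary b)) \<and>
     (\<forall>t\<in>boundary b. martingale M G (\<lambda>n. Q n t))"

definition Q_measure ::
    "(nat \<Rightarrow> (nat \<Rightarrow> nat) \<Rightarrow> 'a \<Rightarrow> real) \<Rightarrow> nat \<Rightarrow> (nat \<Rightarrow> nat) measure \<Rightarrow> 'a \<Rightarrow> (nat \<Rightarrow> nat) measure" where
  "Q_measure Q n \<sigma> \<omega> = density \<sigma> (\<lambda>t. ennreal (Q n t \<omega>))"

definition Q_infinity ::
    "nat \<Rightarrow> (nat \<Rightarrow> (nat \<Rightarrow> nat) \<Rightarrow> 'a \<Rightarrow> real) \<Rightarrow> (nat \<Rightarrow> nat) measure \<Rightarrow> 'a \<Rightarrow> (nat \<Rightarrow> nat) measure" where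
  "Q_infinity b Q \<sigma> \<omega> = weak_limit b (\<lambda>n. Q_measure Q n \<sigma> \<omega>)"


section \<open>Cascades\<close>

definition W_filtration :: "nat \<Rightarrow> 'a measure \<Rightarrow> (nat list \<Rightarrow> 'a \<Rightarrow> real) \<Rightarrow> nat \<Rightarrow> 'a measure" where
  "W_filtration b M W n = sigma_rvs M {\<gamma>\<in>words b. length \<gamma> \<le> n} W"

definition W_path_sigma :: "'a measure \<Rightarrow> (nat list \<Rightarrow> 'a \<Rightarrow> real) \<Rightarrow> nat list \<Rightarrow> 'a measure" where
  "W_path_sigma M W \<gamma> = sigma_rvs M {take j \<gamma> |j. j \<le> length \<gamma>} W"

definition WB_filtration :: "nat \<Rightarrow> 'a measure \<Rightarrow> (nat list \<Rightarrow> 'a \<Rightarrow> real) \<Rightarrow>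
    (nat list \<Rightarrow> 'a \<Rightarrow> real) \<Rightarrow> nat \<Rightarrow> 'a measure" where
  "WB_filtration b M W B n =
     sigma_join M (W_filtration b M W n)
       (sigma_rvs M {\<gamma>\<in>words b. 1 \<le> length \<gamma> \<and> length \<gamma> \<le> n} B)"

definition WB_path_sigma :: "'a measure \<Rightarrow> (nat list \<Rightarrow> 'a \<Rightarrow> real) \<Rightarrow>
    (nat list \<Rightarrow> 'a \<Rightarrow> real) \<Rightarrow> nat list \<Rightarrow> 'a measure" where
  "WB_path_sigma M W B \<gamma> =
     sigma_join M (W_path_sigma M W \<gamma>)
       (sigma_rvs M {take j \<gamma> |j. 1 \<le> j \<and> j \<le> length \<gamma>} B)"

text \<open>A kernel \<open>q n\<close> takes its arguments \<open>x\<^sub>0, \<dots>, x\<^bsub>n-1\<^esub>\<close> as a function on \<open>{..<n}\<close>; the value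
  \<open>q 0\<close> is irrelevant.\<close>

definition cascade_generator :: "nat \<Rightarrow> 'a measure \<Rightarrow> real measure \<Rightarrow>
    (nat \<Rightarrow> (nat \<Rightarrow> real) \<Rightarrow> real measure) \<Rightarrow> (nat list \<Rightarrow> 'a \<Rightarrow> real) \<Rightarrow> bool" where
  "cascade_generator b M p0 q W \<longleftrightarrow>
     p0 \<in> space (prob_algebra nonneg_borel) \<and>
     has_bochner_integral p0 (\<lambda>x. x) 1 \<and>
     (\<forall>n\<ge>1. q n \<in> PiM {..<n} (\<lambda>_. nonneg_borel) \<rightarrow>\<^sub>M prob_algebra nonneg_borel) \<and>
     (\<forall>n\<ge>1. \<forall>x\<in>space (PiM {..<n} (\<lambda>_. nonneg_borel)). has_bochner_integral (q n x) (\<lambda>y. y) 1) \<and>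
     (\<forall>\<gamma>\<in>words b. W \<gamma> \<in> M \<rightarrow>\<^sub>M nonneg_borel) \<and>
     distr M nonneg_borel (W []) = p0 \<and>
     (\<forall>t\<in>boundary b. \<forall>n. \<forall>A\<in>sets nonneg_borel.
        AE \<omega> in M. real_cond_exp M (W_filtration b M W n)
                     (\<lambda>\<omega>. indicator A (W (tprefix t (Suc n)) \<omega>)) \<omega>
                 = measure (q (Suc n) (\<lambda>j\<in>{..<Suc n}. W (tprefix t j) \<omega>)) A) \<and>
     (\<forall>n. cond_indep_vars M (W_filtration b M W n) {\<gamma>\<in>words b. length \<gamma> = Suc n} W)"

text \<open>\<open>Q\<close> is a weighted cascade with weights \<open>F\<close>. The parameters \<open>H\<close> and \<open>G\<close> are the path
  sigma-algebras to which the weights are adapted and the filtration of the martingale property.\<close>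

definition weighted_cascade :: "nat \<Rightarrow> 'a measure \<Rightarrow> (nat list \<Rightarrow> 'a measure) \<Rightarrow> (nat \<Rightarrow> 'a measure) \<Rightarrow>
    (nat list \<Rightarrow> 'a \<Rightarrow> real) \<Rightarrow> (nat list \<Rightarrow> 'a \<Rightarrow> real) \<Rightarrow>
    (nat \<Rightarrow> (nat \<Rightarrow> nat) \<Rightarrow> 'a \<Rightarrow> real) \<Rightarrow> bool" where
  "weighted_cascade b M H G W F Q \<longleftrightarrow>
     (\<forall>\<gamma>\<in>words b. F \<gamma> \<in> H \<gamma> \<rightarrow>\<^sub>M nonneg_borel) \<and>
     (\<forall>n. \<forall>t\<in>boundary b. \<forall>\<omega>\<in>space M.
        Q n t \<omega> = (\<Prod>j=0..n. W (tprefix t j) \<omega>) * F (tprefix t n) \<omega>) \<and>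
     positive_T_martingale b M G Q"

text \<open>\<open>b powr \<beta>\<close> is nonzero, so for \<open>\<beta> = 0\<close> the two clauses on probabilities say \<open>B \<gamma> = 1\<close>
  almost surely.\<close>

definition beta_generator :: "nat \<Rightarrow> 'a measure \<Rightarrow> real \<Rightarrow> (nat list \<Rightarrow> 'a \<Rightarrow> real) \<Rightarrow> bool" where
  "beta_generator b M \<beta> B \<longleftrightarrow>
     prob_space.indep_vars M (\<lambda>_. nonneg_borel) B {\<gamma>\<in>words b. 1 \<le> length \<gamma>} \<and>
     (\<forall>\<gamma>\<in>words b. 1 \<le> length \<gamma> \<longrightarrow>
        measure M {\<omega>\<in>space M. B \<gamma> \<omega> = real b powr \<beta>} = real b powr (- \<beta>) \<and>
        measure M {\<omega>\<in>space M. B \<gamma> \<omega> = 0} = 1 - real b powr (- \<beta>))"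

definition beta_cascade ::
    "(nat list \<Rightarrow> 'a \<Rightarrow> real) \<Rightarrow> nat \<Rightarrow> (nat \<Rightarrow> nat) \<Rightarrow> 'a \<Rightarrow> real" where
  "beta_cascade B n t \<omega> = (\<Prod>j=1..n. B (tprefix t j) \<omega>)"

definition beta_weights ::
    "(nat list \<Rightarrow> 'a \<Rightarrow> real) \<Rightarrow> (nat list \<Rightarrow> 'a \<Rightarrow> real) \<Rightarrow> nat list \<Rightarrow> 'a \<Rightarrow> real" where
  "beta_weights B F \<gamma> \<omega> = (\<Prod>j=1..length \<gamma>. B (take j \<gamma>) \<omega>) * F \<gamma> \<omega>"

end

theory Submission
  imports Defs
begin

text \<open>
  Fix a measure \<open>\<sigma>\<close> and a word \<open>\<gamma>\<close>, let \<open>[\<gamma>]\<close> be the set of the points with prefix \<open>\<gamma>\<close>, and put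
  \<open>Z\<^bsub>m,n\<^esub> = \<integral>\<^bsub>[\<gamma>]\<^esub> Q\<^bsub>\<beta>,m\<^esub>(t) Q\<^bsub>F,n\<^esub>(t) \<sigma>(dt)\<close>. The mass that \<open>Q\<^sub>n\<sigma>\<close> gives to \<open>[\<gamma>]\<close> is the
  diagonal term \<open>Z\<^bsub>n,n\<^esub>\<close>, while the mass that \<open>Q\<^bsub>\<beta>,\<infinity>\<^esub>(Q\<^bsub>F,\<infinity>\<^esub>\<sigma>)\<close> gives to it is the iterated
  limit of \<open>Z\<^bsub>m,n\<^esub>\<close>, first in \<open>n\<close> and then in \<open>m\<close>. So the claim is that the diagonal limit and the
  iterated limit agree almost surely. Since there are only countably many words, and since a finite
  measure on the boundary is determined by the masses of the cylinders \<open>[\<gamma>]\<close>, this gives the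
  equality of the two random measures.

  Because \<open>W\<close> and \<open>B\<close> are independent, \<open>Z\<close> is a martingale in \<open>m\<close> even when all of \<open>W\<close> is
  revealed, and a martingale in \<open>n\<close> even when all of \<open>B\<close> is revealed (\<open>cond_eq_mult_indep\<close>,
  \<open>cond_eq_mass\<close>). Nonnegative supermartingales converge almost surely, so
  \<open>Y\<^sub>m = lim\<^sub>n Z\<^bsub>m,n\<^esub>\<close>, \<open>Y = lim\<^sub>m Y\<^sub>m\<close> and \<open>D = lim\<^sub>n Z\<^bsub>n,n\<^esub>\<close> exist. None of these limits need
  hold in \<open>L\<^sup>1\<close>: a cascade may die out while its expectation stays constant. The identity \<open>Y = D\<close>
  therefore comes from two inequalities, each of which only uses Fatou's lemma
  (\<open>two_parameter_martingale_limits\<close>). Given all of \<open>W\<close> and the first \<open>m\<close> generations of \<open>B\<close>, the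
  conditional expectation of \<open>Z\<^bsub>n,n\<^esub>\<close> is \<open>Z\<^bsub>m,n\<^esub>\<close> for \<open>n \<ge> m\<close>, so that of \<open>D\<close> is at most \<open>Y\<^sub>m\<close>; letting
  \<open>m \<rightarrow> \<infinity>\<close> reveals \<open>D\<close> and gives \<open>D \<le> Y\<close>. Given the first \<open>n\<close> generations of both families, the
  conditional expectation of \<open>Z\<^bsub>m,k\<^esub>\<close> is \<open>Z\<^bsub>n,n\<^esub>\<close> for \<open>m, k \<ge> n\<close>, so that of \<open>Y\<close> is at most \<open>Z\<^bsub>n,n\<^esub>\<close>;
  letting \<open>n \<rightarrow> \<infinity>\<close> reveals \<open>Y\<close> and gives \<open>Y \<le> D\<close>. Passing to the limit in the conditioning is
  \<open>cond_le_limit_imp_le\<close>, a form of Levy's upward theorem.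

  Convergence of the masses of all cylinders is the same as weak convergence, because a continuous
  function on the compact boundary is uniformly close to a function of a finite prefix; the limit
  measure is the image of Lebesgue measure on an interval that is cut up according to the limiting
  masses (\<open>weak_limit_if_cylinders_converge\<close>). That \<open>Q\<^sub>n\<close> is itself a weighted cascade is the
  two martingale properties applied one after the other.
\<close>

section \<open>Inequalities between conditional expectations\<close>

text \<open>\<open>cond_le M G X Y\<close> is \<open>E[X | G] \<le> E[Y | G]\<close> for nonnegative \<open>X\<close> and \<open>Y\<close>. Testing against the
  events of \<open>G\<close> with the Lebesgue integral on \<open>[0, \<infinity>]\<close> makes sense without integrability, and it
  is the form in which Fatou's lemma applies.\<close>

definition cond_le :: "'a measure \<Rightarrow> 'a measure \<Rightarrow> ('a \<Rightarrow> real) \<Rightarrow> ('a \<Rightarrow> real) \<Rightarrow> bool" where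
  "cond_le M G X Y \<longleftrightarrow>
     (\<forall>A\<in>sets G. (\<integral>\<^sup>+x\<in>A. ennreal (X x) \<partial>M) \<le> (\<integral>\<^sup>+x\<in>A. ennreal (Y x) \<partial>M))"

definition cond_eq :: "'a measure \<Rightarrow> 'a measure \<Rightarrow> ('a \<Rightarrow> real) \<Rightarrow> ('a \<Rightarrow> real) \<Rightarrow> bool" where
  "cond_eq M G X Y \<longleftrightarrow>
     (\<forall>A\<in>sets G. (\<integral>\<^sup>+x\<in>A. ennreal (X x) \<partial>M) = (\<integral>\<^sup>+x\<in>A. ennreal (Y x) \<partial>M))"

section \<open>Convergence of nonnegative supermartingales\<close>

text \<open>The strategy behind Doob's upcrossing inequality: buy when the price \<open>x\<close> falls below \<open>a\<close>, and sell
  when it exceeds \<open>c\<close>. Whether the asset is held from time \<open>n\<close> to time \<open>n + 1\<close> depends on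
  \<open>x 0, \<dots>, x n\<close> only.\<close>

fun holding :: "real \<Rightarrow> real \<Rightarrow> (nat \<Rightarrow> real) \<Rightarrow> nat \<Rightarrow> bool" where
  "holding a c x 0 = (x 0 < a)"
| "holding a c x (Suc n) = (if holding a c x n then x (Suc n) \<le> c else x (Suc n) < a)"

fun upcrossings :: "real \<Rightarrow> real \<Rightarrow> (nat \<Rightarrow> real) \<Rightarrow> nat \<Rightarrow> nat" where
  "upcrossings a c x 0 = 0"
| "upcrossings a c x (Suc n) =
     upcrossings a c x n + (if holding a c x n \<and> x (Suc n) > c then 1 else 0)"

definition gain :: "real \<Rightarrow> real \<Rightarrow> (nat \<Rightarrow> real) \<Rightarrow> nat \<Rightarrow> real" where
  "gain a c x n = (\<Sum>k<n. of_bool (holding a c x k) * (x (Suc k) - x k))"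

text \<open>Each completed purchase and sale earns at least \<open>c - a\<close>, and an open position has been bought
  below \<open>a\<close>. For nonnegative \<open>x\<close> the loss on the open position is thus at most \<open>a\<close>, whereas a
  supermartingale has nonpositive expected gain; this bounds the expected number of upcrossings.\<close>

lemma gain_ge_upcrossings:
  assumes "a < c"
  shows "(c - a) * real (upcrossings a c x n) + (if holding a c x n then x n - a else 0) \<le> gain a c x n"
proof (induction n)
  case 0
  then show ?case by (simp add: gain_def)
next
  case (Suc n)
  then show ?case using assms by (auto simp: gain_def algebra_simps split: if_splits)
qed

lemma upcrossings_mono: "m \<le> n \<Longrightarrow> upcrossings a c x m \<le> upcrossings a c x n"
  by (rule lift_Suc_mono_le[of "upcrossings a c x"]) auto

lemma upcrossings_unbounded:
  assumes low: "\<exists>\<^sub>F n in sequentially. x n < a" and high: "\<exists>\<^sub>F n in sequentially. x n > c"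
  shows "\<exists>n. upcrossings a c x n \<ge> k"
proof (induction k)
  case 0
  then show ?case by simp
next
  case (Suc k)
  then obtain n where n: "upcrossings a c x n \<ge> k" by blast
  have "\<exists>m\<ge>n. holding a c x m"
  proof (rule ccontr)
    assume no: "\<not> (\<exists>m\<ge>n. holding a c x m)"
    obtain m where m: "m \<ge> Suc n" "x m < a" using low unfolding frequently_sequentially by blast
    then obtain m' where m': "m = Suc m'" "m' \<ge> n" by (cases m) auto
    have "\<not> holding a c x m'" using no m' by simp
    then have "holding a c x m" using m m' by simp
    then show False using no m by auto
  qed
  then obtain m where m: "m \<ge> n" "holding a c x m" by blast
  have "\<exists>m'\<ge>m. holding a c x m' \<and> x (Suc m') > c"
  proof (rule ccontr)
    assume no: "\<not> (\<exists>m'\<ge>m. holding a c x m' \<and> x (Suc m') > c)"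
    have hold: "holding a c x m'" if "m' \<ge> m" for m'
      using that
    proof (induction m' rule: dec_induct)
      case base
      then show ?case using m by simp
    next
      case (step i)
      then show ?case using no by force
    qed
    obtain j where j: "j \<ge> Suc m" "x j > c" using high unfolding frequently_sequentially by blast
    then obtain j' where "j = Suc j'" "j' \<ge> m" by (cases j) auto
    then show False using hold j no by auto
  qed
  then obtain m' where m': "m' \<ge> m" "holding a c x m'" "x (Suc m') > c" by blast
  have "upcrossings a c x (Suc m') = Suc (upcrossings a c x m')" using m' by simp
  moreover have "upcrossings a c x n \<le> upcrossings a c x m'" using m m' by (intro upcrossings_mono) auto
  ultimately show ?case using n by (intro exI[of _ "Suc m'"]) simp
qed

text \<open>If the lower limit were below the upper limit, then the sequence would cross an interval with
  rational end points infinitely often. The last assumption excludes the limit \<open>\<infinity>\<close>.\<close>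

lemma convergent_if_upcrossings_bounded:
  fixes x :: "nat \<Rightarrow> real"
  assumes nonneg: "\<And>n. 0 \<le> x n"
    and bdd: "\<And>a c. a \<in> \<rat> \<Longrightarrow> c \<in> \<rat> \<Longrightarrow> a < c \<Longrightarrow> \<exists>K. \<forall>n. upcrossings a c x n \<le> K"
    and fin: "\<exists>\<^sub>F n in sequentially. x n \<le> K"
  shows "convergent x"
proof -
  let ?l = "liminf (\<lambda>n. ereal (x n))" and ?u = "limsup (\<lambda>n. ereal (x n))"
  have "\<not> ?l < ?u"
  proof
    assume "?l < ?u"
    then obtain a' where a': "?l < ereal a'" "ereal a' < ?u" using ereal_dense2 by blast
    then obtain c' where c': "ereal a' < ereal c'" "ereal c' < ?u" using ereal_dense2 by blast
    obtain c where c: "c \<in> \<rat>" "a' < c" "c < c'" using c' Rats_dense_in_real by auto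
    obtain a where a: "a \<in> \<rat>" "a' < a" "a < c" using c Rats_dense_in_real by auto
    have "?l < ereal a" using a a' by (meson less_ereal.simps(1) order_less_trans)
    then have low: "\<exists>\<^sub>F n in sequentially. x n < a"
      using Liminf_bounded[of "ereal a" "\<lambda>n. ereal (x n)" sequentially]
      unfolding frequently_def by (auto simp: not_less)
    have "ereal c < ?u" using c c' by (meson less_ereal.simps(1) order_less_trans)
    then have high: "\<exists>\<^sub>F n in sequentially. x n > c"
      using Limsup_bounded[of "\<lambda>n. ereal (x n)" "ereal c" sequentially]
      unfolding frequently_def by (auto simp: not_less)
    obtain K where "\<forall>n. upcrossings a c x n \<le> K" using bdd a c by blast
    moreover obtain n where "upcrossings a c x n \<ge> Suc K" using upcrossings_unbounded[OF low high] by blast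
    ultimately show False by (metis not_less_eq_eq)
  qed
  then have eq: "?l = ?u" using Liminf_le_Limsup[of sequentially "\<lambda>n. ereal (x n)"] by (simp add: antisym_conv2)
  then have lim: "(\<lambda>n. ereal (x n)) \<longlonglongrightarrow> ?l" by (simp add: tendsto_iff_Liminf_eq_Limsup)
  have "?l \<noteq> \<infinity>"
  proof
    assume "?l = \<infinity>"
    then have "\<forall>\<^sub>F n in sequentially. x n > K"
      using lim by (auto simp: tendsto_PInfty)
    then show False using fin unfolding frequently_def by (auto simp: not_le)
  qed
  moreover have "?l \<ge> 0" using nonneg by (intro Liminf_bounded) auto
  ultimately obtain r where "?l = ereal r" by (cases ?l) auto
  then show ?thesis using lim by (auto simp: convergent_def)
qed

text \<open>Fatou's lemma. The bound is asked for from an index \<open>N\<close> on, because conditioning on generation \<open>n\<close>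
  only controls the later terms of a martingale.\<close>

lemma nn_integral_limit_le:
  assumes [measurable]: "\<And>n. U n \<in> borel_measurable M" "A \<in> sets M"
    and lim: "AE x in M. (\<lambda>n. U n x) \<longlonglongrightarrow> V x"
    and le: "\<And>n. n \<ge> N \<Longrightarrow> (\<integral>\<^sup>+x\<in>A. ennreal (U n x) \<partial>M) \<le> C"
  shows "(\<integral>\<^sup>+x\<in>A. ennreal (V x) \<partial>M) \<le> C"
proof -
  have "(\<integral>\<^sup>+x\<in>A. ennreal (V x) \<partial>M) \<le> (\<integral>\<^sup>+x. liminf (\<lambda>n. ennreal (U n x) * indicator A x) \<partial>M)"
  proof (rule nn_integral_mono_AE)
    show "AE x in M. ennreal (V x) * indicator A x \<le> liminf (\<lambda>n. ennreal (U n x) * indicator A x)"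
      using lim
    proof eventually_elim
      case (elim x)
      then have "(\<lambda>n. ennreal (U n x) * indicator A x) \<longlonglongrightarrow> ennreal (V x) * indicator A x"
        by (cases "x \<in> A") (auto intro: tendsto_ennrealI)
      then show ?case by (simp add: lim_imp_Liminf)
    qed
  qed
  also have "\<dots> \<le> liminf (\<lambda>n. \<integral>\<^sup>+x\<in>A. ennreal (U n x) \<partial>M)"
    by (rule nn_integral_liminf) measurable
  also have "\<dots> \<le> limsup (\<lambda>n. \<integral>\<^sup>+x\<in>A. ennreal (U n x) \<partial>M)"
    by (rule Liminf_le_Limsup) simp
  also have "\<dots> \<le> C"
    using le by (intro Limsup_bounded eventually_sequentiallyI[of N]) auto
  finally show ?thesis .
qed

lemma borel_measurable_sigma_Union:
  fixes f :: "'a \<Rightarrow> real"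
  assumes sub: "\<And>n. subalgebra M (G n)" and f: "f \<in> borel_measurable (G k)"
  shows "f \<in> borel_measurable (sigma (space M) (\<Union>n. sets (G n)))"
proof -
  have "(\<Union>n. sets (G n)) \<subseteq> Pow (space M)"
    using sub sets.space_closed by (fastforce simp: subalgebra_def)
  then have "sets (sigma (space M) (\<Union>n. sets (G n))) = sigma_sets (space M) (\<Union>n. sets (G n))"
    by (rule sets_measure_of)
  then have "subalgebra (sigma (space M) (\<Union>n. sets (G n))) (G k)"
    using sub by (auto simp: subalgebra_def space_measure_of_conv)
  then show ?thesis using f by (rule measurable_from_subalg)
qed

context prob_space
begin

lemma holding_sets:
  assumes mono: "\<And>n. sets (G n) \<subseteq> sets (G (Suc n))" and sp: "\<And>n. space (G n) = space M"
    and meas: "\<And>n. X n \<in> borel_measurable (G n)"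
  shows "{\<omega>\<in>space M. holding a c (\<lambda>k. X k \<omega>) n} \<in> sets (G n)"
proof (induction n)
  case 0
  have "{\<omega>\<in>space (G 0). X 0 \<omega> < a} \<in> sets (G 0)" using meas[of 0] by measurable
  then show ?case by (simp add: sp)
next
  case (Suc n)
  note [measurable] = meas[of "Suc n"]
  let ?h = "{\<omega>\<in>space M. holding a c (\<lambda>k. X k \<omega>) n}"
  have h: "?h \<in> sets (G (Suc n))" using Suc mono by blast
  have "{\<omega>\<in>space (G (Suc n)). X (Suc n) \<omega> \<le> c} \<in> sets (G (Suc n))" by measurable
  moreover have "{\<omega>\<in>space (G (Suc n)). X (Suc n) \<omega> < a} \<in> sets (G (Suc n))" by measurable
  ultimately have "(?h \<inter> {\<omega>\<in>space (G (Suc n)). X (Suc n) \<omega> \<le> c}) \<union>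
     ({\<omega>\<in>space (G (Suc n)). X (Suc n) \<omega> < a} - ?h) \<in> sets (G (Suc n))" using h by blast
  also have "(?h \<inter> {\<omega>\<in>space (G (Suc n)). X (Suc n) \<omega> \<le> c}) \<union>
     ({\<omega>\<in>space (G (Suc n)). X (Suc n) \<omega> < a} - ?h) = {\<omega>\<in>space M. holding a c (\<lambda>k. X k \<omega>) (Suc n)}"
    by (auto simp: sp)
  finally show ?case .
qed

lemma upcrossings_measurable:
  assumes hold: "\<And>n. {\<omega>\<in>space M. holding a c (\<lambda>k. X k \<omega>) n} \<in> events"
    and meas: "\<And>n. X n \<in> borel_measurable M"
  shows "(\<lambda>\<omega>. real (upcrossings a c (\<lambda>k. X k \<omega>) n)) \<in> borel_measurable M"
proof (induction n)
  case (Suc n)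
  note [measurable] = meas hold[unfolded Measurable.pred_def[symmetric]] Suc
  have "(\<lambda>\<omega>. real (upcrossings a c (\<lambda>k. X k \<omega>) n) +
      (if holding a c (\<lambda>k. X k \<omega>) n \<and> X (Suc n) \<omega> > c then 1 else 0)) \<in> borel_measurable M"
    by measurable
  then show ?case by (simp add: if_distrib cong: if_cong)
qed simp

text \<open>Doob's convergence theorem. The supermartingale property is in the weak form \<open>cond_le\<close>, which is
  what Fatou's lemma gives for limits of martingales.\<close>

lemma nonneg_supermartingale_converges:
  assumes sub: "\<And>n. subalgebra M (G n)" and mono: "\<And>n. sets (G n) \<subseteq> sets (G (Suc n))"
    and meas: "\<And>n. X n \<in> borel_measurable (G n)"
    and nonneg: "\<And>n \<omega>. \<omega> \<in> space M \<Longrightarrow> 0 \<le> X n \<omega>"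
    and fin: "(\<integral>\<^sup>+\<omega>. ennreal (X 0 \<omega>) \<partial>M) < \<infinity>"
    and le: "\<And>n. cond_le M (G n) (X (Suc n)) (X n)"
  shows "AE \<omega> in M. convergent (\<lambda>n. X n \<omega>)"
proof -
  have sp: "space (G n) = space M" for n using sub by (simp add: subalgebra_def)
  have measM[measurable]: "X n \<in> borel_measurable M" for n
    using measurable_from_subalg[OF sub meas] .
  have cond: "(\<integral>\<^sup>+\<omega>\<in>A. ennreal (X (Suc n) \<omega>) \<partial>M) \<le> (\<integral>\<^sup>+\<omega>\<in>A. ennreal (X n \<omega>) \<partial>M)"
    if "A \<in> sets (G n)" for A n
    using le that by (auto simp: cond_le_def)
  have top: "(\<integral>\<^sup>+\<omega>\<in>space M. f \<omega> \<partial>M) = (\<integral>\<^sup>+\<omega>. f \<omega> \<partial>M)" for f :: "'a \<Rightarrow> ennreal"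
    by (intro nn_integral_cong) simp
  have bound: "(\<integral>\<^sup>+\<omega>. ennreal (X n \<omega>) \<partial>M) \<le> (\<integral>\<^sup>+\<omega>. ennreal (X 0 \<omega>) \<partial>M)" for n
  proof (induction n)
    case (Suc n)
    have "space M \<in> sets (G n)" using sp sets.top by metis
    from cond[OF this] Suc show ?case unfolding top by simp
  qed simp
  have int: "integrable M (X n)" for n
    using bound[of n] fin nonneg by (intro integrableI_nonneg) auto
  have frequently_small: "AE \<omega> in M. \<exists>K. \<exists>\<^sub>F n in sequentially. X n \<omega> \<le> K"
  proof -
    have "(\<integral>\<^sup>+\<omega>. liminf (\<lambda>n. ennreal (X n \<omega>)) \<partial>M) \<le> liminf (\<lambda>n. \<integral>\<^sup>+\<omega>. ennreal (X n \<omega>) \<partial>M)"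
      by (rule nn_integral_liminf) measurable
    also have "\<dots> \<le> limsup (\<lambda>n. \<integral>\<^sup>+\<omega>. ennreal (X n \<omega>) \<partial>M)" by (rule Liminf_le_Limsup) simp
    also have "\<dots> \<le> (\<integral>\<^sup>+\<omega>. ennreal (X 0 \<omega>) \<partial>M)" using bound by (intro Limsup_bounded) auto
    finally have "(\<integral>\<^sup>+\<omega>. liminf (\<lambda>n. ennreal (X n \<omega>)) \<partial>M) \<noteq> \<infinity>"
      using fin by (metis leD infinity_ennreal_def)
    then have "AE \<omega> in M. liminf (\<lambda>n. ennreal (X n \<omega>)) \<noteq> \<infinity>"
      by (intro nn_integral_noteq_infinite) measurable
    then show ?thesis
    proof eventually_elim
      case (elim \<omega>)
      then obtain r where r: "liminf (\<lambda>n. ennreal (X n \<omega>)) = ennreal r" "r \<ge> 0"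
        by (cases "liminf (\<lambda>n. ennreal (X n \<omega>))") auto
      have "\<exists>\<^sub>F n in sequentially. X n \<omega> \<le> r + 1"
      proof (rule ccontr)
        assume "\<not> ?thesis"
        then have "\<forall>\<^sub>F n in sequentially. ennreal (r + 1) \<le> ennreal (X n \<omega>)"
          unfolding not_frequently by eventually_elim (simp add: ennreal_leI)
        then have "ennreal (r + 1) \<le> ennreal r" using r(1) by (metis Liminf_bounded)
        then show False using r(2) by (simp add: ennreal_le_iff)
      qed
      then show ?case by blast
    qed
  qed
  \<comment> \<open>The expected number of upcrossings of a fixed interval is finite.\<close>
  have bounded: "AE \<omega> in M. \<exists>K. \<forall>n. upcrossings a c (\<lambda>k. X k \<omega>) n \<le> K" if "a < c" for a c :: real
  proof -
    let ?h = "\<lambda>n. {\<omega>\<in>space M. holding a c (\<lambda>k. X k \<omega>) n}"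
    let ?U = "\<lambda>n \<omega>. upcrossings a c (\<lambda>k. X k \<omega>) n"
    have hG: "?h n \<in> sets (G n)" for n by (rule holding_sets[where G = G and X = X]) (use mono sp meas in auto)
    then have hM[measurable]: "?h n \<in> events" for n using sub by (auto simp: subalgebra_def)
    have Um[measurable]: "(\<lambda>\<omega>. real (?U n \<omega>)) \<in> borel_measurable M" for n
      by (rule upcrossings_measurable[OF hM measM])
    have inth: "integrable M (\<lambda>\<omega>. X k \<omega> * indicator (?h j) \<omega>)" for k j
      using integrable_mult_indicator[OF hM int, of j k] by (simp add: mult.commute)
    have step: "(\<integral>\<omega>. X (Suc k) \<omega> * indicator (?h k) \<omega> \<partial>M) \<le> (\<integral>\<omega>. X k \<omega> * indicator (?h k) \<omega> \<partial>M)" for k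
    proof -
      have eq: "(\<integral>\<^sup>+\<omega>\<in>?h k. ennreal (X j \<omega>) \<partial>M) = ennreal (\<integral>\<omega>. X j \<omega> * indicator (?h k) \<omega> \<partial>M)" for j
        using nonneg inth
        by (subst nn_integral_eq_integral[symmetric])
           (auto intro!: nn_integral_cong simp: indicator_def)
      have "(\<integral>\<omega>. X j \<omega> * indicator (?h k) \<omega> \<partial>M) \<ge> 0" for j
        using nonneg by (intro Bochner_Integration.integral_nonneg) (auto simp: indicator_def)
      then show ?thesis using cond[OF hG[of k]] unfolding eq by (simp add: ennreal_le_iff)
    qed
    define g where "g k \<omega> = X (Suc k) \<omega> * indicator (?h k) \<omega> - X k \<omega> * indicator (?h k) \<omega>" for k \<omega>
    have intg: "integrable M (g k)" for k
      unfolding g_def using inth by (intro Bochner_Integration.integrable_diff)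
    have gain: "gain a c (\<lambda>k. X k \<omega>) n = (\<Sum>k<n. g k \<omega>)" if "\<omega> \<in> space M" for \<omega> n
      using that unfolding gain_def g_def by (intro sum.cong) (auto simp: indicator_def)
    have "(\<integral>\<omega>. (\<Sum>k<n. g k \<omega>) \<partial>M) \<le> 0" for n
    proof -
      have "(\<integral>\<omega>. (\<Sum>k<n. g k \<omega>) \<partial>M) = (\<Sum>k<n. \<integral>\<omega>. g k \<omega> \<partial>M)"
        using intg by (intro Bochner_Integration.integral_sum) auto
      also have "\<dots> \<le> 0"
        unfolding g_def using inth step by (intro sum_nonpos) (subst Bochner_Integration.integral_diff; simp)
      finally show ?thesis .
    qed
    note E = this
    have Uint: "(\<integral>\<^sup>+\<omega>. ennreal (real (?U n \<omega>)) \<partial>M) \<le> ennreal (\<bar>a\<bar> / (c - a))" for n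
    proof -
      have le: "real (?U n \<omega>) \<le> ((\<Sum>k<n. g k \<omega>) + \<bar>a\<bar>) / (c - a)" if "\<omega> \<in> space M" for \<omega>
        using gain_ge_upcrossings[OF \<open>a < c\<close>, of "\<lambda>k. X k \<omega>" n] \<open>a < c\<close> nonneg[OF that, of n]
        unfolding gain[OF that] by (auto simp: field_simps split: if_splits)
      have "(\<integral>\<^sup>+\<omega>. ennreal (real (?U n \<omega>)) \<partial>M) \<le> (\<integral>\<^sup>+\<omega>. ennreal (((\<Sum>k<n. g k \<omega>) + \<bar>a\<bar>) / (c - a)) \<partial>M)"
        using le by (intro nn_integral_mono ennreal_leI) auto
      also have "\<dots> = ennreal (\<integral>\<omega>. ((\<Sum>k<n. g k \<omega>) + \<bar>a\<bar>) / (c - a) \<partial>M)"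
      proof (rule nn_integral_eq_integral)
        show "integrable M (\<lambda>\<omega>. ((\<Sum>k<n. g k \<omega>) + \<bar>a\<bar>) / (c - a))"
          using intg by (intro integrable_divide Bochner_Integration.integrable_add Bochner_Integration.integrable_sum) auto
        show "AE \<omega> in M. 0 \<le> ((\<Sum>k<n. g k \<omega>) + \<bar>a\<bar>) / (c - a)"
          using le by (intro AE_I2) (meson of_nat_0_le_iff order_trans)
      qed
      also have "(\<integral>\<omega>. ((\<Sum>k<n. g k \<omega>) + \<bar>a\<bar>) / (c - a) \<partial>M) = ((\<integral>\<omega>. (\<Sum>k<n. g k \<omega>) \<partial>M) + \<bar>a\<bar>) / (c - a)"
        using intg by (subst integral_divide_zero, subst Bochner_Integration.integral_add) (auto simp: prob_space)
      also have "ennreal \<dots> \<le> ennreal (\<bar>a\<bar> / (c - a))"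
        using E[of n] \<open>a < c\<close> by (intro ennreal_leI divide_right_mono) auto
      finally show ?thesis .
    qed
    have "(\<integral>\<^sup>+\<omega>. (SUP n. ennreal (real (?U n \<omega>))) \<partial>M) = (SUP n. \<integral>\<^sup>+\<omega>. ennreal (real (?U n \<omega>)) \<partial>M)"
      by (intro nn_integral_monotone_convergence_SUP)
         (auto intro!: incseq_SucI le_funI simp: ennreal_leI)
    also have "\<dots> \<le> ennreal (\<bar>a\<bar> / (c - a))" using Uint by (intro SUP_least)
    also have "\<dots> < \<infinity>" by simp
    finally have "AE \<omega> in M. (SUP n. ennreal (real (?U n \<omega>))) \<noteq> \<infinity>"
      by (intro nn_integral_noteq_infinite) auto
    then show ?thesis
    proof eventually_elim
      case (elim \<omega>)
      then obtain r where r: "(SUP n. ennreal (real (?U n \<omega>))) = ennreal r" "r \<ge> 0"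
        by (cases "SUP n. ennreal (real (?U n \<omega>))") auto
      have "?U n \<omega> \<le> nat \<lceil>r\<rceil>" for n
      proof -
        have "ennreal (real (?U n \<omega>)) \<le> ennreal r" using r(1) by (metis SUP_upper UNIV_I)
        then have "real (?U n \<omega>) \<le> r" using r(2) by (simp add: ennreal_le_iff)
        then show ?thesis by linarith
      qed
      then show ?case by blast
    qed
  qed
  have "AE \<omega> in M. \<forall>p\<in>\<rat>\<times>\<rat>. fst p < snd p \<longrightarrow> (\<exists>K. \<forall>n. upcrossings (fst p) (snd p) (\<lambda>k. X k \<omega>) n \<le> K)"
    using bounded by (intro AE_ball_countable' countable_SIGMA countable_rat) auto
  with frequently_small AE_space show ?thesis
  proof eventually_elim
    case (elim \<omega>)
    then show ?case using nonneg by (auto intro!: convergent_if_upcrossings_bounded)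
  qed
qed


section \<open>Limits under conditioning\<close>

text \<open>The sets that can be approximated by events from finite times form a sigma-algebra: a countable
  union is approximated by a finite one, and a finite union by a union of approximations, which
  is an event at the largest of the finitely many times involved.\<close>

lemma sigma_union_approx:
  assumes sub: "\<And>n. subalgebra M (G n)" and mono: "\<And>n. sets (G n) \<subseteq> sets (G (Suc n))"
    and D: "D \<in> sigma_sets (space M) (\<Union>n. sets (G n))" and "0 < e"
  shows "\<exists>k. \<exists>A\<in>sets (G k). measure M (sym_diff D A) < e"
  using D \<open>0 < e\<close>
proof (induction arbitrary: e rule: sigma_sets.induct)
  case (Basic a)
  then obtain k where "a \<in> sets (G k)" by blast
  then show ?case using \<open>0 < e\<close> by (intro exI[of _ k] bexI[of _ a]) auto
next
  case Empty
  then show ?case by (intro exI[of _ 0] bexI[of _ "{}"]) auto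
next
  case (Compl a)
  then obtain k A where A: "A \<in> sets (G k)" "measure M (sym_diff a A) < e" by blast
  have sp: "space (G k) = space M" using sub by (simp add: subalgebra_def)
  have "a \<subseteq> space M"
    using Compl.hyps sigma_sets_into_sp[of "\<Union>n. sets (G n)" "space M"] sub sets.space_closed
    by (metis (no_types, lifting) UN_least subalgebra_def)
  moreover have "A \<subseteq> space M" using sets.sets_into_space[OF A(1)] sp by simp
  ultimately have "sym_diff (space M - a) (space M - A) = sym_diff a A" by blast
  moreover have "space M - A \<in> sets (G k)" using A(1) sp by (metis sets.compl_sets)
  ultimately show ?case using A(2) by metis
next
  case (Union a)
  have evG: "A \<in> events" if "A \<in> sets (G k)" for A k using sub that by (auto simp: subalgebra_def)
  have a[measurable]: "a i \<in> events" for i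
  proof -
    have "sigma_sets (space M) (\<Union>n. sets (G n)) \<subseteq> events"
      using evG by (intro sets.sigma_sets_subset) auto
    then show ?thesis using Union.hyps by blast
  qed
  \<comment> \<open>Half of \<open>e\<close> pays for cutting off the union, the other half for the \<open>N\<close> approximations.\<close>
  let ?D = "\<Union>i. a i" and ?P = "\<lambda>N. \<Union>i<N. a i"
  have "(\<lambda>N. measure M (?P N)) \<longlonglongrightarrow> measure M (\<Union>N. ?P N)"
    by (intro finite_Lim_measure_incseq) (auto intro!: incseq_SucI simp: lessThan_Suc)
  also have "(\<Union>N. ?P N) = ?D" by auto
  finally have "\<forall>\<^sub>F N in sequentially. measure M ?D - e/2 < measure M (?P N)"
    using Union.prems by (intro order_tendstoD) auto
  then obtain N where N: "measure M ?D - e/2 < measure M (?P N)" "N > 0"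
    using eventually_happens[OF eventually_conj[OF _ eventually_gt_at_top[of 0]]] by auto
  have "measure M (?D - ?P N) = measure M ?D - measure M (?P N)"
    by (intro finite_measure_Diff) auto
  with N have diff: "measure M (?D - ?P N) < e/2" by simp
  have "\<forall>i. \<exists>k. \<exists>A\<in>sets (G k). measure M (sym_diff (a i) A) < e / (2 * real N)"
    using Union N by simp
  then obtain k A where A: "\<And>i. A i \<in> sets (G (k i))"
    "\<And>i. measure M (sym_diff (a i) (A i)) < e / (2 * real N)" by metis
  define m where "m = Max (k ` {..<N})"
  have "sets (G (k i)) \<subseteq> sets (G m)" if "i < N" for i
    using lift_Suc_mono_le[of "\<lambda>n. sets (G n)" "k i" m] mono that by (auto simp: m_def)
  then have Um: "(\<Union>i<N. A i) \<in> sets (G m)" using A by (intro sets.finite_UN) auto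
  note [measurable] = evG[OF A(1)]
  have "measure M (sym_diff ?D (\<Union>i<N. A i)) \<le> measure M ((?D - ?P N) \<union> (\<Union>i<N. sym_diff (a i) (A i)))"
    by (intro finite_measure_mono) auto
  also have "\<dots> \<le> measure M (?D - ?P N) + measure M (\<Union>i<N. sym_diff (a i) (A i))"
    by (intro measure_Un_le) auto
  also have "measure M (\<Union>i<N. sym_diff (a i) (A i)) \<le> (\<Sum>i<N. measure M (sym_diff (a i) (A i)))"
    by (intro measure_UNION_le) auto
  also have "\<dots> \<le> (\<Sum>i<N. e / (2 * real N))" using A(2) by (intro sum_mono less_imp_le)
  also have "\<dots> = e/2" using N by simp
  finally have "measure M (sym_diff ?D (\<Union>i<N. A i)) < e" using diff by simp
  with Um show ?case by blast
qed

text \<open>A form of Levy's upward theorem: if \<open>E[Z | G\<^sub>n] \<le> V\<^sub>n\<close> and \<open>V\<^sub>n \<rightarrow> L\<close>, then \<open>Z \<le> L\<close> once \<open>Z\<close> is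
  measurable with respect to all \<open>G\<^sub>n\<close> together. Since the convergence of \<open>V\<^sub>n\<close> need not take place in \<open>L\<^sup>1\<close>,
  the proof truncates: on the part of an event \<open>A\<close> of some \<open>G\<^sub>k\<close> where \<open>V\<^sub>n < c\<close>, the
  integral of \<open>Z\<close> is at most \<open>c P(A)\<close>. With \<open>n \<rightarrow> \<infinity>\<close>, and with \<open>A\<close> approximating
  \<open>D = {L < c, d < Z}\<close> for some \<open>d > c\<close>, this becomes \<open>d P(D) \<le> c P(D)\<close>, so \<open>D\<close> is a null set.\<close>

lemma cond_le_limit_imp_le:
  assumes sub: "\<And>n. subalgebra M (G n)" and mono: "\<And>n. sets (G n) \<subseteq> sets (G (Suc n))"
    and V: "\<And>n. V n \<in> borel_measurable (G n)"
    and lim: "AE \<omega> in M. (\<lambda>n. V n \<omega>) \<longlonglongrightarrow> L \<omega>"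
    and L: "L \<in> borel_measurable (sigma (space M) (\<Union>n. sets (G n)))"
    and Z: "Z \<in> borel_measurable (sigma (space M) (\<Union>n. sets (G n)))"
    and nonneg: "\<And>\<omega>. \<omega> \<in> space M \<Longrightarrow> 0 \<le> L \<omega>"
    and le: "\<And>n. cond_le M (G n) Z (V n)"
  shows "AE \<omega> in M. Z \<omega> \<le> L \<omega>"
proof -
  let ?GI = "sigma (space M) (\<Union>n. sets (G n))"
  have UG: "(\<Union>n. sets (G n)) \<subseteq> Pow (space M)"
    using sub sets.space_closed by (fastforce simp: subalgebra_def)
  have setsGI: "sets ?GI = sigma_sets (space M) (\<Union>n. sets (G n))"
    using UG by (rule sets_measure_of)
  have evG: "A \<in> events" if "A \<in> sets (G k)" for A k using sub that by (auto simp: subalgebra_def)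
  have subGI: "subalgebra M ?GI"
    unfolding subalgebra_def setsGI using evG by (auto intro!: sets.sigma_sets_subset simp: space_measure_of_conv)
  have sp: "space (G n) = space M" for n using sub by (simp add: subalgebra_def)
  note [measurable] = measurable_from_subalg[OF sub V] measurable_from_subalg[OF subGI L]
    measurable_from_subalg[OF subGI Z]
  have null: "AE \<omega> in M. \<not> (L \<omega> < c \<and> d < Z \<omega>)" if "0 \<le> c" "c < d" for c d :: real
  proof -
    let ?D = "{\<omega>\<in>space M. L \<omega> < c \<and> d < Z \<omega>}"
    have "{\<omega>\<in>space ?GI. L \<omega> < c \<and> d < Z \<omega>} \<in> sets ?GI" using L Z by measurable
    then have D: "?D \<in> sigma_sets (space M) (\<Union>n. sets (G n))"
      unfolding setsGI by (simp add: space_measure_of_conv)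
    have "(d - c) * measure M ?D \<le> (c + d) * e" if "e > 0" for e
    proof -
      obtain k A where A: "A \<in> sets (G k)" "measure M (sym_diff ?D A) < e"
        using sigma_union_approx[where G = G, OF sub mono D \<open>e > 0\<close>] by blast
      note [measurable] = evG[OF A(1)]
      have inc: "A \<in> sets (G n)" if "n \<ge> k" for n
        using A(1) lift_Suc_mono_le[of "\<lambda>n. sets (G n)", OF mono that] by blast
      have "(\<integral>\<^sup>+\<omega>. ennreal (Z \<omega>) * indicator (A \<inter> {\<omega>\<in>space M. L \<omega> < c}) \<omega> \<partial>M) \<le>
        (\<integral>\<^sup>+\<omega>. liminf (\<lambda>n. ennreal (Z \<omega>) * indicator (A \<inter> {\<omega>\<in>space M. V n \<omega> < c}) \<omega>) \<partial>M)"
      proof (rule nn_integral_mono_AE)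
        show "AE \<omega> in M. ennreal (Z \<omega>) * indicator (A \<inter> {\<omega>\<in>space M. L \<omega> < c}) \<omega> \<le>
          liminf (\<lambda>n. ennreal (Z \<omega>) * indicator (A \<inter> {\<omega>\<in>space M. V n \<omega> < c}) \<omega>)"
          using lim
        proof eventually_elim
          case (elim \<omega>)
          show ?case
          proof (cases "\<omega> \<in> A \<inter> {\<omega>\<in>space M. L \<omega> < c}")
            case True
            then have "\<forall>\<^sub>F n in sequentially. V n \<omega> < c" using order_tendstoD(2)[OF elim] by auto
            then have "\<forall>\<^sub>F n in sequentially. ennreal (Z \<omega>) \<le>
              ennreal (Z \<omega>) * indicator (A \<inter> {\<omega>\<in>space M. V n \<omega> < c}) \<omega>"
              by eventually_elim (use True in auto)
            then show ?thesis using True by (auto intro!: Liminf_bounded)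
          qed simp
        qed
      qed
      also have "\<dots> \<le> liminf (\<lambda>n. \<integral>\<^sup>+\<omega>. ennreal (Z \<omega>) * indicator (A \<inter> {\<omega>\<in>space M. V n \<omega> < c}) \<omega> \<partial>M)"
        by (rule nn_integral_liminf) measurable
      also have "\<dots> \<le> limsup (\<lambda>n. \<integral>\<^sup>+\<omega>. ennreal (Z \<omega>) * indicator (A \<inter> {\<omega>\<in>space M. V n \<omega> < c}) \<omega> \<partial>M)"
        by (rule Liminf_le_Limsup) simp
      also have "\<dots> \<le> ennreal c * emeasure M A"
      proof (intro Limsup_bounded eventually_sequentiallyI[of k])
        fix n assume "k \<le> n"
        have "{\<omega>\<in>space (G n). V n \<omega> < c} \<in> sets (G n)" using V by measurable
        then have "A \<inter> {\<omega>\<in>space M. V n \<omega> < c} \<in> sets (G n)" using inc[OF \<open>k \<le> n\<close>] sp by auto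
        then have "(\<integral>\<^sup>+\<omega>. ennreal (Z \<omega>) * indicator (A \<inter> {\<omega>\<in>space M. V n \<omega> < c}) \<omega> \<partial>M) \<le>
          (\<integral>\<^sup>+\<omega>. ennreal (V n \<omega>) * indicator (A \<inter> {\<omega>\<in>space M. V n \<omega> < c}) \<omega> \<partial>M)"
          using le[of n] by (auto simp: cond_le_def)
        also have "\<dots> \<le> (\<integral>\<^sup>+\<omega>. ennreal c * indicator A \<omega> \<partial>M)"
          by (intro nn_integral_mono) (auto simp: indicator_def intro!: ennreal_leI)
        finally show "(\<integral>\<^sup>+\<omega>. ennreal (Z \<omega>) * indicator (A \<inter> {\<omega>\<in>space M. V n \<omega> < c}) \<omega> \<partial>M) \<le> ennreal c * emeasure M A"
          by (simp add: nn_integral_cmult_indicator)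
      qed
      finally have 1: "(\<integral>\<^sup>+\<omega>. ennreal (Z \<omega>) * indicator (A \<inter> {\<omega>\<in>space M. L \<omega> < c}) \<omega> \<partial>M) \<le> ennreal c * emeasure M A" .
      have "ennreal d * emeasure M (A \<inter> ?D) = (\<integral>\<^sup>+\<omega>. ennreal d * indicator (A \<inter> ?D) \<omega> \<partial>M)"
        by (simp add: nn_integral_cmult_indicator)
      also have "\<dots> \<le> (\<integral>\<^sup>+\<omega>. ennreal (Z \<omega>) * indicator (A \<inter> {\<omega>\<in>space M. L \<omega> < c}) \<omega> \<partial>M)"
        by (intro nn_integral_mono) (auto simp: indicator_def intro!: ennreal_leI)
      finally have "ennreal d * emeasure M (A \<inter> ?D) \<le> ennreal c * emeasure M A" using 1 by (rule order_trans)
      then have 2: "d * measure M (A \<inter> ?D) \<le> c * measure M A"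
        using \<open>0 \<le> c\<close> \<open>c < d\<close> by (simp add: emeasure_eq_measure flip: ennreal_mult)
      have "measure M A \<le> measure M (?D \<union> sym_diff ?D A)" by (intro finite_measure_mono) auto
      also have "\<dots> \<le> measure M ?D + measure M (sym_diff ?D A)" by (intro measure_Un_le) auto
      finally have 3: "measure M A \<le> measure M ?D + e" using A(2) by simp
      have "measure M ?D \<le> measure M ((A \<inter> ?D) \<union> sym_diff ?D A)" by (intro finite_measure_mono) auto
      also have "\<dots> \<le> measure M (A \<inter> ?D) + measure M (sym_diff ?D A)" by (intro measure_Un_le) auto
      finally have 4: "measure M ?D - e \<le> measure M (A \<inter> ?D)" using A(2) by simp
      have "d * (measure M ?D - e) \<le> d * measure M (A \<inter> ?D)" using 4 \<open>0 \<le> c\<close> \<open>c < d\<close> by (intro mult_left_mono) auto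
      also have "\<dots> \<le> c * (measure M ?D + e)" using 2 mult_left_mono[OF 3 \<open>0 \<le> c\<close>] by linarith
      finally show ?thesis by (simp add: algebra_simps)
    qed
    note le_e = this
    have "measure M ?D = 0"
    proof (rule ccontr)
      assume "measure M ?D \<noteq> 0"
      then have pos: "(d - c) * measure M ?D > 0" using \<open>c < d\<close> by (simp add: zero_less_measure_iff)
      have cd: "c + d > 0" using that by simp
      define q where "q = (d - c) * measure M ?D"
      have "(c + d) * (q / (2 * (c + d))) = q / 2" using cd by (simp add: field_simps)
      then have "q \<le> q / 2"
        using le_e[of "q / (2 * (c + d))"] pos cd unfolding q_def[symmetric] by simp
      with pos show False unfolding q_def[symmetric] by simp
    qed
    then have "?D \<in> null_sets M" by (simp add: null_sets_def emeasure_eq_measure)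
    from AE_not_in[OF this] AE_space show ?thesis by eventually_elim auto
  qed
  have "AE \<omega> in M. \<forall>p\<in>\<rat>\<times>\<rat>. 0 \<le> fst p \<and> fst p < snd p \<longrightarrow> \<not> (L \<omega> < fst p \<and> snd p < Z \<omega>)"
    using null by (intro AE_ball_countable' countable_SIGMA countable_rat) auto
  with AE_space show ?thesis
  proof eventually_elim
    case (elim \<omega>)
    show ?case
    proof (rule ccontr)
      assume "\<not> Z \<omega> \<le> L \<omega>"
      then obtain c where c: "c \<in> \<rat>" "L \<omega> < c" "c < Z \<omega>" using Rats_dense_in_real[of "L \<omega>" "Z \<omega>"] by auto
      then obtain d where d: "d \<in> \<rat>" "c < d" "d < Z \<omega>" using Rats_dense_in_real[of c "Z \<omega>"] by auto
      from elim(2)[rule_format, of "(c, d)"] show False using c d nonneg[OF elim(1)] by auto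
    qed
  qed
qed

text \<open>The conditional Fatou lemma: \<open>E[U\<^sub>n | G] \<le> V\<^sub>n\<close> with \<open>V\<^sub>n\<close> known to \<open>G\<close> passes to the limit. The
  convergence of \<open>V\<^sub>n\<close> is made dominated by restricting to the event \<open>V\<^sub>n \<le> K\<close> for all \<open>n\<close>, which
  belongs to \<open>G\<close>; almost every point lies in such an event, because convergent sequences are
  bounded.\<close>

lemma cond_le_limits:
  assumes sub: "subalgebra M G" and U: "\<And>n. U n \<in> borel_measurable M" and V: "\<And>n. V n \<in> borel_measurable G"
    and nonneg: "\<And>n \<omega>. \<omega> \<in> space M \<Longrightarrow> 0 \<le> V n \<omega>"
    and le: "\<And>n. cond_le M G (U n) (V n)"
    and limU: "AE \<omega> in M. (\<lambda>n. U n \<omega>) \<longlonglongrightarrow> U' \<omega>"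
    and limV: "AE \<omega> in M. (\<lambda>n. V n \<omega>) \<longlonglongrightarrow> V' \<omega>"
    and U'[measurable]: "U' \<in> borel_measurable M" and V'[measurable]: "V' \<in> borel_measurable M"
  shows "cond_le M G U' V'"
  unfolding cond_le_def
proof
  fix A assume A: "A \<in> sets G"
  note [measurable] = U measurable_from_subalg[OF sub V]
  have sp: "space G = space M" and ev: "\<And>A. A \<in> sets G \<Longrightarrow> A \<in> events" using sub by (auto simp: subalgebra_def)
  define E where "E K = A \<inter> {\<omega>\<in>space M. \<forall>n. V n \<omega> \<le> real K}" for K :: nat
  have EG: "E K \<in> sets G" for K
  proof -
    have "{\<omega>\<in>space G. \<forall>n. V n \<omega> \<le> real K} \<in> sets G" using V by measurable
    then show ?thesis using A sp by (auto simp: E_def)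
  qed
  have [measurable]: "E K \<in> events" "A \<in> events" for K using EG A ev by auto
  have bound: "(\<integral>\<^sup>+\<omega>\<in>E K. ennreal (U' \<omega>) \<partial>M) \<le> (\<integral>\<^sup>+\<omega>\<in>A. ennreal (V' \<omega>) \<partial>M)" for K
  proof -
    have conv: "(\<lambda>n. \<integral>\<^sup>+\<omega>\<in>E K. ennreal (V n \<omega>) \<partial>M) \<longlonglongrightarrow> (\<integral>\<^sup>+\<omega>\<in>E K. ennreal (V' \<omega>) \<partial>M)"
    proof (rule nn_integral_dominated_convergence[where w = "\<lambda>_. ennreal (real K)"])
      show "AE \<omega> in M. ennreal (V j \<omega>) * indicator (E K) \<omega> \<le> ennreal (real K)" for j
        by (intro AE_I2) (auto simp: indicator_def E_def intro!: ennreal_leI)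
      show "AE \<omega> in M. (\<lambda>n. ennreal (V n \<omega>) * indicator (E K) \<omega>) \<longlonglongrightarrow> ennreal (V' \<omega>) * indicator (E K) \<omega>"
        using limV
      proof eventually_elim
        case (elim \<omega>)
        then show ?case by (cases "\<omega> \<in> E K") (auto intro: tendsto_ennrealI)
      qed
    qed (auto simp: emeasure_space_1)
    have "(\<integral>\<^sup>+\<omega>\<in>E K. ennreal (U' \<omega>) \<partial>M) \<le> (\<integral>\<^sup>+\<omega>. liminf (\<lambda>n. ennreal (U n \<omega>) * indicator (E K) \<omega>) \<partial>M)"
    proof (rule nn_integral_mono_AE)
      show "AE \<omega> in M. ennreal (U' \<omega>) * indicator (E K) \<omega> \<le> liminf (\<lambda>n. ennreal (U n \<omega>) * indicator (E K) \<omega>)"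
        using limU
      proof eventually_elim
        case (elim \<omega>)
        then have "(\<lambda>n. ennreal (U n \<omega>) * indicator (E K) \<omega>) \<longlonglongrightarrow> ennreal (U' \<omega>) * indicator (E K) \<omega>"
          by (cases "\<omega> \<in> E K") (auto intro: tendsto_ennrealI)
        then show ?case by (simp add: lim_imp_Liminf)
      qed
    qed
    also have "\<dots> \<le> liminf (\<lambda>n. \<integral>\<^sup>+\<omega>\<in>E K. ennreal (U n \<omega>) \<partial>M)"
      by (rule nn_integral_liminf) measurable
    also have "\<dots> \<le> liminf (\<lambda>n. \<integral>\<^sup>+\<omega>\<in>E K. ennreal (V n \<omega>) \<partial>M)"
      using le EG by (intro Liminf_mono) (auto simp: cond_le_def)
    also have "\<dots> = (\<integral>\<^sup>+\<omega>\<in>E K. ennreal (V' \<omega>) \<partial>M)"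
      using conv by (simp add: lim_imp_Liminf)
    also have "\<dots> \<le> (\<integral>\<^sup>+\<omega>\<in>A. ennreal (V' \<omega>) \<partial>M)"
      by (intro nn_integral_mono) (auto simp: indicator_def E_def)
    finally show ?thesis .
  qed
  have "(\<integral>\<^sup>+\<omega>\<in>A. ennreal (U' \<omega>) \<partial>M) \<le> (\<integral>\<^sup>+\<omega>. liminf (\<lambda>K. ennreal (U' \<omega>) * indicator (E K) \<omega>) \<partial>M)"
  proof (rule nn_integral_mono_AE)
    show "AE \<omega> in M. ennreal (U' \<omega>) * indicator A \<omega> \<le> liminf (\<lambda>K. ennreal (U' \<omega>) * indicator (E K) \<omega>)"
      using limV AE_space
    proof eventually_elim
      case (elim \<omega>)
      have "Bseq (\<lambda>n. V n \<omega>)" using elim(1) by (intro convergent_imp_Bseq) (auto simp: convergent_def)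
      then obtain C where C: "\<And>n. norm (V n \<omega>) \<le> C" by (auto simp: Bseq_def)
      have V_le: "V n \<omega> \<le> real K" if "nat \<lceil>C\<rceil> \<le> K" for n K
        using C[of n] that by (auto simp: real_norm_def) linarith?
      show ?case
      proof (cases "\<omega> \<in> A")
        case True
        have "ennreal (U' \<omega>) \<le> liminf (\<lambda>K. ennreal (U' \<omega>) * indicator (E K) \<omega>)"
          by (intro Liminf_bounded eventually_sequentiallyI[of "nat \<lceil>C\<rceil>"])
             (use True elim(2) V_le in \<open>auto simp: E_def indicator_def\<close>)
        then show ?thesis using True by simp
      qed simp
    qed
  qed
  also have "\<dots> \<le> liminf (\<lambda>K. \<integral>\<^sup>+\<omega>\<in>E K. ennreal (U' \<omega>) \<partial>M)"
    by (rule nn_integral_liminf) measurable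
  also have "\<dots> \<le> limsup (\<lambda>K. \<integral>\<^sup>+\<omega>\<in>E K. ennreal (U' \<omega>) \<partial>M)"
    by (rule Liminf_le_Limsup) simp
  also have "\<dots> \<le> (\<integral>\<^sup>+\<omega>\<in>A. ennreal (V' \<omega>) \<partial>M)"
    using bound by (intro Limsup_bounded) auto
  finally show "(\<integral>\<^sup>+\<omega>\<in>A. ennreal (U' \<omega>) \<partial>M) \<le> (\<integral>\<^sup>+\<omega>\<in>A. ennreal (V' \<omega>) \<partial>M)" .
qed


text \<open>In the application \<open>H m\<close> knows all of \<open>W\<close> and the first \<open>m\<close> generations of \<open>B\<close>, \<open>L n\<close> knows all
  of \<open>B\<close> and the first \<open>n\<close> generations of \<open>W\<close>, and \<open>G n\<close> knows the first \<open>n\<close> generations of both.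
  Conditioning on \<open>H m\<close> makes the row limits a supermartingale in \<open>m\<close> and bounds the diagonal limit
  by them; conditioning on \<open>G n\<close> bounds the iterated limit by the diagonal.\<close>

lemma two_parameter_martingale_limits:
  assumes subH: "\<And>m. subalgebra M (H m)" and subL: "\<And>n. subalgebra M (L n)" and subG: "\<And>n. subalgebra M (G n)"
    and monoH: "\<And>m. sets (H m) \<subseteq> sets (H (Suc m))" and monoL: "\<And>n. sets (L n) \<subseteq> sets (L (Suc n))"
    and monoG: "\<And>n. sets (G n) \<subseteq> sets (G (Suc n))"
    and GH: "\<And>n. sets (G n) \<subseteq> sets (H n)" and GL: "\<And>n. sets (G n) \<subseteq> sets (L n)"
    and ZH: "\<And>m n. Z m n \<in> borel_measurable (H m)" and ZL: "\<And>m n. Z m n \<in> borel_measurable (L n)"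
    and ZG: "\<And>m n. Z m n \<in> borel_measurable (G (max m n))"
    and nonneg: "\<And>m n \<omega>. \<omega> \<in> space M \<Longrightarrow> 0 \<le> Z m n \<omega>"
    and fin: "(\<integral>\<^sup>+\<omega>. ennreal (Z 0 0 \<omega>) \<partial>M) < \<infinity>"
    and condH: "\<And>m n. cond_eq M (H m) (Z (Suc m) n) (Z m n)"
    and condL: "\<And>m n. cond_eq M (L n) (Z m (Suc n)) (Z m n)"
  shows "AE \<omega> in M. (\<forall>m. convergent (\<lambda>n. Z m n \<omega>)) \<and>
    (\<exists>z. (\<lambda>m. lim (\<lambda>n. Z m n \<omega>)) \<longlonglongrightarrow> z \<and> (\<lambda>n. Z n n \<omega>) \<longlonglongrightarrow> z)"
proof -
  have [measurable]: "Z m n \<in> borel_measurable M" for m n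
    using measurable_from_subalg[OF subH ZH] .
  have incH: "sets (H m) \<subseteq> sets (H m')" and incG: "sets (G m) \<subseteq> sets (G m')" and incL: "sets (L m) \<subseteq> sets (L m')"
    if "m \<le> m'" for m m'
    using that lift_Suc_mono_le[of "\<lambda>n. sets (H n)"] lift_Suc_mono_le[of "\<lambda>n. sets (G n)"]
      lift_Suc_mono_le[of "\<lambda>n. sets (L n)"] monoH monoG monoL by auto
  have condH': "(\<integral>\<^sup>+\<omega>\<in>A. ennreal (Z m' n \<omega>) \<partial>M) = (\<integral>\<^sup>+\<omega>\<in>A. ennreal (Z m n \<omega>) \<partial>M)"
    if "m \<le> m'" "A \<in> sets (H m)" for m m' n A
    using that(1)
  proof (induction m' rule: dec_induct)
    case (step k)
    have "A \<in> sets (H k)" using incH step that(2) by blast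
    then show ?case using condH[of k n] step by (simp add: cond_eq_def)
  qed simp
  have condL': "(\<integral>\<^sup>+\<omega>\<in>A. ennreal (Z m n' \<omega>) \<partial>M) = (\<integral>\<^sup>+\<omega>\<in>A. ennreal (Z m n \<omega>) \<partial>M)"
    if "n \<le> n'" "A \<in> sets (L n)" for m n n' A
    using that(1)
  proof (induction n' rule: dec_induct)
    case (step k)
    have "A \<in> sets (L k)" using incL step that(2) by blast
    then show ?case using condL[of k m] step by (simp add: cond_eq_def)
  qed simp
  have top: "(\<integral>\<^sup>+\<omega>\<in>space M. f \<omega> \<partial>M) = (\<integral>\<^sup>+\<omega>. f \<omega> \<partial>M)" for f :: "'a \<Rightarrow> ennreal"
    by (intro nn_integral_cong) simp
  have spH: "space M \<in> sets (H m)" and spL: "space M \<in> sets (L m)" for m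
    using subH subL by (metis sets.top subalgebra_def)+
  have mass: "(\<integral>\<^sup>+\<omega>. ennreal (Z m n \<omega>) \<partial>M) = (\<integral>\<^sup>+\<omega>. ennreal (Z 0 0 \<omega>) \<partial>M)" for m n
    using condH'[OF _ spH, of 0 m n] condL'[OF _ spL, of 0 n 0] by (simp add: top)

  have AE_row: "AE \<omega> in M. convergent (\<lambda>n. Z m n \<omega>)" for m
    by (rule nonneg_supermartingale_converges[where G = L and X = "Z m"])
       (use subL monoL ZL nonneg fin mass[of m 0] condL in \<open>auto simp: cond_le_def cond_eq_def\<close>)
  have AE_diag: "AE \<omega> in M. convergent (\<lambda>n. Z n n \<omega>)"
  proof (rule nonneg_supermartingale_converges[where G = G and X = "\<lambda>n. Z n n"])
    show "cond_le M (G n) (Z (Suc n) (Suc n)) (Z n n)" for n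
      unfolding cond_le_def
    proof
      fix A assume "A \<in> sets (G n)"
      then have "A \<in> sets (H n)" "A \<in> sets (L n)" using GH GL by auto
      then show "(\<integral>\<^sup>+\<omega>\<in>A. ennreal (Z (Suc n) (Suc n) \<omega>) \<partial>M) \<le> (\<integral>\<^sup>+\<omega>\<in>A. ennreal (Z n n \<omega>) \<partial>M)"
        using condH[of n "Suc n"] condL[of n n] by (auto simp: cond_eq_def)
    qed
    show "Z n n \<in> borel_measurable (G n)" for n using ZG[of n n] by simp
  qed (use subG monoG nonneg fin in auto)

  \<comment> \<open>The maximum keeps the limit nonnegative also where there is no convergence.\<close>
  define Y where "Y m \<omega> = max 0 (lim (\<lambda>n. Z m n \<omega>))" for m \<omega>
  define Yinf where "Yinf \<omega> = max 0 (lim (\<lambda>m. Y m \<omega>))" for \<omega>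
  define Zinf where "Zinf \<omega> = max 0 (lim (\<lambda>n. Z n n \<omega>))" for \<omega>
  have Yinf_nonneg: "0 \<le> Yinf \<omega>" and Zinf_nonneg: "0 \<le> Zinf \<omega>" for \<omega>
    by (simp_all add: Yinf_def Zinf_def)
  have lim_max: "X \<longlonglongrightarrow> max 0 (lim X)" if "convergent X" "\<And>n. 0 \<le> X n" for X :: "nat \<Rightarrow> real"
    using that LIMSEQ_le_const[OF that(1)[unfolded convergent_LIMSEQ_iff], of 0]
    by (auto simp: convergent_LIMSEQ_iff max_def)
  have Y_lim: "AE \<omega> in M. (\<lambda>n. Z m n \<omega>) \<longlonglongrightarrow> Y m \<omega>" for m
    using AE_row[of m] AE_space unfolding Y_def by eventually_elim (intro lim_max; use nonneg in auto)
  have Zinf_lim: "AE \<omega> in M. (\<lambda>n. Z n n \<omega>) \<longlonglongrightarrow> Zinf \<omega>"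
    using AE_diag AE_space unfolding Zinf_def by eventually_elim (intro lim_max; use nonneg in auto)
  have YH: "Y m \<in> borel_measurable (H m)" for m
    unfolding Y_def using ZH by measurable
  have [measurable]: "Y m \<in> borel_measurable M" for m using measurable_from_subalg[OF subH YH] .
  have [measurable]: "Zinf \<in> borel_measurable M" unfolding Zinf_def by measurable
  have [measurable]: "Yinf \<in> borel_measurable M" unfolding Yinf_def by measurable
  have "AE \<omega> in M. convergent (\<lambda>m. Y m \<omega>)"
  proof (rule nonneg_supermartingale_converges[where G = H and X = Y])
    show "cond_le M (H m) (Y (Suc m)) (Y m)" for m
      by (rule cond_le_limits[where U = "Z (Suc m)" and V = "Z m"])
         (use subH ZH nonneg condH Y_lim in \<open>auto simp: cond_le_def cond_eq_def\<close>)
    have "(\<integral>\<^sup>+\<omega>\<in>space M. ennreal (Y 0 \<omega>) \<partial>M) \<le> (\<integral>\<^sup>+\<omega>. ennreal (Z 0 0 \<omega>) \<partial>M)"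
      by (rule nn_integral_limit_le[where U = "Z 0" and N = 0, OF _ _ Y_lim])
         (auto simp: top intro: eq_refl[OF mass])
    then show "(\<integral>\<^sup>+\<omega>. ennreal (Y 0 \<omega>) \<partial>M) < \<infinity>" using fin unfolding top by simp
  qed (use subH monoH YH in \<open>auto simp: Y_def\<close>)
  then have Yinf_lim: "AE \<omega> in M. (\<lambda>m. Y m \<omega>) \<longlonglongrightarrow> Yinf \<omega>"
    unfolding Yinf_def by eventually_elim (intro lim_max; auto simp: Y_def)

  have YinfH: "Yinf \<in> borel_measurable (sigma (space M) (\<Union>m. sets (H m)))"
  proof -
    note [measurable] = borel_measurable_sigma_Union[where G = H, OF subH YH]
    show ?thesis unfolding Yinf_def by measurable
  qed
  have ZinfH: "Zinf \<in> borel_measurable (sigma (space M) (\<Union>m. sets (H m)))"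
  proof -
    note [measurable] = borel_measurable_sigma_Union[where G = H, OF subH ZH]
    show ?thesis unfolding Zinf_def by measurable
  qed
  have YinfG: "Yinf \<in> borel_measurable (sigma (space M) (\<Union>m. sets (G m)))"
  proof -
    note [measurable] = borel_measurable_sigma_Union[where G = G, OF subG ZG]
    show ?thesis unfolding Yinf_def Y_def by measurable
  qed
  have ZinfG: "Zinf \<in> borel_measurable (sigma (space M) (\<Union>m. sets (G m)))"
  proof -
    note [measurable] = borel_measurable_sigma_Union[where G = G, OF subG ZG]
    show ?thesis unfolding Zinf_def by measurable
  qed

  \<comment> \<open>Reveal \<open>W\<close> first: the diagonal limit is bounded by the row limits in conditional mean.\<close>
  have "AE \<omega> in M. Zinf \<omega> \<le> Yinf \<omega>"
  proof (rule cond_le_limit_imp_le[where G = H and V = Y])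
    show "cond_le M (H m) Zinf (Y m)" for m
    proof (rule cond_le_limits[where U = "\<lambda>n. Z (n + m) (n + m)" and V = "\<lambda>n. Z m (n + m)"])
      show "AE \<omega> in M. (\<lambda>n. Z (n + m) (n + m) \<omega>) \<longlonglongrightarrow> Zinf \<omega>"
        using Zinf_lim by eventually_elim (rule LIMSEQ_ignore_initial_segment)
      show "AE \<omega> in M. (\<lambda>n. Z m (n + m) \<omega>) \<longlonglongrightarrow> Y m \<omega>"
        using Y_lim[of m] by eventually_elim (rule LIMSEQ_ignore_initial_segment)
      show "cond_le M (H m) (Z (n + m) (n + m)) (Z m (n + m))" for n
        unfolding cond_le_def using condH'[of m "n + m" _ "n + m"] by (metis le_add2 order_refl)
    qed (use subH ZH nonneg in auto)
  qed (use subH monoH YH Yinf_lim YinfH ZinfH Yinf_nonneg in auto)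
  \<comment> \<open>Reveal both together: two applications of Fatou bound the iterated limit by the diagonal.\<close>
  moreover have "AE \<omega> in M. Yinf \<omega> \<le> Zinf \<omega>"
  proof (rule cond_le_limit_imp_le[where G = G and V = "\<lambda>n. Z n n"])
    show "cond_le M (G n) Yinf (Z n n)" for n
      unfolding cond_le_def
    proof
      fix A assume A: "A \<in> sets (G n)"
      have [measurable]: "A \<in> events" using A subG by (auto simp: subalgebra_def)
      show "(\<integral>\<^sup>+\<omega>\<in>A. ennreal (Yinf \<omega>) \<partial>M) \<le> (\<integral>\<^sup>+\<omega>\<in>A. ennreal (Z n n \<omega>) \<partial>M)"
      proof (rule nn_integral_limit_le[where U = Y and N = n, OF _ _ Yinf_lim])
        fix m assume "n \<le> m"
        show "(\<integral>\<^sup>+\<omega>\<in>A. ennreal (Y m \<omega>) \<partial>M) \<le> (\<integral>\<^sup>+\<omega>\<in>A. ennreal (Z n n \<omega>) \<partial>M)"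
        proof (rule nn_integral_limit_le[where U = "Z m" and N = n, OF _ _ Y_lim])
          fix k assume "n \<le> k"
          have "A \<in> sets (H n)" "A \<in> sets (L n)" using A GH GL by auto
          then show "(\<integral>\<^sup>+\<omega>\<in>A. ennreal (Z m k \<omega>) \<partial>M) \<le> (\<integral>\<^sup>+\<omega>\<in>A. ennreal (Z n n \<omega>) \<partial>M)"
            using condH'[OF \<open>n \<le> m\<close>] condL'[OF \<open>n \<le> k\<close>] by simp
        qed auto
      qed auto
    qed
    show "Z n n \<in> borel_measurable (G n)" for n using ZG[of n n] by simp
  qed (use subG monoG Zinf_lim ZinfG YinfG Zinf_nonneg in auto)
  moreover have "AE \<omega> in M. \<forall>m. (\<lambda>n. Z m n \<omega>) \<longlonglongrightarrow> Y m \<omega>"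
    using Y_lim by (simp add: AE_all_countable)
  ultimately show ?thesis using Yinf_lim Zinf_lim
  proof eventually_elim
    case (elim \<omega>)
    then have "lim (\<lambda>n. Z m n \<omega>) = Y m \<omega>" for m by (simp add: limI)
    moreover have "Yinf \<omega> = Zinf \<omega>" using elim by simp
    ultimately show ?case using elim by (auto simp: convergent_def)
  qed
qed

end

section \<open>Measures on the boundary of the tree\<close>
definition cylinder :: "nat \<Rightarrow> nat list \<Rightarrow> (nat \<Rightarrow> nat) set" where
  "cylinder b \<gamma> = {t\<in>boundary b. tprefix t (length \<gamma>) = \<gamma>}"

lemma length_tprefix [simp]: "length (tprefix t n) = n"
  by (simp add: tprefix_def)

lemma tprefix_0 [simp]: "tprefix t 0 = []"
  by (simp add: tprefix_def)

lemma tprefix_Suc: "tprefix t (Suc n) = tprefix t n @ [t n]"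
  by (simp add: tprefix_def)

lemma take_tprefix: "m \<le> n \<Longrightarrow> take m (tprefix t n) = tprefix t m"
  by (simp add: tprefix_def take_map)

lemma tprefix_eq_iff: "tprefix s n = tprefix t n \<longleftrightarrow> (\<forall>i<n. s i = t i)"
  by (auto simp: tprefix_def)

lemma tprefix_in_words: "t \<in> boundary b \<Longrightarrow> tprefix t n \<in> words b"
  by (auto simp: tprefix_def words_def boundary_def)

lemma word_extends:
  assumes "b \<ge> 1" "\<gamma> \<in> words b"
  obtains t where "t \<in> boundary b" "tprefix t (length \<gamma>) = \<gamma>"
proof
  let ?t = "\<lambda>i. if i < length \<gamma> then \<gamma> ! i else 0"
  show "?t \<in> boundary b" using assms by (auto simp: boundary_def words_def dest: nth_mem)
  show "tprefix ?t (length \<gamma>) = \<gamma>" by (auto simp: tprefix_def intro: nth_equalityI)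
qed

lemma countable_words: "countable (words b)"
  by (rule countable_subset[OF subset_UNIV]) simp

lemma finite_words: "finite {\<gamma>\<in>words b. length \<gamma> = n}"
  using finite_lists_length_eq[of "{..<b}" n] by (simp add: words_def)

lemma cylinder_Nil [simp]: "cylinder b [] = boundary b"
  by (simp add: cylinder_def)

lemma cylinder_Int: "cylinder b \<gamma> \<inter> cylinder b \<delta> \<in> {{}, cylinder b \<gamma>, cylinder b \<delta>}"
proof -
  have *: "cylinder b \<gamma> \<inter> cylinder b \<delta> \<in> {{}, cylinder b \<delta>}" if "length \<gamma> \<le> length \<delta>" for \<gamma> \<delta>
  proof (cases "take (length \<gamma>) \<delta> = \<gamma>")
    case True
    then have "cylinder b \<delta> \<subseteq> cylinder b \<gamma>"
      using that by (auto simp: cylinder_def) (metis take_tprefix)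
    then show ?thesis by blast
  next
    case False
    then have "cylinder b \<gamma> \<inter> cylinder b \<delta> = {}"
      using that by (auto simp: cylinder_def) (metis take_tprefix)
    then show ?thesis by blast
  qed
  show ?thesis using *[of \<gamma> \<delta>] *[of \<delta> \<gamma>] by (cases "length \<gamma> \<le> length \<delta>") (auto simp: Int_commute)
qed

lemma space_borel_boundary [simp]: "space (borel_boundary b) = boundary b"
  by (simp add: borel_boundary_def space_restrict_space)

lemma coordinate_measurable: "(\<lambda>t. t i) \<in> borel_boundary b \<rightarrow>\<^sub>M count_space UNIV"
proof -
  have "(\<lambda>t :: nat \<Rightarrow> nat. t i) \<in> borel \<rightarrow>\<^sub>M borel"
    by (intro borel_measurable_continuous_onI continuous_on_product_coordinates)
  then have "(\<lambda>t :: nat \<Rightarrow> nat. t i) \<in> borel \<rightarrow>\<^sub>M count_space UNIV"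
    by (simp add: measurable_cong_sets[OF refl sets_borel_eq_count_space])
  then show ?thesis unfolding borel_boundary_def by (rule measurable_restrict_space1)
qed

lemma tprefix_measurable: "(\<lambda>t. tprefix t n) \<in> borel_boundary b \<rightarrow>\<^sub>M count_space UNIV"
proof (induction n)
  case (Suc n)
  note [measurable] = Suc coordinate_measurable[of n b]
  show ?case unfolding tprefix_Suc by measurable
qed simp

lemma cylinder_sets: "cylinder b \<gamma> \<in> sets (borel_boundary b)"
proof -
  have "(\<lambda>t. tprefix t (length \<gamma>)) -` {\<gamma>} \<inter> space (borel_boundary b) \<in> sets (borel_boundary b)"
    by (rule measurable_sets[OF tprefix_measurable]) simp
  also have "(\<lambda>t. tprefix t (length \<gamma>)) -` {\<gamma>} \<inter> space (borel_boundary b) = cylinder b \<gamma>"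
    by (auto simp: cylinder_def)
  finally show ?thesis .
qed

text \<open>Every coordinate is determined by a prefix, and there are countably many words.\<close>

lemma sets_borel_boundary: "sets (borel_boundary b) = sigma_sets (boundary b) (cylinder b ` words b)"
proof
  let ?S = "sigma (boundary b) (cylinder b ` words b)"
  have sub: "cylinder b ` words b \<subseteq> Pow (boundary b)" by (auto simp: cylinder_def)
  have S: "sets ?S = sigma_sets (boundary b) (cylinder b ` words b)" "space ?S = boundary b"
    using sub by (auto simp: sets_measure_of space_measure_of)
  have "(\<lambda>t. t i) \<in> ?S \<rightarrow>\<^sub>M borel" for i
  proof (subst measurable_cong_sets[OF refl sets_borel_eq_count_space],
      subst measurable_count_space_eq_countable, safe)
    fix k
    have "(\<lambda>t. t i) -` {k} \<inter> space ?S = (\<Union>\<gamma>\<in>{\<gamma>\<in>words b. length \<gamma> = Suc i \<and> last \<gamma> = k}. cylinder b \<gamma>)"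
      unfolding S by (auto simp: cylinder_def tprefix_Suc intro: tprefix_in_words)
    also have "\<dots> \<in> sets ?S"
      by (intro sets.countable_UN' countable_subset[OF _ countable_words[of b]]) (auto simp: S)
    finally show "(\<lambda>t. t i) -` {k} \<inter> space ?S \<in> sets ?S" .
  qed (auto simp: )
  then have "(\<lambda>t. \<lambda>i\<in>UNIV. t i) \<in> ?S \<rightarrow>\<^sub>M PiM UNIV (\<lambda>_. borel)"
    by (intro measurable_restrict)
  then have id: "(\<lambda>t. t) \<in> ?S \<rightarrow>\<^sub>M borel"
    by (simp add: measurable_cong_sets[OF refl sets_PiM_equal_borel] restrict_UNIV)
  show "sets (borel_boundary b) \<subseteq> sigma_sets (boundary b) (cylinder b ` words b)"
  proof
    fix A assume "A \<in> sets (borel_boundary b)"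
    then obtain B where B: "B \<in> sets borel" "A = boundary b \<inter> B"
      by (auto simp: borel_boundary_def sets_restrict_space)
    have "(\<lambda>t. t) -` B \<inter> space ?S \<in> sets ?S" using id B(1) by (rule measurable_sets)
    then show "A \<in> sigma_sets (boundary b) (cylinder b ` words b)" using S B by (simp add: Int_commute)
  qed
  show "sigma_sets (boundary b) (cylinder b ` words b) \<subseteq> sets (borel_boundary b)"
    using cylinder_sets sets.sigma_sets_subset[of "cylinder b ` words b" "borel_boundary b"] by auto
qed

lemma finite_borel_measuresD:
  assumes "\<mu> \<in> finite_borel_measures b"
  shows "finite_measure \<mu>" "sets \<mu> = sets (borel_boundary b)" "space \<mu> = boundary b"
  using assms sets_eq_imp_space_eq[of \<mu> "borel_boundary b"] by (auto simp: finite_borel_measures_def)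

text \<open>Two cylinders are nested or disjoint, so with the empty set they form a generator that is stable
  under intersections.\<close>

lemma measure_eq_if_eq_on_cylinders:
  assumes \<mu>: "\<mu> \<in> finite_borel_measures b" and \<nu>: "\<nu> \<in> finite_borel_measures b"
    and eq: "\<And>\<gamma>. \<gamma> \<in> words b \<Longrightarrow> measure \<mu> (cylinder b \<gamma>) = measure \<nu> (cylinder b \<gamma>)"
  shows "\<mu> = \<nu>"
proof -
  interpret \<mu>: finite_measure \<mu> using finite_borel_measuresD[OF \<mu>] by simp
  interpret \<nu>: finite_measure \<nu> using finite_borel_measuresD[OF \<nu>] by simp
  let ?E = "insert {} (cylinder b ` words b)"
  have gen: "sets (borel_boundary b) = sigma_sets (boundary b) ?E"
  proof -
    have "sigma_sets (boundary b) ?E \<subseteq> sets (borel_boundary b)"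
      using cylinder_sets sets.sigma_sets_subset[of ?E "borel_boundary b"] by auto
    moreover have "sets (borel_boundary b) \<subseteq> sigma_sets (boundary b) ?E"
      unfolding sets_borel_boundary by (intro sigma_sets_mono') auto
    ultimately show ?thesis by blast
  qed
  show ?thesis
  proof (rule measure_eqI_generator_eq[where E = ?E and \<Omega> = "boundary b" and A = "\<lambda>_. boundary b"])
    show "Int_stable ?E"
    proof (rule Int_stableI)
      fix X Y assume XY: "X \<in> ?E" "Y \<in> ?E"
      show "X \<inter> Y \<in> ?E"
      proof (cases "X = {} \<or> Y = {}")
        case False
        then obtain \<gamma> \<delta> where "\<gamma> \<in> words b" "\<delta> \<in> words b" "X = cylinder b \<gamma>" "Y = cylinder b \<delta>"
          using XY by blast
        then show ?thesis using cylinder_Int[of b \<gamma> \<delta>] XY by (elim insertE) simp_all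
      qed auto
    qed
    show "?E \<subseteq> Pow (boundary b)" by (auto simp: cylinder_def)
    show "sets \<mu> = sigma_sets (boundary b) ?E" "sets \<nu> = sigma_sets (boundary b) ?E"
      using finite_borel_measuresD[OF \<mu>] finite_borel_measuresD[OF \<nu>] gen by auto
    show "emeasure \<mu> X = emeasure \<nu> X" if "X \<in> ?E" for X
      using that eq by (auto simp: \<mu>.emeasure_eq_measure \<nu>.emeasure_eq_measure)
    have "boundary b = cylinder b []" "[] \<in> words b" by (auto simp: words_def)
    then show "range (\<lambda>_::nat. boundary b) \<subseteq> ?E" by blast
  qed auto
qed

context
  fixes b :: nat and x :: "nat list \<Rightarrow> real"
  assumes nonneg: "\<And>\<gamma>. \<gamma> \<in> words b \<Longrightarrow> 0 \<le> x \<gamma>"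
    and additive: "\<And>\<gamma>. \<gamma> \<in> words b \<Longrightarrow> x \<gamma> = (\<Sum>i<b. x (\<gamma> @ [i]))"
begin

text \<open>The intervals of the words of length \<open>n\<close>, with lengths \<open>x \<gamma>\<close>, are laid out from \<open>0\<close> in
  lexicographic order, so the left end of the interval of \<open>\<gamma>\<close> is the total length of the subtrees
  that branch off to the left of \<open>\<gamma>\<close>.\<close>

definition left_end :: "nat list \<Rightarrow> real" where
  "left_end \<gamma> = (\<Sum>k<length \<gamma>. \<Sum>j<\<gamma> ! k. x (take k \<gamma> @ [j]))"

definition word_interval :: "nat list \<Rightarrow> real set" where
  "word_interval \<gamma> = {left_end \<gamma> ..< left_end \<gamma> + x \<gamma>}"

text \<open>The child of \<open>\<gamma>\<close> whose interval contains the point \<open>u\<close>, for \<open>u\<close> in the interval of \<open>\<gamma>\<close>: the first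
  child whose right end lies beyond \<open>u\<close>.\<close>

definition digit :: "nat list \<Rightarrow> real \<Rightarrow> nat" where
  "digit \<gamma> u = (LEAST i. u < left_end (\<gamma> @ [i]) + x (\<gamma> @ [i]))"

primrec address :: "real \<Rightarrow> nat \<Rightarrow> nat list" where
  "address u 0 = []"
| "address u (Suc n) = address u n @ [digit (address u n) u]"

lemma left_end_snoc: "left_end (\<gamma> @ [i]) = left_end \<gamma> + (\<Sum>j<i. x (\<gamma> @ [j]))"
  by (simp add: left_end_def nth_append)

lemma snoc_in_words: "\<gamma> @ [i] \<in> words b \<longleftrightarrow> \<gamma> \<in> words b \<and> i < b"
  by (auto simp: words_def)

lemma word_interval_snoc_subset:
  assumes "\<gamma> \<in> words b" "i < b"
  shows "word_interval (\<gamma> @ [i]) \<subseteq> word_interval \<gamma>"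
proof -
  have "(\<Sum>j<i. x (\<gamma> @ [j])) \<ge> 0" using assms by (intro sum_nonneg nonneg) (auto simp: snoc_in_words)
  moreover have "(\<Sum>j<Suc i. x (\<gamma> @ [j])) \<le> (\<Sum>j<b. x (\<gamma> @ [j]))"
    using assms by (intro sum_mono2 nonneg) (auto simp: snoc_in_words)
  ultimately show ?thesis
    using additive[OF assms(1)] by (auto simp: word_interval_def left_end_snoc)
qed

lemma digit_eq_iff:
  assumes \<gamma>: "\<gamma> \<in> words b" and u: "u \<in> word_interval \<gamma>"
  shows "digit \<gamma> u < b" and "i < b \<Longrightarrow> digit \<gamma> u = i \<longleftrightarrow> u \<in> word_interval (\<gamma> @ [i])"
proof -
  define R where "R i = left_end (\<gamma> @ [i]) + x (\<gamma> @ [i])" for i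
  have R: "R i = left_end \<gamma> + (\<Sum>j<Suc i. x (\<gamma> @ [j]))" for i
    by (simp add: R_def left_end_snoc)
  have d: "digit \<gamma> u = (LEAST i. u < R i)" by (simp add: digit_def R_def)
  have "left_end \<gamma> < left_end \<gamma> + x \<gamma>" using u by (auto simp: word_interval_def)
  then have "b > 0" using additive[OF \<gamma>] by (cases b) auto
  have last: "u < R (b - 1)" using u additive[OF \<gamma>] \<open>b > 0\<close> by (simp add: R word_interval_def)
  then have "digit \<gamma> u \<le> b - 1" unfolding d by (rule Least_le)
  then show "digit \<gamma> u < b" using \<open>b > 0\<close> by simp
  have dR: "u < R (digit \<gamma> u)" unfolding d using last by (rule LeastI)
  show "digit \<gamma> u = i \<longleftrightarrow> u \<in> word_interval (\<gamma> @ [i])" if "i < b"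
  proof
    assume i: "digit \<gamma> u = i"
    have "left_end (\<gamma> @ [i]) \<le> u"
    proof (cases i)
      case 0
      then show ?thesis using u by (simp add: left_end_snoc word_interval_def)
    next
      case (Suc k)
      then have "\<not> u < R k" using not_less_Least[of k "\<lambda>i. u < R i"] i d by simp
      then show ?thesis using Suc by (simp add: R left_end_snoc)
    qed
    then show "u \<in> word_interval (\<gamma> @ [i])" using dR i by (simp add: word_interval_def R_def)
  next
    assume i: "u \<in> word_interval (\<gamma> @ [i])"
    have "\<not> u < R k" if "k < i" for k
    proof -
      have "(\<Sum>j<Suc k. x (\<gamma> @ [j])) \<le> (\<Sum>j<i. x (\<gamma> @ [j]))"
        using \<open>k < i\<close> \<open>i < b\<close> \<gamma> by (intro sum_mono2 nonneg) (auto simp: snoc_in_words)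
      then show ?thesis using i by (auto simp: R word_interval_def left_end_snoc)
    qed
    then show "digit \<gamma> u = i"
      unfolding d using i by (intro Least_equality) (auto simp: R_def word_interval_def not_less[symmetric])
  qed
qed

lemma address_in_words:
  assumes "u \<in> word_interval []"
  shows "address u n \<in> words b \<and> length (address u n) = n \<and> u \<in> word_interval (address u n)"
proof (induction n)
  case 0
  then show ?case using assms by (simp add: words_def)
next
  case (Suc n)
  then show ?case using digit_eq_iff[of "address u n" u] by (auto simp: snoc_in_words)
qed

lemma address_eq_iff:
  assumes "\<gamma> \<in> words b"
  shows "u \<in> word_interval [] \<and> address u (length \<gamma>) = \<gamma> \<longleftrightarrow> u \<in> word_interval \<gamma>"
  using assms
proof (induction \<gamma> rule: rev_induct)
  case (snoc i \<gamma>)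
  then have \<gamma>: "\<gamma> \<in> words b" "i < b" by (auto simp: snoc_in_words)
  show ?case
  proof
    assume "u \<in> word_interval [] \<and> address u (length (\<gamma> @ [i])) = \<gamma> @ [i]"
    then show "u \<in> word_interval (\<gamma> @ [i])" using address_in_words by metis
  next
    assume u: "u \<in> word_interval (\<gamma> @ [i])"
    then have "u \<in> word_interval \<gamma>" using word_interval_snoc_subset[OF \<gamma>] by blast
    moreover have "digit \<gamma> u = i" using digit_eq_iff(2)[OF \<gamma>(1) calculation \<gamma>(2)] u by simp
    ultimately show "u \<in> word_interval [] \<and> address u (length (\<gamma> @ [i])) = \<gamma> @ [i]"
      using snoc.IH \<gamma> by simp
  qed
qed simp

text \<open>Each point \<open>u\<close> of the root interval has an address in the tree, and the set of the points whose
  address starts with \<open>\<gamma>\<close> is the interval of \<open>\<gamma>\<close>, of length \<open>x \<gamma>\<close>. Hence the image of Lebesgue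
  measure under the address map has the prescribed masses.\<close>

lemma measure_from_cylinder_masses:
  "\<exists>\<mu>\<in>finite_borel_measures b. \<forall>\<gamma>\<in>words b. measure \<mu> (cylinder b \<gamma>) = x \<gamma>"
proof -
  define pt where "pt u i = digit (address u i) u" for u i
  have pre: "tprefix (pt u) n = address u n" for u n
    by (induction n) (simp_all add: tprefix_Suc pt_def)
  let ?N = "restrict_space lborel (word_interval [])"
  have spN: "space ?N = word_interval []" by (simp add: space_restrict_space)
  have pt: "pt u \<in> boundary b" if "u \<in> word_interval []" for u
    using address_in_words[OF that, of "Suc _"] by (auto simp: boundary_def pt_def snoc_in_words)
  have vimage: "pt -` cylinder b \<gamma> \<inter> space ?N = word_interval \<gamma>" if "\<gamma> \<in> words b" for \<gamma>
    using address_eq_iff[OF that] pt by (auto simp: spN cylinder_def pre)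
  have sub: "word_interval \<gamma> \<subseteq> word_interval []" if "\<gamma> \<in> words b" for \<gamma>
    using address_eq_iff[OF that] by blast
  have [measurable]: "word_interval \<gamma> \<in> sets borel" for \<gamma> by (simp add: word_interval_def)
  have meas: "pt \<in> ?N \<rightarrow>\<^sub>M borel_boundary b"
  proof (rule measurable_sigma_sets[OF sets_borel_boundary])
    show "cylinder b ` words b \<subseteq> Pow (boundary b)" by (auto simp: cylinder_def)
    show "pt \<in> space ?N \<rightarrow> boundary b" using pt spN by auto
    fix A assume "A \<in> cylinder b ` words b"
    then obtain \<gamma> where \<gamma>: "\<gamma> \<in> words b" "A = cylinder b \<gamma>" by blast
    show "pt -` A \<inter> space ?N \<in> sets ?N"
      unfolding \<gamma>(2) vimage[OF \<gamma>(1)] using sub[OF \<gamma>(1)] by (simp add: sets_restrict_space_iff)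
  qed
  let ?\<mu> = "distr ?N (borel_boundary b) pt"
  have em: "emeasure ?\<mu> (cylinder b \<gamma>) = ennreal (x \<gamma>)" if "\<gamma> \<in> words b" for \<gamma>
  proof -
    have "emeasure ?\<mu> (cylinder b \<gamma>) = emeasure ?N (word_interval \<gamma>)"
      using vimage[OF that] by (simp add: emeasure_distr[OF meas cylinder_sets])
    also have "\<dots> = emeasure lborel (word_interval \<gamma>)"
      using sub[OF that] by (simp add: emeasure_restrict_space)
    also have "\<dots> = ennreal (x \<gamma>)" using nonneg[OF that] by (simp add: word_interval_def)
    finally show ?thesis .
  qed
  have "emeasure ?\<mu> (space ?\<mu>) \<noteq> \<infinity>" using em[of "[]"] by (simp add: words_def)
  then have "finite_measure ?\<mu>" by (rule finite_measureI)
  then have "?\<mu> \<in> finite_borel_measures b" by (simp add: finite_borel_measures_def)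
  moreover have "\<forall>\<gamma>\<in>words b. measure ?\<mu> (cylinder b \<gamma>) = x \<gamma>" using em nonneg by (simp add: measure_def)
  ultimately show ?thesis by blast
qed

end

section \<open>Weak convergence and masses of cylinders\<close>

lemma compact_boundary: "compact (boundary b)"
proof -
  have "boundary b = (\<Pi>\<^sub>E i\<in>UNIV. {..<b})" by (auto simp: boundary_def PiE_def Pi_def extensional_def)
  moreover have "compactin (product_topology (\<lambda>i::nat. euclidean :: nat topology) UNIV) (\<Pi>\<^sub>E i\<in>UNIV. {..<b})"
    by (subst compactin_PiE) (auto intro: finite_imp_compact)
  ultimately show ?thesis by (simp add: euclidean_product_topology)
qed

lemma open_prefix_class: "open {s :: nat \<Rightarrow> nat. \<forall>i<n. s i = t i}"
proof -
  have "{s :: nat \<Rightarrow> nat. \<forall>i<n. s i = t i} = (\<Inter>i\<in>{..<n}. (\<lambda>s. s i) -` {t i})" by auto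
  also have "open \<dots>"
    by (intro open_INT open_vimage ballI continuous_on_product_coordinates) (auto intro: discrete_topology_class.open_discrete)
  finally show ?thesis .
qed

lemma continuous_on_prefix_function:
  fixes g :: "nat list \<Rightarrow> 'a::topological_space"
  shows "continuous_on S (\<lambda>t. g (tprefix t n))"
  unfolding continuous_on_topological
proof (intro ballI allI impI)
  fix t B assume "g (tprefix t n) \<in> B"
  then have "g (tprefix s n) \<in> B" if "\<forall>i<n. s i = t i" for s
    using that tprefix_eq_iff[of s n t] by simp
  then show "\<exists>A. open A \<and> t \<in> A \<and> (\<forall>s\<in>S. s \<in> A \<longrightarrow> g (tprefix s n) \<in> B)"
    by (intro exI[of _ "{s. \<forall>i<n. s i = t i}"])
       (auto simp: open_prefix_class)
qed

lemma open_contains_prefix_class: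
  fixes t :: "nat \<Rightarrow> nat"
  assumes "open A" and t: "t \<in> A"
  obtains n where "{s. \<forall>i<n. s i = t i} \<subseteq> A"
proof -
  have op: "openin (product_topology (\<lambda>_. euclidean) UNIV) A" using assms(1) by (simp add: open_fun_def)
  obtain X where X: "t \<in> (\<Pi>\<^sub>E i\<in>UNIV. X i)" "finite {i. X i \<noteq> UNIV}" "(\<Pi>\<^sub>E i\<in>UNIV. X i) \<subseteq> A"
    using product_topology_open_contains_basis[OF op t] unfolding topspace_euclidean by (elim exE conjE)
  let ?n = "Suc (Max (insert 0 {i. X i \<noteq> UNIV}))"
  have "{s. \<forall>i<?n. s i = t i} \<subseteq> A"
  proof
    fix s assume s: "s \<in> {s. \<forall>i<?n. s i = t i}"
    have "s i \<in> X i" for i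
    proof (cases "X i = UNIV")
      case False
      then have "i < ?n" using X(2) by (auto simp: less_Suc_eq_le intro!: Max_ge)
      then show ?thesis using s X(1) by auto
    qed simp
    then show "s \<in> A" using X(3) by auto
  qed
  then show thesis by (rule that)
qed

text \<open>Uniform continuity on the compact boundary, where two points are close if they share a long prefix.\<close>

lemma continuous_on_boundary_prefix_modulus:
  fixes f :: "(nat \<Rightarrow> nat) \<Rightarrow> real"
  assumes f: "continuous_on (boundary b) f" and "0 < e"
  obtains n where "\<And>s t. s \<in> boundary b \<Longrightarrow> t \<in> boundary b \<Longrightarrow> tprefix s n = tprefix t n \<Longrightarrow> \<bar>f s - f t\<bar> < e"
proof -
  have "\<exists>n. \<forall>s\<in>boundary b. tprefix s n = tprefix t n \<longrightarrow> \<bar>f s - f t\<bar> < e / 2" if t: "t \<in> boundary b" for t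
  proof -
    obtain A where A: "open A" "t \<in> A" "\<And>s. s \<in> boundary b \<Longrightarrow> s \<in> A \<Longrightarrow> f s \<in> ball (f t) (e / 2)"
      using f[unfolded continuous_on_topological, rule_format, OF t, of "ball (f t) (e / 2)"] \<open>0 < e\<close>
      by auto
    obtain n where n: "{s. \<forall>i<n. s i = t i} \<subseteq> A" using open_contains_prefix_class[OF A(1,2)] .
    have "\<bar>f s - f t\<bar> < e / 2" if "s \<in> boundary b" "tprefix s n = tprefix t n" for s
    proof -
      have "s \<in> A" using n that(2) by (auto simp: tprefix_eq_iff)
      from A(3)[OF that(1) this] show ?thesis by (simp add: dist_real_def abs_minus_commute)
    qed
    then show ?thesis by blast
  qed
  then obtain N where N: "\<And>s t. s \<in> boundary b \<Longrightarrow> t \<in> boundary b \<Longrightarrow>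
      tprefix s (N t) = tprefix t (N t) \<Longrightarrow> \<bar>f s - f t\<bar> < e / 2"
    by metis
  obtain D where D: "D \<subseteq> boundary b" "finite D" "boundary b \<subseteq> (\<Union>t\<in>D. {s. \<forall>i<N t. s i = t i})"
    by (rule compactE_image[OF compact_boundary[of b], of "boundary b" "\<lambda>t. {s. \<forall>i<N t. s i = t i}"])
       (auto simp: open_prefix_class)
  show thesis
  proof (rule that[of "Max (insert 0 (N ` D))"])
    fix s t assume s: "s \<in> boundary b" and t: "t \<in> boundary b"
      and eq: "tprefix s (Max (insert 0 (N ` D))) = tprefix t (Max (insert 0 (N ` D)))"
    obtain u where u: "u \<in> D" "tprefix s (N u) = tprefix u (N u)"
      using D(3) s by (auto simp: tprefix_eq_iff)
    have "N u \<le> Max (insert 0 (N ` D))" using u(1) D(2) by (intro Max_ge) auto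
    then have "tprefix t (N u) = tprefix u (N u)" using eq u(2) by (auto simp: tprefix_eq_iff)
    then have "\<bar>f s - f u\<bar> < e / 2" "\<bar>f t - f u\<bar> < e / 2" using N s t u D(1) by auto
    then show "\<bar>f s - f t\<bar> < e" by linarith
  qed
qed

lemma integral_prefix_function:
  assumes \<mu>: "\<mu> \<in> finite_borel_measures b"
  shows "integrable \<mu> (\<lambda>t. g (tprefix t n) :: real)"
    and "(\<integral>t. g (tprefix t n) \<partial>\<mu>) = (\<Sum>\<delta>\<in>{\<gamma>\<in>words b. length \<gamma> = n}. g \<delta> * measure \<mu> (cylinder b \<delta>))"
proof -
  interpret finite_measure \<mu> using finite_borel_measuresD[OF \<mu>] by simp
  have [measurable]: "cylinder b \<gamma> \<in> sets \<mu>" for \<gamma> using finite_borel_measuresD[OF \<mu>] cylinder_sets by simp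
  have [simp]: "integrable \<mu> (indicator (cylinder b \<gamma>) :: _ \<Rightarrow> real)" for \<gamma>
    by (rule integrable_real_indicator) (auto simp: less_top[symmetric])
  have eq: "g (tprefix t n) = (\<Sum>\<delta>\<in>{\<gamma>\<in>words b. length \<gamma> = n}. g \<delta> * indicator (cylinder b \<delta>) t)"
    if "t \<in> space \<mu>" for t
  proof -
    have t: "t \<in> boundary b" using that finite_borel_measuresD[OF \<mu>] by simp
    have "(\<Sum>\<delta>\<in>{\<gamma>\<in>words b. length \<gamma> = n}. g \<delta> * indicator (cylinder b \<delta>) t) =
      (\<Sum>\<delta>\<in>{tprefix t n}. g \<delta> * indicator (cylinder b \<delta>) t)"
      by (rule sum.mono_neutral_right)
         (use finite_words t in \<open>auto simp: tprefix_in_words cylinder_def indicator_def\<close>)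
    then show ?thesis using t by (simp add: cylinder_def)
  qed
  show "integrable \<mu> (\<lambda>t. g (tprefix t n))"
    by (subst Bochner_Integration.integrable_cong[OF refl eq]) (auto intro!: Bochner_Integration.integrable_sum)
  show "(\<integral>t. g (tprefix t n) \<partial>\<mu>) = (\<Sum>\<delta>\<in>{\<gamma>\<in>words b. length \<gamma> = n}. g \<delta> * measure \<mu> (cylinder b \<delta>))"
    by (subst Bochner_Integration.integral_cong[OF refl eq]) (auto simp: Bochner_Integration.integral_sum)
qed

lemma continuous_integrable:
  fixes f :: "(nat \<Rightarrow> nat) \<Rightarrow> real"
  assumes \<mu>: "\<mu> \<in> finite_borel_measures b" and f: "continuous_on (boundary b) f"
  shows "integrable \<mu> f"
proof -
  interpret finite_measure \<mu> using finite_borel_measuresD[OF \<mu>] by simp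
  have "f \<in> borel_measurable (borel_boundary b)"
    unfolding borel_boundary_def using f by (rule borel_measurable_continuous_on_restrict)
  then have [measurable]: "f \<in> borel_measurable \<mu>"
    using finite_borel_measuresD[OF \<mu>] measurable_cong_sets by blast
  have "bounded (f ` boundary b)" using compact_continuous_image[OF f compact_boundary] compact_imp_bounded by blast
  then obtain C where "\<And>t. t \<in> boundary b \<Longrightarrow> norm (f t) \<le> C" by (auto simp: bounded_iff)
  then show ?thesis using finite_borel_measuresD[OF \<mu>] by (intro integrable_const_bound[of _ C]) auto
qed

text \<open>A continuous function is replaced by its value at a chosen extension of a long prefix; the error
  is uniformly small, and the total masses are bounded because the root is a cylinder too.\<close>

lemma weakly_converges_if_cylinders_converge:
  assumes \<mu>s: "\<And>n. \<mu>s n \<in> finite_borel_measures b" and \<mu>: "\<mu> \<in> finite_borel_measures b" and "b \<ge> 1"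
    and conv: "\<And>\<gamma>. \<gamma> \<in> words b \<Longrightarrow> (\<lambda>n. measure (\<mu>s n) (cylinder b \<gamma>)) \<longlonglongrightarrow> measure \<mu> (cylinder b \<gamma>)"
  shows "weakly_converges b \<mu>s \<mu>"
  unfolding weakly_converges_def
proof (intro allI impI)
  fix f :: "(nat \<Rightarrow> nat) \<Rightarrow> real" assume f: "continuous_on (boundary b) f"
  have "(\<lambda>n. measure (\<mu>s n) (boundary b)) \<longlonglongrightarrow> measure \<mu> (boundary b)"
    using conv[of "[]"] by (simp add: words_def)
  then have "Bseq (\<lambda>n. measure (\<mu>s n) (boundary b))" by (intro convergent_imp_Bseq) (auto simp: convergent_def)
  then obtain C0 where C0: "\<And>n. norm (measure (\<mu>s n) (boundary b)) \<le> C0" by (auto simp: Bseq_def)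
  define C where "C = max 1 (max C0 (measure \<mu> (boundary b)))"
  have C: "C \<ge> 1" "measure (\<mu>s n) (boundary b) \<le> C" "measure \<mu> (boundary b) \<le> C" for n
    using C0[of n] by (auto simp: C_def)
  have "\<forall>\<gamma>. \<exists>t. \<gamma> \<in> words b \<longrightarrow> t \<in> boundary b \<and> tprefix t (length \<gamma>) = \<gamma>"
    using word_extends[OF \<open>b \<ge> 1\<close>] by metis
  then obtain ext where ext: "\<And>\<gamma>. \<gamma> \<in> words b \<Longrightarrow> ext \<gamma> \<in> boundary b \<and> tprefix (ext \<gamma>) (length \<gamma>) = \<gamma>"
    by metis
  show "(\<lambda>n. \<integral>t. f t \<partial>\<mu>s n) \<longlonglongrightarrow> (\<integral>t. f t \<partial>\<mu>)"
  proof (rule metric_LIMSEQ_I)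
    fix e :: real assume "0 < e"
    define \<eta> where "\<eta> = e / (4 * C)"
    have \<eta>: "\<eta> > 0" "\<eta> * C = e / 4" using C(1) \<open>0 < e\<close> by (auto simp: \<eta>_def)
    obtain N where N: "\<And>s t. s \<in> boundary b \<Longrightarrow> t \<in> boundary b \<Longrightarrow> tprefix s N = tprefix t N \<Longrightarrow> \<bar>f s - f t\<bar> < \<eta>"
      using continuous_on_boundary_prefix_modulus[OF f \<eta>(1)] by blast
    define g where "g \<delta> = f (ext \<delta>)" for \<delta>
    have close: "\<bar>(\<integral>t. f t \<partial>\<nu>) - (\<integral>t. g (tprefix t N) \<partial>\<nu>)\<bar> \<le> e / 4"
      if \<nu>: "\<nu> \<in> finite_borel_measures b" and le: "measure \<nu> (boundary b) \<le> C" for \<nu>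
    proof -
      interpret finite_measure \<nu> using finite_borel_measuresD[OF \<nu>] by simp
      note int = continuous_integrable[OF \<nu> f] integral_prefix_function(1)[OF \<nu>, of g N]
      have "\<bar>(\<integral>t. f t \<partial>\<nu>) - (\<integral>t. g (tprefix t N) \<partial>\<nu>)\<bar> = \<bar>\<integral>t. f t - g (tprefix t N) \<partial>\<nu>\<bar>"
        using int by simp
      also have "\<dots> \<le> (\<integral>t. \<bar>f t - g (tprefix t N)\<bar> \<partial>\<nu>)" by (rule integral_abs_bound)
      also have "\<dots> \<le> (\<integral>t. \<eta> \<partial>\<nu>)"
      proof (rule integral_mono)
        fix t assume "t \<in> space \<nu>"
        then have t: "t \<in> boundary b" using finite_borel_measuresD[OF \<nu>] by simp
        show "\<bar>f t - g (tprefix t N)\<bar> \<le> \<eta>"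
          using N[OF t, of "ext (tprefix t N)"] ext[OF tprefix_in_words[OF t, of N]] by (simp add: g_def)
      qed (use int in auto)
      also have "\<dots> = \<eta> * measure \<nu> (boundary b)" using finite_borel_measuresD[OF \<nu>] by simp
      also have "\<dots> \<le> \<eta> * C" using \<eta>(1) le by (intro mult_left_mono) auto
      finally show ?thesis using \<eta>(2) by simp
    qed
    have "(\<lambda>n. \<integral>t. g (tprefix t N) \<partial>\<mu>s n) \<longlonglongrightarrow> (\<integral>t. g (tprefix t N) \<partial>\<mu>)"
      unfolding integral_prefix_function(2)[OF \<mu>s] integral_prefix_function(2)[OF \<mu>]
      by (intro tendsto_sum tendsto_mult tendsto_const conv) auto
    from metric_LIMSEQ_D[OF this, of "e / 4"] \<open>0 < e\<close>
    obtain n0 where n0: "\<And>n. n \<ge> n0 \<Longrightarrow> \<bar>(\<integral>t. g (tprefix t N) \<partial>\<mu>s n) - (\<integral>t. g (tprefix t N) \<partial>\<mu>)\<bar> < e / 4"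
      by (auto simp: dist_real_def)
    have "dist (\<integral>t. f t \<partial>\<mu>s n) (\<integral>t. f t \<partial>\<mu>) < e" if "n \<ge> n0" for n
      using close[OF \<mu>s[of n] C(2)] close[OF \<mu> C(3)] n0[OF that] \<open>0 < e\<close> unfolding dist_real_def by linarith
    then show "\<exists>no. \<forall>n\<ge>no. dist (\<integral>t. f t \<partial>\<mu>s n) (\<integral>t. f t \<partial>\<mu>) < e" by blast
  qed
qed

lemma weakly_converges_integral_prefix:
  assumes "weakly_converges b \<mu>s \<mu>"
  shows "(\<lambda>n. \<integral>t. (g (tprefix t m) :: real) \<partial>\<mu>s n) \<longlonglongrightarrow> (\<integral>t. g (tprefix t m) \<partial>\<mu>)"
  using assms continuous_on_prefix_function[of "boundary b" g m] unfolding weakly_converges_def by blast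

lemma integral_cylinder_indicator:
  assumes "\<mu> \<in> finite_borel_measures b"
  shows "(\<integral>t. of_bool (tprefix t (length \<gamma>) = \<gamma>) \<partial>\<mu>) = measure \<mu> (cylinder b \<gamma>)"
proof -
  have "(\<integral>t. (of_bool (tprefix t (length \<gamma>) = \<gamma>) :: real) \<partial>\<mu>) = (\<integral>t. indicator (cylinder b \<gamma>) t \<partial>\<mu>)"
    using finite_borel_measuresD[OF assms]
    by (intro Bochner_Integration.integral_cong) (auto simp: cylinder_def)
  then show ?thesis
    using finite_borel_measuresD[OF assms] cylinder_sets[of b \<gamma>] sets.Int_space_eq2[of "cylinder b \<gamma>" \<mu>] by simp
qed

lemma weakly_converges_cylinder:
  assumes "\<And>n. \<mu>s n \<in> finite_borel_measures b" "\<mu> \<in> finite_borel_measures b" "weakly_converges b \<mu>s \<mu>"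
  shows "(\<lambda>n. measure (\<mu>s n) (cylinder b \<gamma>)) \<longlonglongrightarrow> measure \<mu> (cylinder b \<gamma>)"
  using weakly_converges_integral_prefix[OF assms(3), of "\<lambda>\<delta>. of_bool (\<delta> = \<gamma>)" "length \<gamma>"]
  unfolding integral_cylinder_indicator[OF assms(1)] integral_cylinder_indicator[OF assms(2)] .

lemma measure_cylinder_additive:
  assumes \<mu>: "\<mu> \<in> finite_borel_measures b"
  shows "measure \<mu> (cylinder b \<gamma>) = (\<Sum>i<b. measure \<mu> (cylinder b (\<gamma> @ [i])))"
proof -
  interpret finite_measure \<mu> using finite_borel_measuresD[OF \<mu>] by simp
  have "cylinder b \<gamma> = (\<Union>i<b. cylinder b (\<gamma> @ [i]))"
    by (auto simp: cylinder_def tprefix_Suc boundary_def)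
  also have "measure \<mu> \<dots> = (\<Sum>i<b. measure \<mu> (cylinder b (\<gamma> @ [i])))"
    using finite_borel_measuresD[OF \<mu>] cylinder_sets
    by (intro finite_measure_finite_Union) (auto simp: disjoint_family_on_def, auto simp: cylinder_def tprefix_Suc)
  finally show ?thesis .
qed

text \<open>The limits of the masses are additive along the tree, so they are the masses of a measure. Weak
  limits are unique because indicators of cylinders are continuous.\<close>

lemma weak_limit_if_cylinders_converge:
  assumes \<mu>s: "\<And>n. \<mu>s n \<in> finite_borel_measures b" and "b \<ge> 1"
    and conv: "\<And>\<gamma>. \<gamma> \<in> words b \<Longrightarrow> convergent (\<lambda>n. measure (\<mu>s n) (cylinder b \<gamma>))"
  shows "weak_limit b \<mu>s \<in> finite_borel_measures b" and "weakly_converges b \<mu>s (weak_limit b \<mu>s)"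
    and "\<gamma> \<in> words b \<Longrightarrow> measure (weak_limit b \<mu>s) (cylinder b \<gamma>) = lim (\<lambda>n. measure (\<mu>s n) (cylinder b \<gamma>))"
proof -
  define x where "x \<gamma> = lim (\<lambda>n. measure (\<mu>s n) (cylinder b \<gamma>))" for \<gamma>
  have x: "(\<lambda>n. measure (\<mu>s n) (cylinder b \<gamma>)) \<longlonglongrightarrow> x \<gamma>" if "\<gamma> \<in> words b" for \<gamma>
    using conv[OF that] by (simp add: x_def convergent_LIMSEQ_iff)
  have nonneg: "0 \<le> x \<gamma>" if "\<gamma> \<in> words b" for \<gamma>
    using x[OF that] by (rule LIMSEQ_le_const) simp
  have additive: "x \<gamma> = (\<Sum>i<b. x (\<gamma> @ [i]))" if "\<gamma> \<in> words b" for \<gamma>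
  proof -
    have "(\<lambda>n. \<Sum>i<b. measure (\<mu>s n) (cylinder b (\<gamma> @ [i]))) \<longlonglongrightarrow> (\<Sum>i<b. x (\<gamma> @ [i]))"
      using that by (intro tendsto_sum x) (auto simp: words_def)
    then show ?thesis
      using LIMSEQ_unique[OF x[OF that]] by (simp flip: measure_cylinder_additive[OF \<mu>s])
  qed
  obtain \<mu> where \<mu>: "\<mu> \<in> finite_borel_measures b" "\<forall>\<gamma>\<in>words b. measure \<mu> (cylinder b \<gamma>) = x \<gamma>"
    using measure_from_cylinder_masses[of b x] nonneg additive by blast
  have w: "weakly_converges b \<mu>s \<mu>"
    using weakly_converges_if_cylinders_converge[OF \<mu>s \<mu>(1) \<open>b \<ge> 1\<close>] x \<mu>(2) by simp
  have uniq: "\<nu> = \<mu>" if "\<nu> \<in> finite_borel_measures b" "weakly_converges b \<mu>s \<nu>" for \<nu>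
  proof (rule measure_eq_if_eq_on_cylinders[OF that(1) \<mu>(1)])
    show "measure \<nu> (cylinder b \<gamma>) = measure \<mu> (cylinder b \<gamma>)" for \<gamma>
      using weakly_converges_cylinder[OF \<mu>s that] weakly_converges_cylinder[OF \<mu>s \<mu>(1) w]
      by (rule LIMSEQ_unique)
  qed
  have "weak_limit b \<mu>s = \<mu>"
  proof -
    have "\<exists>\<mu>\<in>finite_borel_measures b. weakly_converges b \<mu>s \<mu>" using \<mu>(1) w by blast
    moreover have "(THE \<mu>. \<mu> \<in> finite_borel_measures b \<and> weakly_converges b \<mu>s \<mu>) = \<mu>"
      using uniq \<mu>(1) w by (intro the_equality) blast+
    ultimately show ?thesis by (simp only: weak_limit_def if_True)
  qed
  then show "weak_limit b \<mu>s \<in> finite_borel_measures b" "weakly_converges b \<mu>s (weak_limit b \<mu>s)"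
    "\<gamma> \<in> words b \<Longrightarrow> measure (weak_limit b \<mu>s) (cylinder b \<gamma>) = lim (\<lambda>n. measure (\<mu>s n) (cylinder b \<gamma>))"
    using \<mu> w by (auto simp: x_def)
qed

text \<open>A density that depends on a finite prefix takes finitely many values, so it is bounded.\<close>

lemma density_prefix_function:
  assumes \<mu>: "\<mu> \<in> finite_borel_measures b"
    and Q: "\<And>t. t \<in> boundary b \<Longrightarrow> Q t = g (tprefix t n)" and nonneg: "\<And>t. t \<in> boundary b \<Longrightarrow> 0 \<le> Q t"
  shows "density \<mu> (\<lambda>t. ennreal (Q t)) \<in> finite_borel_measures b"
    and "(\<integral>t. k (tprefix t m) \<partial>density \<mu> (\<lambda>t. ennreal (Q t))) = (\<integral>t. Q t * k (tprefix t m) \<partial>\<mu>)"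
proof -
  note fin = finite_borel_measuresD[OF \<mu>]
  have meas: "(\<lambda>t. f (tprefix t j) :: real) \<in> borel_measurable \<mu>" for f j
    using integral_prefix_function(1)[OF \<mu>, of f j] by auto
  have Qint: "integrable \<mu> Q"
    using integral_prefix_function(1)[OF \<mu>, of g n] Q fin(3)
    by (subst Bochner_Integration.integrable_cong[OF refl, of _ _ "\<lambda>t. g (tprefix t n)"]) auto
  then have [measurable]: "Q \<in> borel_measurable \<mu>" by auto
  have nn: "AE t in \<mu>. 0 \<le> Q t" using nonneg fin(3) by auto
  have "emeasure (density \<mu> (\<lambda>t. ennreal (Q t))) (space (density \<mu> (\<lambda>t. ennreal (Q t)))) =
      (\<integral>\<^sup>+t. ennreal (Q t) \<partial>\<mu>)"
    by (subst emeasure_density) (auto intro!: nn_integral_cong simp: indicator_def)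
  also have "\<dots> = ennreal (\<integral>t. Q t \<partial>\<mu>)" by (rule nn_integral_eq_integral[OF Qint nn])
  finally have "finite_measure (density \<mu> (\<lambda>t. ennreal (Q t)))" by (intro finite_measureI) simp
  then show "density \<mu> (\<lambda>t. ennreal (Q t)) \<in> finite_borel_measures b"
    using fin by (simp add: finite_borel_measures_def)
  show "(\<integral>t. k (tprefix t m) \<partial>density \<mu> (\<lambda>t. ennreal (Q t))) = (\<integral>t. Q t * k (tprefix t m) \<partial>\<mu>)"
    by (rule integral_real_density[OF _ nn meas]) measurable
qed

section \<open>Generated sigma-algebras and independence\<close>

lemma measurable_nonneg_borel_iff:
  "f \<in> N \<rightarrow>\<^sub>M nonneg_borel \<longleftrightarrow> f \<in> borel_measurable N \<and> (\<forall>x\<in>space N. 0 \<le> f x)"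
  unfolding nonneg_borel_def by (auto simp: measurable_restrict_space2_iff)

lemma space_sigma_rvs [simp]: "space (sigma_rvs M I X) = space M"
  by (auto simp: sigma_rvs_def space_measure_of_conv)

lemma sets_sigma_rvs:
  "sets (sigma_rvs M I X) = sigma_sets (space M) (\<Union>i\<in>I. {X i -` A \<inter> space M |A. A \<in> sets nonneg_borel})"
  unfolding sigma_rvs_def by (rule sets_measure_of) auto

lemma subalgebra_sigma_rvs:
  assumes "\<And>i. i \<in> I \<Longrightarrow> X i \<in> M \<rightarrow>\<^sub>M nonneg_borel"
  shows "subalgebra M (sigma_rvs M I X)"
  unfolding subalgebra_def sets_sigma_rvs
  using assms by (auto intro!: sets.sigma_sets_subset measurable_sets)

lemma sets_sigma_rvs_mono: "I \<subseteq> J \<Longrightarrow> sets (sigma_rvs M I X) \<subseteq> sets (sigma_rvs M J X)"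
  unfolding sets_sigma_rvs by (intro sigma_sets_mono') auto

lemma measurable_sigma_rvs:
  assumes "i \<in> I" "\<And>\<omega>. \<omega> \<in> space M \<Longrightarrow> 0 \<le> X i \<omega>"
  shows "X i \<in> sigma_rvs M I X \<rightarrow>\<^sub>M nonneg_borel"
proof (rule measurableI)
  show "X i \<omega> \<in> space nonneg_borel" if "\<omega> \<in> space (sigma_rvs M I X)" for \<omega>
    using that assms(2) by (simp add: nonneg_borel_def space_restrict_space)
  show "X i -` A \<inter> space (sigma_rvs M I X) \<in> sets (sigma_rvs M I X)" if "A \<in> sets nonneg_borel" for A
    using that assms(1) unfolding sets_sigma_rvs by (auto intro!: sigma_sets.Basic)
qed

lemma space_sigma_join [simp]: "space (sigma_join M F G) = space M"
  by (auto simp: sigma_join_def space_measure_of_conv)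

context
  fixes M F G :: "'a measure"
  assumes F: "subalgebra M F" and G: "subalgebra M G"
begin

lemma sets_sigma_join: "sets (sigma_join M F G) = sigma_sets (space M) (sets F \<union> sets G)"
  unfolding sigma_join_def using F G sets.space_closed[of F] sets.space_closed[of G]
  by (intro sets_measure_of) (auto simp: subalgebra_def)

lemma subalgebra_sigma_join:
  "subalgebra M (sigma_join M F G)" "subalgebra (sigma_join M F G) F" "subalgebra (sigma_join M F G) G"
  using F G by (auto simp: subalgebra_def sets_sigma_join intro!: sets.sigma_sets_subset)

end

lemma sets_sigma_join_mono:
  assumes "subalgebra M F" "subalgebra M G" "subalgebra M F'" "subalgebra M G'"
    and "sets F \<subseteq> sets F'" "sets G \<subseteq> sets G'"
  shows "sets (sigma_join M F G) \<subseteq> sets (sigma_join M F' G')"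
  using assms by (auto simp: sets_sigma_join intro!: sigma_sets_mono')

lemma cond_eq_sum:
  assumes "finite I" and c: "\<And>i. i \<in> I \<Longrightarrow> 0 \<le> c i" and sub: "subalgebra M G"
    and meas: "\<And>i. i \<in> I \<Longrightarrow> X i \<in> borel_measurable M" "\<And>i. i \<in> I \<Longrightarrow> Y i \<in> borel_measurable M"
    and nonneg: "\<And>i \<omega>. i \<in> I \<Longrightarrow> \<omega> \<in> space M \<Longrightarrow> 0 \<le> X i \<omega>" "\<And>i \<omega>. i \<in> I \<Longrightarrow> \<omega> \<in> space M \<Longrightarrow> 0 \<le> Y i \<omega>"
    and eq: "\<And>i. i \<in> I \<Longrightarrow> cond_eq M G (X i) (Y i)"
  shows "cond_eq M G (\<lambda>\<omega>. \<Sum>i\<in>I. X i \<omega> * c i) (\<lambda>\<omega>. \<Sum>i\<in>I. Y i \<omega> * c i)"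
  unfolding cond_eq_def
proof
  fix A assume A: "A \<in> sets G"
  then have [measurable]: "A \<in> sets M" using sub by (auto simp: subalgebra_def)
  have sum: "(\<integral>\<^sup>+\<omega>\<in>A. ennreal (\<Sum>i\<in>I. V i \<omega> * c i) \<partial>M) = (\<Sum>i\<in>I. (\<integral>\<^sup>+\<omega>\<in>A. ennreal (V i \<omega>) \<partial>M) * ennreal (c i))"
    if V: "\<And>i. i \<in> I \<Longrightarrow> V i \<in> borel_measurable M" "\<And>i \<omega>. i \<in> I \<Longrightarrow> \<omega> \<in> space M \<Longrightarrow> 0 \<le> V i \<omega>" for V
  proof -
    have "(\<integral>\<^sup>+\<omega>\<in>A. ennreal (\<Sum>i\<in>I. V i \<omega> * c i) \<partial>M) =
        (\<integral>\<^sup>+\<omega>. (\<Sum>i\<in>I. (ennreal (V i \<omega>) * indicator A \<omega>) * ennreal (c i)) \<partial>M)"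
    proof (rule nn_integral_cong)
      fix \<omega> assume \<omega>: "\<omega> \<in> space M"
      have "ennreal (\<Sum>i\<in>I. V i \<omega> * c i) = (\<Sum>i\<in>I. ennreal (V i \<omega>) * ennreal (c i))"
        using V(2)[OF _ \<omega>] c by (subst sum_ennreal[symmetric]) (auto simp: ennreal_mult)
      then show "ennreal (\<Sum>i\<in>I. V i \<omega> * c i) * indicator A \<omega> =
          (\<Sum>i\<in>I. (ennreal (V i \<omega>) * indicator A \<omega>) * ennreal (c i))"
        by (simp add: sum_distrib_left sum_distrib_right mult_ac)
    qed
    also have "\<dots> = (\<Sum>i\<in>I. \<integral>\<^sup>+\<omega>. (ennreal (V i \<omega>) * indicator A \<omega>) * ennreal (c i) \<partial>M)"
      using V(1) by (intro nn_integral_sum) auto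
    also have "\<dots> = (\<Sum>i\<in>I. (\<integral>\<^sup>+\<omega>\<in>A. ennreal (V i \<omega>) \<partial>M) * ennreal (c i))"
      using V(1) by (intro sum.cong nn_integral_multc refl) auto
    finally show ?thesis .
  qed
  show "(\<integral>\<^sup>+\<omega>\<in>A. ennreal (\<Sum>i\<in>I. X i \<omega> * c i) \<partial>M) = (\<integral>\<^sup>+\<omega>\<in>A. ennreal (\<Sum>i\<in>I. Y i \<omega> * c i) \<partial>M)"
    using sum[of X] sum[of Y] meas nonneg eq A by (simp add: cond_eq_def)
qed

lemma cond_eq_refl: "cond_eq M G X X"
  by (simp add: cond_eq_def)

context prob_space
begin

lemma sets_sigma_rvs_subset_vimage:
  assumes rv: "(\<lambda>\<omega>. \<lambda>i\<in>I. X i \<omega>) \<in> M \<rightarrow>\<^sub>M PiM I (\<lambda>_. nonneg_borel)"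
  shows "sets (sigma_rvs M I X) \<subseteq> sigma_sets (space M)
      {(\<lambda>\<omega>. \<lambda>i\<in>I. X i \<omega>) -` A \<inter> space M |A. A \<in> sets (PiM I (\<lambda>_. nonneg_borel))}"
  unfolding sets_sigma_rvs
proof (intro sigma_sets_mono', safe)
  fix i A assume i: "i \<in> I" and A: "A \<in> sets nonneg_borel"
  have "X i -` A \<inter> space M = (\<lambda>\<omega>. \<lambda>i\<in>I. X i \<omega>) -` ((\<lambda>x. x i) -` A \<inter> space (PiM I (\<lambda>_. nonneg_borel))) \<inter> space M"
    using measurable_space[OF rv] i by auto
  moreover have "(\<lambda>x. x i) -` A \<inter> space (PiM I (\<lambda>_. nonneg_borel)) \<in> sets (PiM I (\<lambda>_. nonneg_borel))"
    using measurable_component_singleton[OF i] A by (rule measurable_sets)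
  ultimately show "\<exists>B. X i -` A \<inter> space M = (\<lambda>\<omega>. \<lambda>i\<in>I. X i \<omega>) -` B \<inter> space M \<and> B \<in> sets (PiM I (\<lambda>_. nonneg_borel))"
    by blast
qed

lemma martingale_if_cond_eq:
  assumes sub: "\<And>n. subalgebra M (G n)" and mono: "\<And>m n. m \<le> n \<Longrightarrow> sets (G m) \<subseteq> sets (G n)"
    and meas: "\<And>n. X n \<in> borel_measurable (G n)" and nonneg: "\<And>n \<omega>. \<omega> \<in> space M \<Longrightarrow> 0 \<le> X n \<omega>"
    and fin: "(\<integral>\<^sup>+\<omega>. ennreal (X 0 \<omega>) \<partial>M) < \<infinity>"
    and step: "\<And>n. cond_eq M (G n) (X (Suc n)) (X n)"
  shows "martingale M G X"
proof -
  have steps: "(\<integral>\<^sup>+\<omega>\<in>A. ennreal (X n \<omega>) \<partial>M) = (\<integral>\<^sup>+\<omega>\<in>A. ennreal (X m \<omega>) \<partial>M)"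
    if "m \<le> n" "A \<in> sets (G m)" for m n A
    using that(1)
  proof (induction n rule: dec_induct)
    case (step k)
    then show ?case using \<open>\<And>n. cond_eq M (G n) (X (Suc n)) (X n)\<close>[of k] mono[of m k] that(2)
      by (auto simp: cond_eq_def)
  qed simp
  have sp: "space M \<in> sets (G n)" for n using sub by (metis sets.top subalgebra_def)
  have top: "(\<integral>\<^sup>+\<omega>\<in>space M. f \<omega> \<partial>M) = (\<integral>\<^sup>+\<omega>. f \<omega> \<partial>M)" for f :: "'a \<Rightarrow> ennreal"
    by (intro nn_integral_cong) simp
  have measM[measurable]: "X n \<in> borel_measurable M" for n using measurable_from_subalg[OF sub meas] .
  have int: "integrable M (X n)" for n
    using steps[OF _ sp, of 0 n] fin nonneg by (intro integrableI_nonneg) (auto simp: top)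
  have AE: "AE \<omega> in M. real_cond_exp M (G m) (X n) \<omega> = X m \<omega>" if "m \<le> n" for m n
  proof -
    interpret finite_measure_subalgebra M "G m" by unfold_locales (rule sub)
    show ?thesis
    proof (rule real_cond_exp_charact[OF _ int int meas])
      fix A assume A: "A \<in> sets (G m)"
      then have [measurable]: "A \<in> events" using sub by (auto simp: subalgebra_def)
      have "(\<integral>\<omega>\<in>A. X k \<omega> \<partial>M) = enn2real (\<integral>\<^sup>+\<omega>\<in>A. ennreal (X k \<omega>) \<partial>M)" for k
      proof -
        have "(\<integral>\<omega>\<in>A. X k \<omega> \<partial>M) = enn2real (\<integral>\<^sup>+\<omega>. ennreal (indicat_real A \<omega> *\<^sub>R X k \<omega>) \<partial>M)"
          unfolding set_lebesgue_integral_def using nonneg by (intro integral_eq_nn_integral) auto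
        also have "(\<integral>\<^sup>+\<omega>. ennreal (indicat_real A \<omega> *\<^sub>R X k \<omega>) \<partial>M) = (\<integral>\<^sup>+\<omega>\<in>A. ennreal (X k \<omega>) \<partial>M)"
          by (intro nn_integral_cong) (auto simp: indicator_def)
        finally show ?thesis .
      qed
      then show "(\<integral>\<omega>\<in>A. X n \<omega> \<partial>M) = (\<integral>\<omega>\<in>A. X m \<omega> \<partial>M)" using steps[OF that A] by simp
    qed
  qed
  have "filtration (space M) G"
    by unfold_locales (use sub mono in \<open>auto simp: subalgebra_def\<close>)
  then show ?thesis using sub meas int AE by (auto simp: martingale_def)
qed

lemma indep_set_subset: "indep_set S T \<Longrightarrow> S' \<subseteq> S \<Longrightarrow> T' \<subseteq> T \<Longrightarrow> indep_set S' T'"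
  unfolding indep_sets2_eq by blast

text \<open>Joint independence of two families, expressed by their product-valued maps, gives independence
  of the generated sigma-algebras.\<close>

lemma indep_set_sigma_rvs:
  assumes "indep_var (PiM I (\<lambda>_. nonneg_borel)) (\<lambda>\<omega>. \<lambda>i\<in>I. X i \<omega>) (PiM J (\<lambda>_. nonneg_borel)) (\<lambda>\<omega>. \<lambda>i\<in>J. Y i \<omega>)"
  shows "indep_set (sets (sigma_rvs M I X)) (sets (sigma_rvs M J Y))"
  using assms unfolding indep_var_eq
  by (elim conjE) (erule indep_set_subset; rule sets_sigma_rvs_subset_vimage; assumption)

lemma nn_integral_mult_indep:
  fixes f g :: "'a \<Rightarrow> ennreal"
  assumes F: "subalgebra M F" and K: "subalgebra M K" and indep: "indep_set (sets F) (sets K)"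
    and f: "f \<in> borel_measurable F" and g: "g \<in> borel_measurable K"
  shows "(\<integral>\<^sup>+\<omega>. f \<omega> * g \<omega> \<partial>M) = (\<integral>\<^sup>+\<omega>. f \<omega> \<partial>M) * (\<integral>\<^sup>+\<omega>. g \<omega> \<partial>M)"
proof -
  have sub: "sigma_sets (space M) {f -` A \<inter> space M |A. A \<in> sets borel} \<subseteq> sets F"
    if "subalgebra M F" "f \<in> borel_measurable F" for F and f :: "'a \<Rightarrow> ennreal"
  proof -
    have "space F = space M" using that(1) by (simp add: subalgebra_def)
    then show ?thesis
      using measurable_sets[OF that(2)] sets.sigma_sets_subset[of "{f -` A \<inter> space M |A. A \<in> sets borel}" F]
      by auto
  qed
  have "indep_var borel f borel g"
    unfolding indep_var_eq
    by (intro conjI measurable_from_subalg[OF F f] measurable_from_subalg[OF K g]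
        indep_set_subset[OF indep] sub[OF F f] sub[OF K g])
  then have "indep_vars (case_bool borel borel) (case_bool f g) UNIV" by (simp only: indep_var_def)
  also have "case_bool borel borel = (\<lambda>_. borel)" by (auto split: bool.split)
  finally have "(\<integral>\<^sup>+\<omega>. (\<Prod>i\<in>UNIV. case_bool f g i \<omega>) \<partial>M) = (\<Prod>i\<in>UNIV. \<integral>\<^sup>+\<omega>. case_bool f g i \<omega> \<partial>M)"
    by (intro indep_vars_nn_integral) auto
  then show ?thesis by (simp add: UNIV_bool mult.commute)
qed

text \<open>Products of independent martingales are martingales for the joint filtration. On \<open>A \<inter> C\<close> with
  \<open>A\<close> in \<open>F\<close> and \<open>C\<close> in \<open>K\<close> both sides factorise; these events form a generator that is stable
  under intersections, so the two finite measures with densities \<open>u v\<close> and \<open>u' v'\<close> agree on the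
  join. The sigma-algebras \<open>F'\<close> and \<open>K'\<close> carry the independence; taking \<open>F = F'\<close> and \<open>u = u'\<close> reveals
  one family completely.\<close>

lemma cond_eq_mult_indep:
  assumes F': "subalgebra M F'" and K': "subalgebra M K'" and indep: "indep_set (sets F') (sets K')"
    and F: "subalgebra F' F" and K: "subalgebra K' K"
    and u: "u \<in> borel_measurable F'" "u' \<in> borel_measurable F'"
    and v: "v \<in> borel_measurable K'" "v' \<in> borel_measurable K'"
    and nonneg: "\<And>\<omega>. \<omega> \<in> space M \<Longrightarrow> 0 \<le> u \<omega>" "\<And>\<omega>. \<omega> \<in> space M \<Longrightarrow> 0 \<le> u' \<omega>"
    and fin: "(\<integral>\<^sup>+\<omega>. ennreal (u \<omega>) \<partial>M) < \<infinity>" "(\<integral>\<^sup>+\<omega>. ennreal (v \<omega>) \<partial>M) < \<infinity>"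
    and eq: "cond_eq M F u u'" "cond_eq M K v v'"
  shows "cond_eq M (sigma_join M F K) (\<lambda>\<omega>. u \<omega> * v \<omega>) (\<lambda>\<omega>. u' \<omega> * v' \<omega>)"
proof -
  have FM: "subalgebra M F" and KM: "subalgebra M K" using F K F' K' by (auto simp: subalgebra_def)
  note J = subalgebra_sigma_join[OF FM KM]
  have sp: "space F = space M" "space K = space M" using FM KM by (auto simp: subalgebra_def)
  let ?J = "sigma_join M F K"
  let ?E = "{A \<inter> C |A C. A \<in> sets F \<and> C \<in> sets K}"
  have rect: "(\<integral>\<^sup>+\<omega>\<in>A \<inter> C. ennreal (f \<omega> * g \<omega>) \<partial>M) =
      (\<integral>\<^sup>+\<omega>\<in>A. ennreal (f \<omega>) \<partial>M) * (\<integral>\<^sup>+\<omega>\<in>C. ennreal (g \<omega>) \<partial>M)"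
    if "A \<in> sets F" "C \<in> sets K" "f \<in> borel_measurable F'" "g \<in> borel_measurable K'"
      "\<And>\<omega>. \<omega> \<in> space M \<Longrightarrow> 0 \<le> f \<omega>" for A C and f g :: "'a \<Rightarrow> real"
  proof -
    have [measurable]: "A \<in> sets F'" "C \<in> sets K'" using that F K by (auto simp: subalgebra_def)
    note [measurable] = that(3,4)
    have "(\<integral>\<^sup>+\<omega>\<in>A \<inter> C. ennreal (f \<omega> * g \<omega>) \<partial>M) =
      (\<integral>\<^sup>+\<omega>. (ennreal (f \<omega>) * indicator A \<omega>) * (ennreal (g \<omega>) * indicator C \<omega>) \<partial>M)"
      using that(5) by (intro nn_integral_cong) (auto simp: indicator_def ennreal_mult')
    also have "\<dots> = (\<integral>\<^sup>+\<omega>\<in>A. ennreal (f \<omega>) \<partial>M) * (\<integral>\<^sup>+\<omega>\<in>C. ennreal (g \<omega>) \<partial>M)"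
      by (rule nn_integral_mult_indep[OF F' K' indep]) measurable
    finally show ?thesis .
  qed
  define N where "N h = distr (density M (\<lambda>\<omega>. ennreal (h \<omega>))) ?J (\<lambda>\<omega>. \<omega>)" for h :: "'a \<Rightarrow> real"
  have N: "emeasure (N h) A = (\<integral>\<^sup>+\<omega>\<in>A. ennreal (h \<omega>) \<partial>M)"
    if "A \<in> sets ?J" and [measurable]: "h \<in> borel_measurable M" for A h
  proof -
    have A: "A \<in> events" using that J by (auto simp: subalgebra_def)
    have "(\<lambda>\<omega>. \<omega>) \<in> M \<rightarrow>\<^sub>M ?J" using J(1) by (auto simp: measurable_def subalgebra_def)
    then have "emeasure (N h) A = emeasure (density M (\<lambda>\<omega>. ennreal (h \<omega>))) ((\<lambda>\<omega>. \<omega>) -` A \<inter> space M)"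
      unfolding N_def using that by (subst emeasure_distr) auto
    also have "(\<lambda>\<omega>. \<omega>) -` A \<inter> space M = A" using sets.sets_into_space[OF A] by auto
    finally show ?thesis using A by (simp add: emeasure_density)
  qed
  have uvM: "(\<lambda>\<omega>. u \<omega> * v \<omega>) \<in> borel_measurable M" "(\<lambda>\<omega>. u' \<omega> * v' \<omega>) \<in> borel_measurable M"
    using measurable_from_subalg[OF F' u(1)] measurable_from_subalg[OF F' u(2)]
      measurable_from_subalg[OF K' v(1)] measurable_from_subalg[OF K' v(2)] by auto
  have EJ: "?E \<subseteq> sets ?J" using J(2,3) by (auto simp: subalgebra_def)
  have gen: "sets ?J = sigma_sets (space M) ?E"
  proof
    have "sets F \<union> sets K \<subseteq> ?E"
    proof safe
      fix A assume "A \<in> sets F"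
      then show "\<exists>A' C. A = A' \<inter> C \<and> A' \<in> sets F \<and> C \<in> sets K"
        using sets.sets_into_space[of A F] sets.top[of K] sp by (intro exI[of _ A] exI[of _ "space M"]) auto
    next
      fix A assume "A \<in> sets K"
      then show "\<exists>A' C. A = A' \<inter> C \<and> A' \<in> sets F \<and> C \<in> sets K"
        using sets.sets_into_space[of A K] sets.top[of F] sp by (intro exI[of _ "space M"] exI[of _ A]) auto
    qed
    then show "sets ?J \<subseteq> sigma_sets (space M) ?E"
      unfolding sets_sigma_join[OF FM KM] by (rule sigma_sets_mono')
    show "sigma_sets (space M) ?E \<subseteq> sets ?J"
      using sets.sigma_sets_subset[OF EJ] by simp
  qed
  have eqN: "N (\<lambda>\<omega>. u \<omega> * v \<omega>) = N (\<lambda>\<omega>. u' \<omega> * v' \<omega>)"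
  proof (rule measure_eqI_generator_eq[where E = ?E and \<Omega> = "space M" and A = "\<lambda>_. space M"])
    show "Int_stable ?E"
    proof (rule Int_stableI, safe)
      fix A C A' C' assume "A \<in> sets F" "C \<in> sets K" "A' \<in> sets F" "C' \<in> sets K"
      then show "\<exists>A'' C''. A \<inter> C \<inter> (A' \<inter> C') = A'' \<inter> C'' \<and> A'' \<in> sets F \<and> C'' \<in> sets K"
        by (intro exI[of _ "A \<inter> A'"] exI[of _ "C \<inter> C'"]) auto
    qed
    show "?E \<subseteq> Pow (space M)" using FM sets.sets_into_space[of _ F] sp by blast
    show "emeasure (N (\<lambda>\<omega>. u \<omega> * v \<omega>)) X = emeasure (N (\<lambda>\<omega>. u' \<omega> * v' \<omega>)) X" if X: "X \<in> ?E" for X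
    proof -
      obtain A C where AC: "X = A \<inter> C" "A \<in> sets F" "C \<in> sets K" using X by blast
      show ?thesis
        using N[OF subsetD[OF EJ X] uvM(1)] N[OF subsetD[OF EJ X] uvM(2)] AC(2,3) eq
          rect[OF AC(2,3) u(1) v(1) nonneg(1)] rect[OF AC(2,3) u(2) v(2) nonneg(2)]
        unfolding cond_eq_def AC(1)[symmetric] by simp
    qed
    show "sets (N (\<lambda>\<omega>. u \<omega> * v \<omega>)) = sigma_sets (space M) ?E" "sets (N (\<lambda>\<omega>. u' \<omega> * v' \<omega>)) = sigma_sets (space M) ?E"
      by (simp_all add: N_def gen)
    have spF: "space M \<in> sets F" "space M \<in> sets K" using sp by (metis sets.top)+
    then have sE: "space M \<in> ?E" by blast
    then show "range (\<lambda>_::nat. space M) \<subseteq> ?E" by blast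
    have "emeasure (N (\<lambda>\<omega>. u \<omega> * v \<omega>)) (space M) = (\<integral>\<^sup>+\<omega>\<in>space M \<inter> space M. ennreal (u \<omega> * v \<omega>) \<partial>M)"
      using N[OF subsetD[OF EJ sE] uvM(1)] by simp
    also have "\<dots> = (\<integral>\<^sup>+\<omega>\<in>space M. ennreal (u \<omega>) \<partial>M) * (\<integral>\<^sup>+\<omega>\<in>space M. ennreal (v \<omega>) \<partial>M)"
      using rect[OF spF u(1) v(1) nonneg(1)] .
    also have "\<dots> = (\<integral>\<^sup>+\<omega>. ennreal (u \<omega>) \<partial>M) * (\<integral>\<^sup>+\<omega>. ennreal (v \<omega>) \<partial>M)"
      by (intro arg_cong2[where f = "(*)"] nn_integral_cong) auto
    also have "\<dots> < \<infinity>" using fin by (simp add: ennreal_mult_less_top)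
    finally show "emeasure (N (\<lambda>\<omega>. u \<omega> * v \<omega>)) (space M) \<noteq> \<infinity>" by simp
  qed auto
  show ?thesis
    unfolding cond_eq_def
  proof
    fix A assume A: "A \<in> sets ?J"
    show "(\<integral>\<^sup>+\<omega>\<in>A. ennreal (u \<omega> * v \<omega>) \<partial>M) = (\<integral>\<^sup>+\<omega>\<in>A. ennreal (u' \<omega> * v' \<omega>) \<partial>M)"
      unfolding N[OF A uvM(1), symmetric] N[OF A uvM(2), symmetric] eqN ..
  qed
qed

end

section \<open>A weighted cascade with independent percolation\<close>

locale percolated_cascade = prob_space M for M :: "'a measure" +
  fixes b :: nat and \<beta> :: real and W F B :: "nat list \<Rightarrow> 'a \<Rightarrow> real"
    and QF :: "nat \<Rightarrow> (nat \<Rightarrow> nat) \<Rightarrow> 'a \<Rightarrow> real"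
  assumes b: "b \<ge> 2"
    and W: "\<And>\<gamma>. \<gamma> \<in> words b \<Longrightarrow> W \<gamma> \<in> M \<rightarrow>\<^sub>M nonneg_borel"
    and cascade: "weighted_cascade b M (W_path_sigma M W) (W_filtration b M W) W F QF"
    and beta: "beta_generator b M \<beta> B"
    and indep_WB: "indep_var
           (PiM (words b) (\<lambda>_. nonneg_borel)) (\<lambda>\<omega>. \<lambda>\<gamma>\<in>words b. W \<gamma> \<omega>)
           (PiM {\<gamma>\<in>words b. 1 \<le> length \<gamma>} (\<lambda>_. nonneg_borel))
           (\<lambda>\<omega>. \<lambda>\<gamma>\<in>{\<gamma>\<in>words b. 1 \<le> length \<gamma>}. B \<gamma> \<omega>)"
begin

definition B_sigma :: "nat \<Rightarrow> 'a measure" where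
  "B_sigma n = sigma_rvs M {\<gamma>\<in>words b. 1 \<le> length \<gamma> \<and> length \<gamma> \<le> n} B"

definition all_W :: "'a measure" where
  "all_W = sigma_rvs M (words b) W"

definition all_B :: "'a measure" where
  "all_B = sigma_rvs M {\<gamma>\<in>words b. 1 \<le> length \<gamma>} B"

definition B_weight :: "nat list \<Rightarrow> 'a \<Rightarrow> real" where
  "B_weight \<gamma> \<omega> = (\<Prod>j=1..length \<gamma>. B (take j \<gamma>) \<omega>)"

definition W_weight :: "nat list \<Rightarrow> 'a \<Rightarrow> real" where
  "W_weight \<gamma> \<omega> = (\<Prod>j=0..length \<gamma>. W (take j \<gamma>) \<omega>) * F \<gamma> \<omega>"

lemma take_in_words: "\<gamma> \<in> words b \<Longrightarrow> take j \<gamma> \<in> words b"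
  using set_take_subset[of j \<gamma>] by (auto simp: words_def)

lemma B_rv: "\<gamma> \<in> words b \<Longrightarrow> 1 \<le> length \<gamma> \<Longrightarrow> B \<gamma> \<in> M \<rightarrow>\<^sub>M nonneg_borel"
  using beta by (auto simp: beta_generator_def indep_vars_def)

lemma B_nonneg: "\<gamma> \<in> words b \<Longrightarrow> 1 \<le> length \<gamma> \<Longrightarrow> \<omega> \<in> space M \<Longrightarrow> 0 \<le> B \<gamma> \<omega>"
  using B_rv by (simp add: measurable_nonneg_borel_iff)

lemma subalgebras:
  "subalgebra M all_W" "subalgebra M all_B" "subalgebra M (B_sigma n)" "subalgebra M (W_filtration b M W n)"
  unfolding all_W_def all_B_def B_sigma_def W_filtration_def
  by (intro subalgebra_sigma_rvs; use W B_rv in auto)+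

lemma subalgebras_all: "subalgebra all_B (B_sigma n)" "subalgebra all_W (W_filtration b M W n)"
  unfolding subalgebra_def all_W_def all_B_def B_sigma_def W_filtration_def space_sigma_rvs
  by (intro conjI refl sets_sigma_rvs_mono; auto)+

lemma sets_mono:
  "m \<le> n \<Longrightarrow> sets (B_sigma m) \<subseteq> sets (B_sigma n)"
  "m \<le> n \<Longrightarrow> sets (W_filtration b M W m) \<subseteq> sets (W_filtration b M W n)"
  unfolding B_sigma_def W_filtration_def by (rule sets_sigma_rvs_mono; auto)+

lemma indep_W_B: "indep_set (sets all_W) (sets all_B)"
  unfolding all_W_def all_B_def by (rule indep_set_sigma_rvs[OF indep_WB])

lemma B_weight_measurable:
  assumes "\<gamma> \<in> words b" "length \<gamma> \<le> n"
  shows "B_weight \<gamma> \<in> borel_measurable (B_sigma n)"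
  unfolding B_weight_def[abs_def]
proof (rule borel_measurable_prod)
  fix j assume "j \<in> {1..length \<gamma>}"
  then have "take j \<gamma> \<in> words b" "1 \<le> length (take j \<gamma>)" "length (take j \<gamma>) \<le> n"
    using assms take_in_words by auto
  then have "B (take j \<gamma>) \<in> B_sigma n \<rightarrow>\<^sub>M nonneg_borel"
    unfolding B_sigma_def by (intro measurable_sigma_rvs) (auto intro: B_nonneg)
  then show "B (take j \<gamma>) \<in> borel_measurable (B_sigma n)" by (simp add: measurable_nonneg_borel_iff)
qed

lemma B_weight_nonneg: "\<gamma> \<in> words b \<Longrightarrow> \<omega> \<in> space M \<Longrightarrow> 0 \<le> B_weight \<gamma> \<omega>"
  unfolding B_weight_def by (auto intro!: prod_nonneg B_nonneg take_in_words)

lemma B_weight_snoc: "B_weight (\<gamma> @ [i]) \<omega> = B_weight \<gamma> \<omega> * B (\<gamma> @ [i]) \<omega>"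
proof -
  have "B_weight (\<gamma> @ [i]) \<omega> = (\<Prod>j=1..length \<gamma>. B (take j (\<gamma> @ [i])) \<omega>) * B (\<gamma> @ [i]) \<omega>"
    by (simp add: B_weight_def)
  also have "(\<Prod>j=1..length \<gamma>. B (take j (\<gamma> @ [i])) \<omega>) = B_weight \<gamma> \<omega>"
    unfolding B_weight_def by (intro prod.cong) auto
  finally show ?thesis .
qed

lemma beta_cascade_eq: "beta_cascade B n t \<omega> = B_weight (tprefix t n) \<omega>"
  unfolding beta_cascade_def B_weight_def by (intro prod.cong) (auto simp: take_tprefix)

lemma QF_eq: "t \<in> boundary b \<Longrightarrow> \<omega> \<in> space M \<Longrightarrow> QF n t \<omega> = W_weight (tprefix t n) \<omega>"
  using cascade by (auto simp: weighted_cascade_def W_weight_def take_tprefix intro!: prod.cong)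

lemma QF_martingale: "t \<in> boundary b \<Longrightarrow> martingale M (W_filtration b M W) (\<lambda>n. QF n t)"
  using cascade by (simp add: weighted_cascade_def positive_T_martingale_def)

lemma W_weight_nonneg:
  assumes "\<gamma> \<in> words b" "\<omega> \<in> space M"
  shows "0 \<le> W_weight \<gamma> \<omega>"
proof -
  obtain t where t: "t \<in> boundary b" "tprefix t (length \<gamma>) = \<gamma>" using word_extends[of b \<gamma>] b assms by auto
  have "0 \<le> QF (length \<gamma>) t \<omega>"
    using cascade t(1) assms(2) unfolding weighted_cascade_def positive_T_martingale_def by blast
  then show ?thesis using QF_eq[OF t(1) assms(2), of "length \<gamma>"] t(2) by simp
qed

lemma W_weight_integrable:
  assumes "\<gamma> \<in> words b" "length \<gamma> \<le> n"
  shows "W_weight \<gamma> \<in> borel_measurable (W_filtration b M W n)" and "integrable M (W_weight \<gamma>)"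
proof -
  obtain t where t: "t \<in> boundary b" "tprefix t (length \<gamma>) = \<gamma>" using word_extends[of b \<gamma>] b assms by auto
  have eq: "W_weight \<gamma> \<omega> = QF (length \<gamma>) t \<omega>" if "\<omega> \<in> space M" for \<omega> using QF_eq[OF t(1) that] t(2) by simp
  have "QF (length \<gamma>) t \<in> borel_measurable (W_filtration b M W (length \<gamma>))" "integrable M (QF (length \<gamma>) t)"
    using QF_martingale[OF t(1)] by (simp_all add: martingale_def)
  then show "integrable M (W_weight \<gamma>)"
    using Bochner_Integration.integrable_cong[of M M "W_weight \<gamma>" "QF (length \<gamma>) t"] eq by simp
  have "subalgebra (W_filtration b M W n) (W_filtration b M W (length \<gamma>))"
    using sets_mono(2)[OF assms(2)] subalgebras(4) by (simp add: subalgebra_def)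
  then have "QF (length \<gamma>) t \<in> borel_measurable (W_filtration b M W n)"
    using \<open>QF (length \<gamma>) t \<in> _\<close> by (rule measurable_from_subalg)
  moreover have "space (W_filtration b M W n) = space M" by (simp add: W_filtration_def)
  ultimately show "W_weight \<gamma> \<in> borel_measurable (W_filtration b M W n)"
    using measurable_cong[of "W_filtration b M W n" "W_weight \<gamma>" "QF (length \<gamma>) t" borel] eq by auto
qed

lemma W_weight_finite: "\<gamma> \<in> words b \<Longrightarrow> (\<integral>\<^sup>+\<omega>. ennreal (W_weight \<gamma> \<omega>) \<partial>M) < \<infinity>"
  using W_weight_integrable(2)[of \<gamma> "length \<gamma>"] W_weight_nonneg
  by (subst nn_integral_eq_integral) auto

lemma cond_eq_W_weight:
  assumes t: "t \<in> boundary b"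
  shows "cond_eq M (W_filtration b M W n) (W_weight (tprefix t (Suc n))) (W_weight (tprefix t n))"
  unfolding cond_eq_def
proof
  fix A assume A: "A \<in> sets (W_filtration b M W n)"
  interpret finite_measure_subalgebra M "W_filtration b M W n"
    by unfold_locales (rule subalgebras)
  note mart = QF_martingale[OF t, unfolded martingale_def]
  have int: "integrable M (QF k t)" for k using mart by blast
  have [measurable]: "A \<in> events" using A subalgebras(4) by (auto simp: subalgebra_def)
  have [measurable]: "QF k t \<in> borel_measurable M" for k using int by auto
  have AE: "AE \<omega> in M. real_cond_exp M (W_filtration b M W n) (QF (Suc n) t) \<omega> = QF n t \<omega>"
    using mart by auto
  have "(\<integral>\<omega>\<in>A. QF (Suc n) t \<omega> \<partial>M) = (\<integral>\<omega>\<in>A. real_cond_exp M (W_filtration b M W n) (QF (Suc n) t) \<omega> \<partial>M)"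
    by (rule real_cond_exp_intA[OF int A])
  also have "\<dots> = (\<integral>\<omega>\<in>A. QF n t \<omega> \<partial>M)"
    unfolding set_lebesgue_integral_def
  proof (rule integral_cong_AE)
    show "AE \<omega> in M. indicat_real A \<omega> *\<^sub>R real_cond_exp M (W_filtration b M W n) (QF (Suc n) t) \<omega> =
        indicat_real A \<omega> *\<^sub>R QF n t \<omega>"
      using AE by eventually_elim simp
  qed measurable
  finally have eq: "(\<integral>\<omega>\<in>A. QF (Suc n) t \<omega> \<partial>M) = (\<integral>\<omega>\<in>A. QF n t \<omega> \<partial>M)" .
  have "(\<integral>\<^sup>+\<omega>\<in>A. ennreal (W_weight (tprefix t k) \<omega>) \<partial>M) = ennreal (\<integral>\<omega>\<in>A. QF k t \<omega> \<partial>M)" for k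
  proof -
    have nn: "0 \<le> QF k t \<omega>" if "\<omega> \<in> space M" for \<omega>
      using QF_eq[OF t that] W_weight_nonneg[OF tprefix_in_words[OF t] that] by simp
    have "(\<integral>\<^sup>+\<omega>\<in>A. ennreal (W_weight (tprefix t k) \<omega>) \<partial>M) = (\<integral>\<^sup>+\<omega>. ennreal (indicator A \<omega> *\<^sub>R QF k t \<omega>) \<partial>M)"
      using QF_eq[OF t] by (intro nn_integral_cong) (auto simp: indicator_def)
    also have "\<dots> = ennreal (\<integral>\<omega>\<in>A. QF k t \<omega> \<partial>M)"
      unfolding set_lebesgue_integral_def
      by (intro nn_integral_eq_integral integrable_mult_indicator int AE_I2) (use nn in auto)
    finally show ?thesis .
  qed
  then show "(\<integral>\<^sup>+\<omega>\<in>A. ennreal (W_weight (tprefix t (Suc n)) \<omega>) \<partial>M) = (\<integral>\<^sup>+\<omega>\<in>A. ennreal (W_weight (tprefix t n) \<omega>) \<partial>M)"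
    using eq by simp
qed

text \<open>The two values exhaust the probability, and \<open>b powr \<beta>\<close> times its probability is \<open>1\<close>.\<close>

lemma nn_integral_B:
  assumes \<gamma>: "\<gamma> \<in> words b" "1 \<le> length \<gamma>"
  shows "(\<integral>\<^sup>+\<omega>. ennreal (B \<gamma> \<omega>) \<partial>M) = 1"
proof -
  have [measurable]: "B \<gamma> \<in> borel_measurable M" using B_rv[OF \<gamma>] by (simp add: measurable_nonneg_borel_iff)
  let ?c = "real b powr \<beta>"
  let ?E = "{\<omega>\<in>space M. B \<gamma> \<omega> = ?c}" and ?O = "{\<omega>\<in>space M. B \<gamma> \<omega> = 0}"
  have c: "?c > 0" using b by simp
  have P: "prob ?E = real b powr (- \<beta>)" "prob ?O = 1 - real b powr (- \<beta>)"
    using beta \<gamma> by (auto simp: beta_generator_def)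
  have "prob (?E \<union> ?O) = prob ?E + prob ?O"
    using c by (intro finite_measure_Union) auto
  then have "prob (?E \<union> ?O) = 1" using P by simp
  then have "AE \<omega> in M. \<omega> \<in> ?E \<union> ?O" by (intro prob_eq_1[THEN iffD1]) auto
  then have "(\<integral>\<^sup>+\<omega>. ennreal (B \<gamma> \<omega>) \<partial>M) = (\<integral>\<^sup>+\<omega>. ennreal ?c * indicator ?E \<omega> \<partial>M)"
    by (intro nn_integral_cong_AE, eventually_elim) (auto simp: indicator_def)
  also have "\<dots> = ennreal ?c * ennreal (real b powr (- \<beta>))"
    using P by (simp add: nn_integral_cmult_indicator emeasure_eq_measure)
  also have "\<dots> = ennreal (real b powr \<beta> * real b powr (- \<beta>))" by (simp add: ennreal_mult)
  also have "real b powr \<beta> * real b powr (- \<beta>) = 1" using b by (simp flip: powr_add)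
  finally show ?thesis by simp
qed

text \<open>The new factor has mean one and is independent of the earlier generations.\<close>

lemma cond_eq_B_weight_snoc:
  assumes \<gamma>: "\<gamma> @ [i] \<in> words b"
  shows "cond_eq M (B_sigma (length \<gamma>)) (B_weight (\<gamma> @ [i])) (B_weight \<gamma>)"
  unfolding cond_eq_def
proof
  fix A assume A: "A \<in> sets (B_sigma (length \<gamma>))"
  let ?I = "{\<gamma>'\<in>words b. 1 \<le> length \<gamma>' \<and> length \<gamma>' \<le> length \<gamma>}"
  have "\<gamma> \<in> words b" using \<gamma> by (auto simp: words_def)
  have sub: "subalgebra M (sigma_rvs M {\<gamma> @ [i]} B)"
    using B_rv[OF \<gamma>] by (intro subalgebra_sigma_rvs) auto
  have "indep_var (PiM ?I (\<lambda>_. nonneg_borel)) (\<lambda>\<omega>. \<lambda>\<gamma>\<in>?I. B \<gamma> \<omega>)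
      (PiM {\<gamma> @ [i]} (\<lambda>_. nonneg_borel)) (\<lambda>\<omega>. \<lambda>\<gamma>\<in>{\<gamma> @ [i]}. B \<gamma> \<omega>)"
    by (rule indep_var_restrict[where I = "{\<gamma>\<in>words b. 1 \<le> length \<gamma>}"])
       (use beta \<gamma> in \<open>auto simp: beta_generator_def\<close>)
  then have ind: "indep_set (sets (B_sigma (length \<gamma>))) (sets (sigma_rvs M {\<gamma> @ [i]} B))"
    unfolding B_sigma_def by (rule indep_set_sigma_rvs)
  have Bm: "B (\<gamma> @ [i]) \<in> borel_measurable (sigma_rvs M {\<gamma> @ [i]} B)"
    using measurable_sigma_rvs[of "\<gamma> @ [i]" "{\<gamma> @ [i]}" M B] B_nonneg[OF \<gamma>] by (simp add: measurable_nonneg_borel_iff)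
  note [measurable] = A B_weight_measurable[OF \<open>\<gamma> \<in> words b\<close> order_refl] Bm
  have "(\<integral>\<^sup>+\<omega>\<in>A. ennreal (B_weight (\<gamma> @ [i]) \<omega>) \<partial>M) =
      (\<integral>\<^sup>+\<omega>. (ennreal (B_weight \<gamma> \<omega>) * indicator A \<omega>) * ennreal (B (\<gamma> @ [i]) \<omega>) \<partial>M)"
    using B_weight_nonneg[OF \<open>\<gamma> \<in> words b\<close>]
    by (intro nn_integral_cong) (auto simp: B_weight_snoc indicator_def ennreal_mult')
  also have "\<dots> = (\<integral>\<^sup>+\<omega>\<in>A. ennreal (B_weight \<gamma> \<omega>) \<partial>M) * (\<integral>\<^sup>+\<omega>. ennreal (B (\<gamma> @ [i]) \<omega>) \<partial>M)"
    by (rule nn_integral_mult_indep[OF subalgebras(3) sub ind]) measurable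
  finally show "(\<integral>\<^sup>+\<omega>\<in>A. ennreal (B_weight (\<gamma> @ [i]) \<omega>) \<partial>M) = (\<integral>\<^sup>+\<omega>\<in>A. ennreal (B_weight \<gamma> \<omega>) \<partial>M)"
    using nn_integral_B[OF \<gamma>] by simp
qed

lemma nn_integral_B_weight: "\<gamma> \<in> words b \<Longrightarrow> (\<integral>\<^sup>+\<omega>. ennreal (B_weight \<gamma> \<omega>) \<partial>M) = 1"
proof (induction \<gamma> rule: rev_induct)
  case Nil
  then show ?case by (simp add: B_weight_def emeasure_space_1)
next
  case (snoc i \<gamma>)
  have top: "(\<integral>\<^sup>+\<omega>\<in>space M. f \<omega> \<partial>M) = (\<integral>\<^sup>+\<omega>. f \<omega> \<partial>M)" for f :: "'a \<Rightarrow> ennreal"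
    by (intro nn_integral_cong) simp
  have "space M \<in> sets (B_sigma (length \<gamma>))" using subalgebras(3) by (metis sets.top subalgebra_def)
  then show ?case
    using cond_eq_B_weight_snoc[OF snoc.prems] snoc unfolding cond_eq_def by (auto simp: top words_def)
qed

lemma cond_eq_B_weight:
  "t \<in> boundary b \<Longrightarrow> cond_eq M (B_sigma n) (B_weight (tprefix t (Suc n))) (B_weight (tprefix t n))"
  using cond_eq_B_weight_snoc[of "tprefix t n" "t n"] tprefix_in_words[of t b "Suc n"] by (simp add: tprefix_Suc)

definition B_level :: "nat \<Rightarrow> 'a measure" where
  "B_level m = sigma_join M all_W (B_sigma m)"

definition W_level :: "nat \<Rightarrow> 'a measure" where
  "W_level n = sigma_join M (W_filtration b M W n) all_B"

lemma WB_filtration_eq: "WB_filtration b M W B n = sigma_join M (W_filtration b M W n) (B_sigma n)"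
  by (simp add: WB_filtration_def B_sigma_def)

text \<open>One more generation of either family leaves the conditional expectation unchanged, even if the
  other family is completely known.\<close>

lemma cond_eq_product:
  assumes t: "t \<in> boundary b"
  shows "cond_eq M (B_level m)
      (\<lambda>\<omega>. W_weight (tprefix t n) \<omega> * B_weight (tprefix t (Suc m)) \<omega>)
      (\<lambda>\<omega>. W_weight (tprefix t n) \<omega> * B_weight (tprefix t m) \<omega>)"
    and "cond_eq M (W_level n)
      (\<lambda>\<omega>. W_weight (tprefix t (Suc n)) \<omega> * B_weight (tprefix t m) \<omega>)
      (\<lambda>\<omega>. W_weight (tprefix t n) \<omega> * B_weight (tprefix t m) \<omega>)"
proof -
  note words = tprefix_in_words[OF t]
  have u: "W_weight (tprefix t k) \<in> borel_measurable all_W" for k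
    using W_weight_integrable(1)[OF words order_refl] subalgebras_all(2) measurable_from_subalg by blast
  have v: "B_weight (tprefix t k) \<in> borel_measurable all_B" for k
    using B_weight_measurable[OF words order_refl] subalgebras_all(1) measurable_from_subalg by blast
  note prem = subalgebras(1,2) indep_W_B
  have self: "subalgebra N N" for N :: "'a measure" by (simp add: subalgebra_def)
  show "cond_eq M (B_level m)
      (\<lambda>\<omega>. W_weight (tprefix t n) \<omega> * B_weight (tprefix t (Suc m)) \<omega>)
      (\<lambda>\<omega>. W_weight (tprefix t n) \<omega> * B_weight (tprefix t m) \<omega>)"
    unfolding B_level_def
    by (rule cond_eq_mult_indep[OF prem self subalgebras_all(1) u u v v _ _ _ _ cond_eq_refl cond_eq_B_weight[OF t]])
       (auto simp: W_weight_nonneg[OF words] W_weight_finite[OF words, simplified] nn_integral_B_weight[OF words])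
  show "cond_eq M (W_level n)
      (\<lambda>\<omega>. W_weight (tprefix t (Suc n)) \<omega> * B_weight (tprefix t m) \<omega>)
      (\<lambda>\<omega>. W_weight (tprefix t n) \<omega> * B_weight (tprefix t m) \<omega>)"
    unfolding W_level_def
    by (rule cond_eq_mult_indep[OF prem subalgebras_all(2) self u u v v _ _ _ _ cond_eq_W_weight[OF t] cond_eq_refl])
       (auto simp: W_weight_nonneg[OF words] W_weight_finite[OF words, simplified] nn_integral_B_weight[OF words])
qed


lemma level_subalgebras:
  "subalgebra M (B_level m)" "subalgebra M (W_level m)" "subalgebra M (WB_filtration b M W B m)"
  unfolding B_level_def W_level_def WB_filtration_eq by (intro subalgebra_sigma_join subalgebras)+

lemma level_mono:
  assumes "m \<le> n"
  shows "sets (B_level m) \<subseteq> sets (B_level n)" "sets (W_level m) \<subseteq> sets (W_level n)"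
    "sets (WB_filtration b M W B m) \<subseteq> sets (WB_filtration b M W B n)"
  unfolding B_level_def W_level_def WB_filtration_eq
  by (intro sets_sigma_join_mono subalgebras sets_mono[OF assms] order_refl)+

lemma WB_filtration_le_level:
  "sets (WB_filtration b M W B n) \<subseteq> sets (B_level n)" "sets (WB_filtration b M W B n) \<subseteq> sets (W_level n)"
  unfolding B_level_def W_level_def WB_filtration_eq using subalgebras_all
  by (intro sets_sigma_join_mono subalgebras order_refl; simp add: subalgebra_def)+

lemma level_measurable:
  assumes "\<gamma> \<in> words b" "length \<gamma> \<le> k"
  shows "W_weight \<gamma> \<in> borel_measurable (B_level m)" "B_weight \<gamma> \<in> borel_measurable (B_level k)"
    "W_weight \<gamma> \<in> borel_measurable (W_level k)" "B_weight \<gamma> \<in> borel_measurable (W_level m)"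
    "W_weight \<gamma> \<in> borel_measurable (WB_filtration b M W B k)" "B_weight \<gamma> \<in> borel_measurable (WB_filtration b M W B k)"
proof -
  note w = W_weight_integrable(1)[OF assms] and v = B_weight_measurable[OF assms]
  note w' = measurable_from_subalg[OF subalgebras_all(2) w] and v' = measurable_from_subalg[OF subalgebras_all(1) v]
  note J = subalgebra_sigma_join(2,3)[OF subalgebras(1,3)] subalgebra_sigma_join(2,3)[OF subalgebras(4,2)]
     subalgebra_sigma_join(2,3)[OF subalgebras(4,3)]
  show "W_weight \<gamma> \<in> borel_measurable (B_level m)" "B_weight \<gamma> \<in> borel_measurable (B_level k)"
    "W_weight \<gamma> \<in> borel_measurable (W_level k)" "B_weight \<gamma> \<in> borel_measurable (W_level m)"
    "W_weight \<gamma> \<in> borel_measurable (WB_filtration b M W B k)" "B_weight \<gamma> \<in> borel_measurable (WB_filtration b M W B k)"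
    unfolding B_level_def W_level_def WB_filtration_eq
    using measurable_from_subalg[OF J(1) w'] measurable_from_subalg[OF J(2) v] measurable_from_subalg[OF J(3) w]
      measurable_from_subalg[OF J(4) v'] measurable_from_subalg[OF J(5) w] measurable_from_subalg[OF J(6) v]
    by blast+
qed

lemma weights_measurable:
  assumes "\<gamma> \<in> words b"
  shows "W_weight \<gamma> \<in> borel_measurable M" "B_weight \<gamma> \<in> borel_measurable M"
  using measurable_from_subalg[OF level_subalgebras(3) level_measurable(5)[OF assms order_refl]]
    measurable_from_subalg[OF level_subalgebras(3) level_measurable(6)[OF assms order_refl]] .

context
  fixes \<sigma> :: "(nat \<Rightarrow> nat) measure"
  assumes \<sigma>: "\<sigma> \<in> finite_borel_measures b"
begin

text \<open>The two-parameter process \<open>Z\<^bsub>m,n\<^esub>\<close> of the introduction for the word \<open>\<gamma>\<close>.\<close>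

definition mass :: "nat list \<Rightarrow> nat \<Rightarrow> nat \<Rightarrow> 'a \<Rightarrow> real" where
  "mass \<gamma> m n \<omega> = (\<integral>t. of_bool (tprefix t (length \<gamma>) = \<gamma>) *
     (W_weight (tprefix t n) \<omega> * B_weight (tprefix t m) \<omega>) \<partial>\<sigma>)"

text \<open>The integrand only depends on a prefix of length \<open>N\<close>. A common level \<open>N\<close> for \<open>mass \<gamma> (Suc m) n\<close> and
  \<open>mass \<gamma> m n\<close> reduces the martingale properties of the process to those at single points \<open>t\<close>.\<close>

lemma mass_eq_sum:
  assumes "length \<gamma> \<le> N" "m \<le> N" "n \<le> N"
  shows "mass \<gamma> m n \<omega> = (\<Sum>\<delta>\<in>{\<delta>\<in>words b. length \<delta> = N}. (W_weight (take n \<delta>) \<omega> * B_weight (take m \<delta>) \<omega>) *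
     (of_bool (take (length \<gamma>) \<delta> = \<gamma>) * measure \<sigma> (cylinder b \<delta>)))"
proof -
  have "mass \<gamma> m n \<omega> = (\<integral>t. (\<lambda>\<delta>. of_bool (take (length \<gamma>) \<delta> = \<gamma>) *
     (W_weight (take n \<delta>) \<omega> * B_weight (take m \<delta>) \<omega>)) (tprefix t N) \<partial>\<sigma>)"
    using assms by (simp add: mass_def take_tprefix)
  also have "\<dots> = (\<Sum>\<delta>\<in>{\<delta>\<in>words b. length \<delta> = N}. (\<lambda>\<delta>. of_bool (take (length \<gamma>) \<delta> = \<gamma>) *
     (W_weight (take n \<delta>) \<omega> * B_weight (take m \<delta>) \<omega>)) \<delta> * measure \<sigma> (cylinder b \<delta>))"
    by (rule integral_prefix_function(2)[OF \<sigma>])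
  finally show ?thesis by (simp add: mult_ac)
qed

lemma mass_measurable:
  "mass \<gamma> m n \<in> borel_measurable (B_level m)" "mass \<gamma> m n \<in> borel_measurable (W_level n)"
  "mass \<gamma> m n \<in> borel_measurable (WB_filtration b M W B (max m n))"
proof -
  let ?N = "max (length \<gamma>) (max m n)"
  have eq: "mass \<gamma> m n = (\<lambda>\<omega>. \<Sum>\<delta>\<in>{\<delta>\<in>words b. length \<delta> = ?N}. (W_weight (take n \<delta>) \<omega> * B_weight (take m \<delta>) \<omega>) *
     (of_bool (take (length \<gamma>) \<delta> = \<gamma>) * measure \<sigma> (cylinder b \<delta>)))"
    by (intro ext mass_eq_sum) auto
  show "mass \<gamma> m n \<in> borel_measurable (B_level m)" "mass \<gamma> m n \<in> borel_measurable (W_level n)"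
    "mass \<gamma> m n \<in> borel_measurable (WB_filtration b M W B (max m n))"
    unfolding eq
    by (intro borel_measurable_sum borel_measurable_times borel_measurable_const level_measurable;
        auto simp: take_in_words)+
qed

lemma mass_nonneg: "\<omega> \<in> space M \<Longrightarrow> 0 \<le> mass \<gamma> m n \<omega>"
  unfolding mass_def using finite_borel_measuresD[OF \<sigma>]
  by (intro Bochner_Integration.integral_nonneg mult_nonneg_nonneg W_weight_nonneg B_weight_nonneg tprefix_in_words) auto

lemma cond_eq_mass:
  "cond_eq M (B_level m) (mass \<gamma> (Suc m) n) (mass \<gamma> m n)"
  "cond_eq M (W_level n) (mass \<gamma> m (Suc n)) (mass \<gamma> m n)"
proof -
  \<comment> \<open>One level deeper than \<open>m\<close> and \<open>n\<close>, so that it also resolves the next generation.\<close>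
  let ?N = "max (length \<gamma>) (Suc (max m n))"
  let ?D = "{\<delta>\<in>words b. length \<delta> = ?N}"
  have eq: "mass \<gamma> m' n' = (\<lambda>\<omega>. \<Sum>\<delta>\<in>?D. (W_weight (take n' \<delta>) \<omega> * B_weight (take m' \<delta>) \<omega>) *
     (of_bool (take (length \<gamma>) \<delta> = \<gamma>) * measure \<sigma> (cylinder b \<delta>)))" if "m' \<le> Suc m" "n' \<le> Suc n" for m' n'
    using that by (intro ext mass_eq_sum) auto
  have ext: "\<exists>t\<in>boundary b. \<forall>j\<le>?N. take j \<delta> = tprefix t j" if "\<delta> \<in> ?D" for \<delta>
  proof -
    have "1 \<le> b" "\<delta> \<in> words b" using b that by auto
    then obtain t where "t \<in> boundary b" "tprefix t (length \<delta>) = \<delta>" by (rule word_extends)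
    then show ?thesis using that take_tprefix[of _ ?N t] by (intro bexI[of _ t]) auto
  qed
  have eqB: "cond_eq M (B_level m) (\<lambda>\<omega>. W_weight (take n \<delta>) \<omega> * B_weight (take (Suc m) \<delta>) \<omega>)
      (\<lambda>\<omega>. W_weight (take n \<delta>) \<omega> * B_weight (take m \<delta>) \<omega>)" if \<delta>: "\<delta> \<in> ?D" for \<delta>
  proof -
    obtain t where t: "t \<in> boundary b" "\<forall>j\<le>?N. take j \<delta> = tprefix t j" using ext[OF \<delta>] by blast
    then have "take n \<delta> = tprefix t n" "take m \<delta> = tprefix t m" "take (Suc m) \<delta> = tprefix t (Suc m)" by auto
    then show ?thesis using cond_eq_product(1)[OF t(1), of m n] by simp
  qed
  have eqW: "cond_eq M (W_level n) (\<lambda>\<omega>. W_weight (take (Suc n) \<delta>) \<omega> * B_weight (take m \<delta>) \<omega>)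
      (\<lambda>\<omega>. W_weight (take n \<delta>) \<omega> * B_weight (take m \<delta>) \<omega>)" if \<delta>: "\<delta> \<in> ?D" for \<delta>
  proof -
    obtain t where t: "t \<in> boundary b" "\<forall>j\<le>?N. take j \<delta> = tprefix t j" using ext[OF \<delta>] by blast
    then have "take n \<delta> = tprefix t n" "take m \<delta> = tprefix t m" "take (Suc n) \<delta> = tprefix t (Suc n)" by auto
    then show ?thesis using cond_eq_product(2)[OF t(1), of n m] by simp
  qed
  have meas: "(\<lambda>\<omega>. W_weight (take i \<delta>) \<omega> * B_weight (take j \<delta>) \<omega>) \<in> borel_measurable M"
    and nonneg: "\<omega> \<in> space M \<Longrightarrow> 0 \<le> W_weight (take i \<delta>) \<omega> * B_weight (take j \<delta>) \<omega>" if "\<delta> \<in> ?D" for \<delta> i j \<omega>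
    using that weights_measurable[OF take_in_words] W_weight_nonneg[OF take_in_words] B_weight_nonneg[OF take_in_words]
    by auto
  have fin: "finite ?D" by (rule finite_words)
  show "cond_eq M (B_level m) (mass \<gamma> (Suc m) n) (mass \<gamma> m n)"
    unfolding eq[OF order_refl, of n, OF le_SucI[OF order_refl]] eq[OF le_SucI[OF order_refl] le_SucI[OF order_refl]]
    by (rule cond_eq_sum[OF fin _ level_subalgebras(1) meas meas nonneg nonneg eqB]) auto
  show "cond_eq M (W_level n) (mass \<gamma> m (Suc n)) (mass \<gamma> m n)"
    unfolding eq[OF le_SucI[OF order_refl] order_refl] eq[OF le_SucI[OF order_refl] le_SucI[OF order_refl]]
    by (rule cond_eq_sum[OF fin _ level_subalgebras(2) meas meas nonneg nonneg eqW]) auto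
qed

lemma mass_finite: "(\<integral>\<^sup>+\<omega>. ennreal (mass \<gamma> 0 0 \<omega>) \<partial>M) < \<infinity>"
proof -
  have "integrable M (\<lambda>\<omega>. \<Sum>\<delta>\<in>{\<delta>\<in>words b. length \<delta> = length \<gamma>}. (W_weight (take 0 \<delta>) \<omega> * B_weight (take 0 \<delta>) \<omega>) *
     (of_bool (take (length \<gamma>) \<delta> = \<gamma>) * measure \<sigma> (cylinder b \<delta>)))"
    using W_weight_integrable(2)[of "[]"] by (auto simp: B_weight_def words_def)
  also have "(\<lambda>\<omega>. \<Sum>\<delta>\<in>{\<delta>\<in>words b. length \<delta> = length \<gamma>}. (W_weight (take 0 \<delta>) \<omega> * B_weight (take 0 \<delta>) \<omega>) *
     (of_bool (take (length \<gamma>) \<delta> = \<gamma>) * measure \<sigma> (cylinder b \<delta>))) = mass \<gamma> 0 0"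
    by (intro ext mass_eq_sum[symmetric]) auto
  finally show ?thesis using mass_nonneg by (subst nn_integral_eq_integral) auto
qed

lemma mass_limits:
  "AE \<omega> in M. \<forall>\<gamma>\<in>words b. (\<forall>m. convergent (\<lambda>n. mass \<gamma> m n \<omega>)) \<and>
    (\<exists>z. (\<lambda>m. lim (\<lambda>n. mass \<gamma> m n \<omega>)) \<longlonglongrightarrow> z \<and> (\<lambda>n. mass \<gamma> n n \<omega>) \<longlonglongrightarrow> z)"
  by (intro AE_ball_countable' countable_words
      two_parameter_martingale_limits[where H = B_level and L = W_level and G = "WB_filtration b M W B"]
      level_subalgebras level_mono WB_filtration_le_level mass_measurable mass_nonneg mass_finite cond_eq_mass) auto

text \<open>Only the identification of the masses remains. For the percolated limit measure, the indicator
  of a cylinder times \<open>Q\<^bsub>\<beta>,m\<^esub>\<close> is a continuous function on the boundary, so its integral against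
  the weak limit of \<open>Q\<^bsub>F,n\<^esub>\<sigma>\<close> is the limit of \<open>mass \<gamma> m n\<close> in \<open>n\<close>.\<close>

lemma percolation_of_limit:
  "AE \<omega> in M.
      Q_infinity b QF \<sigma> \<omega> \<in> finite_borel_measures b
    \<and> weakly_converges b (\<lambda>n. Q_measure QF n \<sigma> \<omega>) (Q_infinity b QF \<sigma> \<omega>)
    \<and> Q_infinity b (\<lambda>n t \<omega>. beta_cascade B n t \<omega> * QF n t \<omega>) \<sigma> \<omega> \<in> finite_borel_measures b
    \<and> weakly_converges b (\<lambda>n. Q_measure (\<lambda>n t \<omega>. beta_cascade B n t \<omega> * QF n t \<omega>) n \<sigma> \<omega>)
        (Q_infinity b (\<lambda>n t \<omega>. beta_cascade B n t \<omega> * QF n t \<omega>) \<sigma> \<omega>)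
    \<and> weakly_converges b (\<lambda>m. Q_measure (beta_cascade B) m (Q_infinity b QF \<sigma> \<omega>) \<omega>)
        (Q_infinity b (beta_cascade B) (Q_infinity b QF \<sigma> \<omega>) \<omega>)
    \<and> Q_infinity b (\<lambda>n t \<omega>. beta_cascade B n t \<omega> * QF n t \<omega>) \<sigma> \<omega> =
        Q_infinity b (beta_cascade B) (Q_infinity b QF \<sigma> \<omega>) \<omega>"
  using mass_limits AE_space
proof eventually_elim
  case (elim \<omega>)
  let ?Q = "\<lambda>n t \<omega>. beta_cascade B n t \<omega> * QF n t \<omega>"
  let ?\<mu> = "Q_infinity b QF \<sigma> \<omega>" and ?\<nu> = "Q_infinity b ?Q \<sigma> \<omega>"
  let ?\<rho> = "Q_infinity b (beta_cascade B) ?\<mu> \<omega>"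
  have "1 \<le> b" using b by simp
  note sp = finite_borel_measuresD(3)[OF \<sigma>]
  have conv: "convergent (\<lambda>n. mass \<gamma> m n \<omega>)" if "\<gamma> \<in> words b" for \<gamma> m using elim(1) that by blast
  obtain z where z: "\<And>\<gamma>. \<gamma> \<in> words b \<Longrightarrow> (\<lambda>m. lim (\<lambda>n. mass \<gamma> m n \<omega>)) \<longlonglongrightarrow> z \<gamma>"
    "\<And>\<gamma>. \<gamma> \<in> words b \<Longrightarrow> (\<lambda>n. mass \<gamma> n n \<omega>) \<longlonglongrightarrow> z \<gamma>"
    using bchoice[of "words b" "\<lambda>\<gamma> z. (\<lambda>m. lim (\<lambda>n. mass \<gamma> m n \<omega>)) \<longlonglongrightarrow> z \<and> (\<lambda>n. mass \<gamma> n n \<omega>) \<longlonglongrightarrow> z"] elim(1)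
    by blast

  have QF_nonneg: "0 \<le> QF n t \<omega>" if "t \<in> boundary b" for n t
    using W_weight_nonneg[OF tprefix_in_words[OF that] elim(2)] by (simp add: QF_eq[OF that elim(2)])
  have QF_fin: "Q_measure QF n \<sigma> \<omega> \<in> finite_borel_measures b" for n
    unfolding Q_measure_def
    by (rule density_prefix_function(1)[OF \<sigma>, where g = "\<lambda>\<delta>. W_weight \<delta> \<omega>" and n = n];
        (erule QF_eq[OF _ elim(2)] | erule QF_nonneg))
  have QF_prefix: "(\<integral>t. k (tprefix t m) \<partial>Q_measure QF n \<sigma> \<omega>) = (\<integral>t. W_weight (tprefix t n) \<omega> * k (tprefix t m) \<partial>\<sigma>)"
    for k :: "nat list \<Rightarrow> real" and m n
  proof -
    have "(\<integral>t. k (tprefix t m) \<partial>Q_measure QF n \<sigma> \<omega>) = (\<integral>t. QF n t \<omega> * k (tprefix t m) \<partial>\<sigma>)"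
      unfolding Q_measure_def
      by (rule density_prefix_function(2)[OF \<sigma>, where g = "\<lambda>\<delta>. W_weight \<delta> \<omega>" and n = n];
        (erule QF_eq[OF _ elim(2)] | erule QF_nonneg))
    also have "\<dots> = (\<integral>t. W_weight (tprefix t n) \<omega> * k (tprefix t m) \<partial>\<sigma>)"
      by (intro Bochner_Integration.integral_cong) (auto simp: QF_eq elim(2) sp)
    finally show ?thesis .
  qed
  have QF_cyl: "measure (Q_measure QF n \<sigma> \<omega>) (cylinder b \<gamma>) = mass \<gamma> 0 n \<omega>" for \<gamma> n
    using QF_prefix[of n "\<lambda>\<delta>. of_bool (\<delta> = \<gamma>)" "length \<gamma>"]
    by (simp add: integral_cylinder_indicator[OF QF_fin] mass_def B_weight_def mult.commute)
  have \<mu>: "?\<mu> \<in> finite_borel_measures b" "weakly_converges b (\<lambda>n. Q_measure QF n \<sigma> \<omega>) ?\<mu>"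
    unfolding Q_infinity_def
    by (rule weak_limit_if_cylinders_converge[OF QF_fin \<open>1 \<le> b\<close>]; simp add: QF_cyl conv)+

  have Q_eq: "?Q n t \<omega> = B_weight (tprefix t n) \<omega> * W_weight (tprefix t n) \<omega>" if "t \<in> boundary b" for n t
    using QF_eq[OF that elim(2)] by (simp add: beta_cascade_eq)
  have Q_nonneg: "0 \<le> ?Q n t \<omega>" if "t \<in> boundary b" for n t
    using W_weight_nonneg[OF tprefix_in_words[OF that] elim(2)] B_weight_nonneg[OF tprefix_in_words[OF that] elim(2)]
    by (simp add: Q_eq[OF that])
  have Q_fin: "Q_measure ?Q n \<sigma> \<omega> \<in> finite_borel_measures b" for n
    unfolding Q_measure_def
    by (rule density_prefix_function(1)[OF \<sigma>, where g = "\<lambda>\<delta>. B_weight \<delta> \<omega> * W_weight \<delta> \<omega>" and n = n];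
        (erule Q_eq | erule Q_nonneg))
  have Q_cyl: "measure (Q_measure ?Q n \<sigma> \<omega>) (cylinder b \<gamma>) = mass \<gamma> n n \<omega>" for \<gamma> n
  proof -
    have "measure (Q_measure ?Q n \<sigma> \<omega>) (cylinder b \<gamma>) =
        (\<integral>t. ?Q n t \<omega> * of_bool (tprefix t (length \<gamma>) = \<gamma>) \<partial>\<sigma>)"
      unfolding integral_cylinder_indicator[OF Q_fin, symmetric] unfolding Q_measure_def
      by (rule density_prefix_function(2)[OF \<sigma>, where g = "\<lambda>\<delta>. B_weight \<delta> \<omega> * W_weight \<delta> \<omega>" and n = n];
        (erule Q_eq | erule Q_nonneg))
    also have "\<dots> = mass \<gamma> n n \<omega>"
      unfolding mass_def by (intro Bochner_Integration.integral_cong) (auto simp: Q_eq sp)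
    finally show ?thesis .
  qed
  have \<nu>: "?\<nu> \<in> finite_borel_measures b" "weakly_converges b (\<lambda>n. Q_measure ?Q n \<sigma> \<omega>) ?\<nu>"
    "\<gamma> \<in> words b \<Longrightarrow> measure ?\<nu> (cylinder b \<gamma>) = lim (\<lambda>n. measure (Q_measure ?Q n \<sigma> \<omega>) (cylinder b \<gamma>))" for \<gamma>
    unfolding Q_infinity_def
    by (rule weak_limit_if_cylinders_converge[OF Q_fin \<open>1 \<le> b\<close>]; (simp add: Q_cyl convergentI[OF z(2)])?)+

  have beta_nonneg: "0 \<le> beta_cascade B m t \<omega>" if "t \<in> boundary b" for m t
    using B_weight_nonneg[OF tprefix_in_words[OF that] elim(2)] by (simp add: beta_cascade_eq)
  have beta_fin: "Q_measure (beta_cascade B) m ?\<mu> \<omega> \<in> finite_borel_measures b" for m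
    unfolding Q_measure_def
    by (rule density_prefix_function(1)[OF \<mu>(1), where g = "\<lambda>\<delta>. B_weight \<delta> \<omega>" and n = m];
        (rule beta_cascade_eq | erule beta_nonneg))
  have beta_cyl: "measure (Q_measure (beta_cascade B) m ?\<mu> \<omega>) (cylinder b \<gamma>) = lim (\<lambda>n. mass \<gamma> m n \<omega>)" for \<gamma> m
  proof -
    define N where "N = max m (length \<gamma>)"
    define k where "k \<delta> = B_weight (take m \<delta>) \<omega> * of_bool (take (length \<gamma>) \<delta> = \<gamma>)" for \<delta>
    have k: "k (tprefix t N) = B_weight (tprefix t m) \<omega> * of_bool (tprefix t (length \<gamma>) = \<gamma>)" for t
      by (simp add: k_def N_def take_tprefix)
    have "measure (Q_measure (beta_cascade B) m ?\<mu> \<omega>) (cylinder b \<gamma>) =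
        (\<integral>t. beta_cascade B m t \<omega> * of_bool (tprefix t (length \<gamma>) = \<gamma>) \<partial>?\<mu>)"
      unfolding integral_cylinder_indicator[OF beta_fin, symmetric] unfolding Q_measure_def
      by (rule density_prefix_function(2)[OF \<mu>(1), where g = "\<lambda>\<delta>. B_weight \<delta> \<omega>" and n = m];
        (rule beta_cascade_eq | erule beta_nonneg))
    also have "\<dots> = (\<integral>t. k (tprefix t N) \<partial>?\<mu>)" by (simp add: k beta_cascade_eq)
    finally have eq: "measure (Q_measure (beta_cascade B) m ?\<mu> \<omega>) (cylinder b \<gamma>) = (\<integral>t. k (tprefix t N) \<partial>?\<mu>)" .
    have "(\<lambda>n. \<integral>t. k (tprefix t N) \<partial>Q_measure QF n \<sigma> \<omega>) \<longlonglongrightarrow> (\<integral>t. k (tprefix t N) \<partial>?\<mu>)"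
      by (rule weakly_converges_integral_prefix[OF \<mu>(2)])
    also have "(\<lambda>n. \<integral>t. k (tprefix t N) \<partial>Q_measure QF n \<sigma> \<omega>) = (\<lambda>n. mass \<gamma> m n \<omega>)"
      unfolding QF_prefix mass_def by (simp add: k mult_ac)
    finally show ?thesis unfolding eq by (simp add: limI)
  qed
  have \<rho>: "?\<rho> \<in> finite_borel_measures b"
    "weakly_converges b (\<lambda>m. Q_measure (beta_cascade B) m ?\<mu> \<omega>) ?\<rho>"
    "\<gamma> \<in> words b \<Longrightarrow> measure ?\<rho> (cylinder b \<gamma>) = lim (\<lambda>m. measure (Q_measure (beta_cascade B) m ?\<mu> \<omega>) (cylinder b \<gamma>))" for \<gamma>
    unfolding Q_infinity_def[of b "beta_cascade B" ?\<mu>]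
    by (rule weak_limit_if_cylinders_converge[OF beta_fin \<open>1 \<le> b\<close>]; (simp add: beta_cyl convergentI[OF z(1)])?)+
  have "?\<nu> = ?\<rho>"
  proof (rule measure_eq_if_eq_on_cylinders[OF \<nu>(1) \<rho>(1)])
    fix \<gamma> assume \<gamma>: "\<gamma> \<in> words b"
    show "measure ?\<nu> (cylinder b \<gamma>) = measure ?\<rho> (cylinder b \<gamma>)"
      using \<nu>(3)[OF \<gamma>] \<rho>(3)[OF \<gamma>] limI[OF z(1)[OF \<gamma>]] limI[OF z(2)[OF \<gamma>]] by (simp add: Q_cyl beta_cyl)
  qed
  then show ?case using \<mu> \<nu>(1,2) \<rho>(2) by blast
qed

end

text \<open>The martingale step from generation \<open>n\<close> to \<open>n + 1\<close> is taken first in \<open>B\<close>, with all of \<open>W\<close> known,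
  and then in \<open>W\<close>, with all of \<open>B\<close> known; the events of the joint filtration belong to both.\<close>

lemma percolated_weighted_cascade:
  "weighted_cascade b M (WB_path_sigma M W B) (WB_filtration b M W B) W (beta_weights B F)
    (\<lambda>n t \<omega>. beta_cascade B n t \<omega> * QF n t \<omega>)"
  unfolding weighted_cascade_def
proof (intro conjI ballI allI)
  let ?Q = "\<lambda>n t \<omega>. beta_cascade B n t \<omega> * QF n t \<omega>"
  have weights_eq: "beta_weights B F \<gamma> \<omega> = B_weight \<gamma> \<omega> * F \<gamma> \<omega>" for \<gamma> \<omega>
    by (simp add: beta_weights_def B_weight_def)
  show "?Q n t \<omega> = (\<Prod>j=0..n. W (tprefix t j) \<omega>) * beta_weights B F (tprefix t n) \<omega>"
    if "t \<in> boundary b" "\<omega> \<in> space M" for n t \<omega>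
    using cascade that by (auto simp: weighted_cascade_def weights_eq beta_cascade_eq)
  show "beta_weights B F \<gamma> \<in> WB_path_sigma M W B \<gamma> \<rightarrow>\<^sub>M nonneg_borel" if \<gamma>: "\<gamma> \<in> words b" for \<gamma>
  proof -
    let ?S = "sigma_rvs M {take j \<gamma> |j. 1 \<le> j \<and> j \<le> length \<gamma>} B"
    have "subalgebra M (W_path_sigma M W \<gamma>)"
      unfolding W_path_sigma_def using W take_in_words[OF \<gamma>] by (intro subalgebra_sigma_rvs) auto
    moreover have "subalgebra M ?S"
      using take_in_words[OF \<gamma>] by (intro subalgebra_sigma_rvs B_rv) auto
    ultimately have sub: "subalgebra (WB_path_sigma M W B \<gamma>) (W_path_sigma M W \<gamma>)" "subalgebra (WB_path_sigma M W B \<gamma>) ?S"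
      unfolding WB_path_sigma_def by (rule subalgebra_sigma_join)+
    have spW: "space (W_path_sigma M W \<gamma>) = space M" and spWB: "space (WB_path_sigma M W B \<gamma>) = space M"
      by (simp_all add: W_path_sigma_def WB_path_sigma_def)
    have F: "F \<gamma> \<in> W_path_sigma M W \<gamma> \<rightarrow>\<^sub>M nonneg_borel" using cascade \<gamma> by (simp add: weighted_cascade_def)
    have "B_weight \<gamma> \<in> borel_measurable ?S"
      unfolding B_weight_def[abs_def]
    proof (rule borel_measurable_prod)
      fix j assume "j \<in> {1..length \<gamma>}"
      then have "B (take j \<gamma>) \<in> ?S \<rightarrow>\<^sub>M nonneg_borel"
        using take_in_words[OF \<gamma>] by (intro measurable_sigma_rvs) (auto intro: B_nonneg)
      then show "B (take j \<gamma>) \<in> borel_measurable ?S" by (simp add: measurable_nonneg_borel_iff)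
    qed
    then have "(\<lambda>\<omega>. B_weight \<gamma> \<omega> * F \<gamma> \<omega>) \<in> borel_measurable (WB_path_sigma M W B \<gamma>)"
      using F measurable_from_subalg[OF sub(1)] measurable_from_subalg[OF sub(2)]
      by (intro borel_measurable_times) (auto simp: measurable_nonneg_borel_iff)
    moreover have "0 \<le> B_weight \<gamma> \<omega> * F \<gamma> \<omega>" if "\<omega> \<in> space M" for \<omega>
      using F that B_weight_nonneg[OF \<gamma> that] by (simp add: measurable_nonneg_borel_iff spW)
    ultimately show ?thesis by (simp add: measurable_nonneg_borel_iff spWB weights_eq[abs_def])
  qed
  show "positive_T_martingale b M (WB_filtration b M W B) ?Q"
    unfolding positive_T_martingale_def
  proof (intro conjI ballI allI)
    show "0 \<le> ?Q n t \<omega>" if "t \<in> boundary b" "\<omega> \<in> space M" for n t \<omega>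
      using that W_weight_nonneg[OF tprefix_in_words] B_weight_nonneg[OF tprefix_in_words]
      by (auto simp: QF_eq beta_cascade_eq)
    have "AE \<omega> in M. \<forall>n. (\<lambda>t. QF n t \<omega>) \<in> borel_measurable (borel_boundary b)"
      using cascade by (simp add: weighted_cascade_def positive_T_martingale_def)
    then show "AE \<omega> in M. \<forall>n. (\<lambda>t. ?Q n t \<omega>) \<in> borel_measurable (borel_boundary b)"
    proof eventually_elim
      case (elim \<omega>)
      have "(\<lambda>t. B_weight (tprefix t n) \<omega>) \<in> borel_measurable (borel_boundary b)" for n
        by (rule measurable_compose[OF tprefix_measurable]) simp
      with elim show ?case unfolding beta_cascade_eq by (intro allI borel_measurable_times) auto
    qed
    fix t assume t: "t \<in> boundary b"
    note words = tprefix_in_words[OF t]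
    let ?G = "WB_filtration b M W B"
    have G: "subalgebra M (?G n)" for n unfolding WB_filtration_eq by (intro subalgebra_sigma_join subalgebras)
    have Gmono: "sets (?G m) \<subseteq> sets (?G n)" if "m \<le> n" for m n
      unfolding WB_filtration_eq by (intro sets_sigma_join_mono subalgebras sets_mono[OF that])
    have Q_eq: "?Q n t \<omega> = W_weight (tprefix t n) \<omega> * B_weight (tprefix t n) \<omega>" if "\<omega> \<in> space M" for n \<omega>
      using QF_eq[OF t that] by (simp add: beta_cascade_eq)
    have nn: "0 \<le> ?Q n t \<omega>" if "\<omega> \<in> space M" for n \<omega>
      using W_weight_nonneg[OF words that] B_weight_nonneg[OF words that] by (simp add: Q_eq[OF that])
    have meas: "?Q n t \<in> borel_measurable (?G n)" for n
    proof -
      have "(\<lambda>\<omega>. W_weight (tprefix t n) \<omega> * B_weight (tprefix t n) \<omega>) \<in> borel_measurable (?G n)"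
        using level_measurable(5,6)[OF words[of n]] by simp
      moreover have "space (?G n) = space M" using G by (simp add: subalgebra_def)
      ultimately show ?thesis
        using measurable_cong[of "?G n" "?Q n t" "\<lambda>\<omega>. W_weight (tprefix t n) \<omega> * B_weight (tprefix t n) \<omega>" borel] Q_eq
        by simp
    qed
    have step: "cond_eq M (?G n) (?Q (Suc n) t) (?Q n t)" for n
      unfolding cond_eq_def
    proof
      fix A assume A: "A \<in> sets (?G n)"
      have AB: "A \<in> sets (B_level n)" "A \<in> sets (W_level n)" using A WB_filtration_le_level by auto
      have "(\<integral>\<^sup>+\<omega>\<in>A. ennreal (?Q (Suc n) t \<omega>) \<partial>M) =
          (\<integral>\<^sup>+\<omega>\<in>A. ennreal (W_weight (tprefix t (Suc n)) \<omega> * B_weight (tprefix t (Suc n)) \<omega>) \<partial>M)"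
        by (intro nn_integral_cong) (simp add: Q_eq)
      also have "\<dots> = (\<integral>\<^sup>+\<omega>\<in>A. ennreal (W_weight (tprefix t (Suc n)) \<omega> * B_weight (tprefix t n) \<omega>) \<partial>M)"
        using cond_eq_product(1)[OF t, of n "Suc n"] AB(1) by (simp add: cond_eq_def)
      also have "\<dots> = (\<integral>\<^sup>+\<omega>\<in>A. ennreal (W_weight (tprefix t n) \<omega> * B_weight (tprefix t n) \<omega>) \<partial>M)"
        using cond_eq_product(2)[OF t, of n n] AB(2) by (simp add: cond_eq_def)
      also have "\<dots> = (\<integral>\<^sup>+\<omega>\<in>A. ennreal (?Q n t \<omega>) \<partial>M)"
        by (intro nn_integral_cong) (simp add: Q_eq)
      finally show "(\<integral>\<^sup>+\<omega>\<in>A. ennreal (?Q (Suc n) t \<omega>) \<partial>M) = (\<integral>\<^sup>+\<omega>\<in>A. ennreal (?Q n t \<omega>) \<partial>M)" .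
    qed
    have "(\<integral>\<^sup>+\<omega>. ennreal (?Q 0 t \<omega>) \<partial>M) = (\<integral>\<^sup>+\<omega>. ennreal (W_weight [] \<omega>) \<partial>M)"
      by (intro nn_integral_cong) (simp add: Q_eq B_weight_def)
    then have fin: "(\<integral>\<^sup>+\<omega>. ennreal (?Q 0 t \<omega>) \<partial>M) < \<infinity>" using W_weight_finite[OF words, of 0] by simp
    show "martingale M ?G (\<lambda>n. ?Q n t)"
      by (rule martingale_if_cond_eq[where X = "\<lambda>n. ?Q n t", OF G Gmono meas nn fin step])
  qed
qed

end

theorem theorem2p4:
  fixes b :: nat and M :: "'a measure" and \<beta> :: real
    and p0 :: "real measure" and q :: "nat \<Rightarrow> (nat \<Rightarrow> real) \<Rightarrow> real measure"
    and W F B :: "nat list \<Rightarrow> 'a \<Rightarrow> real"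
    and QF Q :: "nat \<Rightarrow> (nat \<Rightarrow> nat) \<Rightarrow> 'a \<Rightarrow> real"
  assumes "b \<ge> 2"
    and "prob_space M"
    and "cascade_generator b M p0 q W"
    and "weighted_cascade b M (W_path_sigma M W) (W_filtration b M W) W F QF"
    and "(\<integral>\<omega>. W [] \<omega> * F [] \<omega> \<partial>M) > 0"
    and "\<beta> \<ge> 0"
    and "beta_generator b M \<beta> B"
    and "prob_space.indep_var M
           (PiM (words b) (\<lambda>_. nonneg_borel)) (\<lambda>\<omega>. \<lambda>\<gamma>\<in>words b. W \<gamma> \<omega>)
           (PiM {\<gamma>\<in>words b. 1 \<le> length \<gamma>} (\<lambda>_. nonneg_borel))
           (\<lambda>\<omega>. \<lambda>\<gamma>\<in>{\<gamma>\<in>words b. 1 \<le> length \<gamma>}. B \<gamma> \<omega>)"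
    and "Q = (\<lambda>n t \<omega>. beta_cascade B n t \<omega> * QF n t \<omega>)"
  shows "weighted_cascade b M (WB_path_sigma M W B) (WB_filtration b M W B) W (beta_weights B F) Q
    \<and> (\<forall>\<sigma>\<in>finite_borel_measures b. AE \<omega> in M.
          Q_infinity b QF \<sigma> \<omega> \<in> finite_borel_measures b
        \<and> weakly_converges b (\<lambda>n. Q_measure QF n \<sigma> \<omega>) (Q_infinity b QF \<sigma> \<omega>)
        \<and> Q_infinity b Q \<sigma> \<omega> \<in> finite_borel_measures b
        \<and> weakly_converges b (\<lambda>n. Q_measure Q n \<sigma> \<omega>) (Q_infinity b Q \<sigma> \<omega>)
        \<and> weakly_converges b (\<lambda>m. Q_measure (beta_cascade B) m (Q_infinity b QF \<sigma> \<omega>) \<omega>)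
            (Q_infinity b (beta_cascade B) (Q_infinity b QF \<sigma> \<omega>) \<omega>)
        \<and> Q_infinity b Q \<sigma> \<omega> = Q_infinity b (beta_cascade B) (Q_infinity b QF \<sigma> \<omega>) \<omega>)"
proof -
  interpret prob_space M by fact
  interpret percolated_cascade M b \<beta> W F B QF
    using assms by unfold_locales (auto simp: cascade_generator_def)
  show ?thesis
    unfolding \<open>Q = _\<close> using percolated_weighted_cascade percolation_of_limit by blast
qed

end
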